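(* Let $G$ be a finite simple graph that is $\{\mathrm{ISK4},\mathrm{wheel}\}$-free. Then at least one of the following holds: (i) $G$ is series-parallel; (ii) $G$ is the line graph of a chordless graph with maximum degree at most three; (iii) $G$ is a complete bipartite graph; (iv) $G$ has a clique-cutset or a proper 2-cutset.
   Context: An ISK4 in a graph $G$ is an induced subgraph of $G$ isomorphic to a subdivision of $K_4$. A wheel is a graph consisting of a chordless cycle together with a vertex that has at least three neighbors in the cycle. $G$ is $\{\mathrm{ISK4},\mathrm{wheel}\}$-free if it has no ISK4 and no induced subgraph isomorphic to a wheel. A graph is series-parallel if it contains no subdivision of $K_4$ as a (not necessarily induced) subgraph. The line graph $L(H)$ of a graph $H$ has vertex set $E(H)$, two vertices adjacent iff the corresponding edges share an endpoint. A graph is chordless if all its cycles are induced. A cutset of $G$ is a (possibly empty) set of vertices whose deletion yields a disconnected graph; a clique-cutset is a clique (possibly empty) that is a cutset (so a disconnected graph has the empty clique-cutset). A proper 2-cutset of $G$ is a cutset $\{a,b\}$ consisting of two non-adjacent vertices such that $V(G)\setminus\{a,b\}$ can be partitioned into two non-empty sets $X,Y$ with no edge between $X$ and $Y$ and such that neither $G[X\cup\{a,b\}]$ nor $G[Y\cup\{a,b\}]$ is a path between $a$ and $b$. *)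

theory Defs
  imports "Graph_Theory.Kuratowski" "Graph_Theory.Digraph_Isomorphism"
begin

text \<open>
  Finite simple graphs are the finite, symmetric, loop-free digraphs without parallel arcs,
  i.e. \<^term>\<open>G :: 'a pair_pre_digraph\<close> with \<^term>\<open>pair_graph G\<close>: every undirected edge
  is represented by its two arcs, and the graph may be empty.
\<close>

subsection \<open>Subdivisions of the complete graph on four vertices\<close>

text \<open>
  The relation \<^term>\<open>subdivision_pair K H\<close> keeps the vertices of \<open>K\<close> as the branch vertices of \<open>H\<close>.
  As \<open>K\<close> ranges over all complete graphs on four vertices of the given type, the class
  below is closed under isomorphism.
\<close>
definition K4_subdivision :: "'a pair_pre_digraph \<Rightarrow> bool" where
  "K4_subdivision H \<longleftrightarrow>
     (\<exists>K :: 'a pair_pre_digraph. complete_digraph 4 (with_proj K) \<and> subdivision_pair K H)"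

definition has_ISK4 :: "'a pair_pre_digraph \<Rightarrow> bool" where
  "has_ISK4 G \<longleftrightarrow>
     (\<exists>H :: 'a pair_pre_digraph. induced_subgraph (with_proj H) (with_proj G) \<and> K4_subdivision H)"

definition series_parallel :: "'a pair_pre_digraph \<Rightarrow> bool" where
  "series_parallel G \<longleftrightarrow>
     \<not> (\<exists>H :: 'a pair_pre_digraph. subgraph (with_proj H) (with_proj G) \<and> K4_subdivision H)"

subsection \<open>Cycles and wheels\<close>

text \<open>
  In a symmetric digraph \<^const>\<open>pre_digraph.cycle\<close> also accepts the closed walk \<open>a, b, a\<close>,
  hence the bound on the length. A cycle is given by its list of arcs.
\<close>
definition undirected_cycle :: "'a pair_pre_digraph \<Rightarrow> ('a \<times> 'a) awalk \<Rightarrow> bool" where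
  "undirected_cycle G p \<longleftrightarrow> pre_digraph.cycle (with_proj G) p \<and> 3 \<le> length p"

definition graph_of_arcs :: "('a \<times> 'a) awalk \<Rightarrow> 'a pair_pre_digraph" where
  "graph_of_arcs p = \<lparr> pverts = fst ` set p \<union> snd ` set p, parcs = set p \<union> (set p)\<inverse> \<rparr>"

definition chordless_cycle :: "'a pair_pre_digraph \<Rightarrow> ('a \<times> 'a) awalk \<Rightarrow> bool" where
  "chordless_cycle G p \<longleftrightarrow>
     undirected_cycle G p \<and> induced_subgraph (with_proj (graph_of_arcs p)) (with_proj G)"

text \<open>
  Triangles are allowed as rims; the only additional wheel is the complete graph on four
  vertices, which is itself a (trivial) subdivision of that graph.
\<close>
definition wheel :: "'a pair_pre_digraph \<Rightarrow> bool" where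
  "wheel W \<longleftrightarrow> pair_graph W \<and>
     (\<exists>p v. chordless_cycle W p \<and> v \<notin> pverts (graph_of_arcs p) \<and>
        pverts W = insert v (pverts (graph_of_arcs p)) \<and>
        3 \<le> card {u \<in> pverts (graph_of_arcs p). (v, u) \<in> parcs W})"

definition has_wheel :: "'a pair_pre_digraph \<Rightarrow> bool" where
  "has_wheel G \<longleftrightarrow>
     (\<exists>W :: 'a pair_pre_digraph. induced_subgraph (with_proj W) (with_proj G) \<and> wheel W)"

definition ISK4_wheel_free :: "'a pair_pre_digraph \<Rightarrow> bool" where
  "ISK4_wheel_free G \<longleftrightarrow> \<not> has_ISK4 G \<and> \<not> has_wheel G"

definition chordless_graph :: "'a pair_pre_digraph \<Rightarrow> bool" where
  "chordless_graph G \<longleftrightarrow> (\<forall>p. undirected_cycle G p \<longrightarrow> chordless_cycle G p)"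

subsection \<open>Line graphs and complete bipartite graphs\<close>

definition undirected_edges :: "'a pair_pre_digraph \<Rightarrow> 'a set set" where
  "undirected_edges H = {{u, v} | u v. (u, v) \<in> parcs H}"

definition line_graph :: "'a pair_pre_digraph \<Rightarrow> 'a set pair_pre_digraph" where
  "line_graph H = \<lparr> pverts = undirected_edges H,
     parcs = {(e, f). e \<in> undirected_edges H \<and> f \<in> undirected_edges H \<and> e \<noteq> f \<and> e \<inter> f \<noteq> {}} \<rparr>"

text \<open>In a symmetric digraph the out-degree of a vertex is its degree in the undirected graph.\<close>
definition max_degree_le :: "nat \<Rightarrow> 'a pair_pre_digraph \<Rightarrow> bool" where
  "max_degree_le k H \<longleftrightarrow> (\<forall>v \<in> pverts H. out_degree (with_proj H) v \<le> k)"

text \<open>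
  The root graph \<open>H\<close> may be taken on natural numbers without loss of generality, since every
  finite graph is isomorphic to such a graph. Being a line graph is meant up to isomorphism.
\<close>
definition line_graph_of_chordless_subcubic :: "'a pair_pre_digraph \<Rightarrow> bool" where
  "line_graph_of_chordless_subcubic G \<longleftrightarrow>
     (\<exists>H :: nat pair_pre_digraph. pair_graph H \<and> chordless_graph H \<and> max_degree_le 3 H \<and>
        digraph_iso (with_proj (line_graph H)) (with_proj G))"

text \<open>Both sides are required to be non-empty.\<close>
definition complete_bipartite :: "'a pair_pre_digraph \<Rightarrow> bool" where
  "complete_bipartite G \<longleftrightarrow>
     (\<exists>m n. 0 < m \<and> 0 < n \<and> complete_bipartite_digraph m n (with_proj G))"

subsection \<open>Cutsets\<close>

text \<open>
  \<^const>\<open>Digraph_Component.connected\<close> is false for the empty graph; the empty graph is not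
  disconnected either, so the whole vertex set is never a cutset.
\<close>
definition disconnected :: "('a, 'b) pre_digraph \<Rightarrow> bool" where
  "disconnected H \<longleftrightarrow> verts H \<noteq> {} \<and> \<not> Digraph_Component.connected H"

definition cutset :: "'a pair_pre_digraph \<Rightarrow> 'a set \<Rightarrow> bool" where
  "cutset G S \<longleftrightarrow> S \<subseteq> pverts G \<and> disconnected (with_proj G \<restriction> (pverts G - S))"

definition clique :: "'a pair_pre_digraph \<Rightarrow> 'a set \<Rightarrow> bool" where
  "clique G S \<longleftrightarrow> S \<subseteq> pverts G \<and> (\<forall>u \<in> S. \<forall>v \<in> S. u \<noteq> v \<longrightarrow> (u, v) \<in> parcs G)"

definition has_clique_cutset :: "'a pair_pre_digraph \<Rightarrow> bool" where
  "has_clique_cutset G \<longleftrightarrow> (\<exists>S. clique G S \<and> cutset G S)"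

text \<open>The whole graph \<open>H\<close> is a path with end vertices \<open>a\<close> and \<open>b\<close>.\<close>
definition is_path_between :: "('a, 'a \<times> 'a) pre_digraph \<Rightarrow> 'a \<Rightarrow> 'a \<Rightarrow> bool" where
  "is_path_between H a b \<longleftrightarrow>
     (\<exists>p. pre_digraph.apath H a p b \<and> verts H = set (pre_digraph.awalk_verts H a p) \<and>
        arcs H = set p \<union> (set p)\<inverse>)"

definition proper_2_cutset :: "'a pair_pre_digraph \<Rightarrow> 'a \<Rightarrow> 'a \<Rightarrow> bool" where
  "proper_2_cutset G a b \<longleftrightarrow>
     a \<noteq> b \<and> (a, b) \<notin> parcs G \<and> cutset G {a, b} \<and>
     (\<exists>X Y. X \<noteq> {} \<and> Y \<noteq> {} \<and> X \<inter> Y = {} \<and> X \<union> Y = pverts G - {a, b} \<and>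
        (\<forall>x \<in> X. \<forall>y \<in> Y. (x, y) \<notin> parcs G) \<and>
        \<not> is_path_between (with_proj G \<restriction> (X \<union> {a, b})) a b \<and>
        \<not> is_path_between (with_proj G \<restriction> (Y \<union> {a, b})) a b)"

definition has_proper_2_cutset :: "'a pair_pre_digraph \<Rightarrow> bool" where
  "has_proper_2_cutset G \<longleftrightarrow> (\<exists>a b. proper_2_cutset G a b)"

end

theory Submission
  imports Defs
begin

text \<open>
  Assume that there is no clique-cutset. If the ends of an edge had two common neighbours, a path
  between these that avoids the edge would contain the rim of a wheel. So every edge lies in at most
  one triangle, and the maximal cliques through a vertex overlap only in that vertex.

  If there is no claw, every vertex lies in at most two maximal cliques, each of size at most three:
  the cliques are the vertices of a subcubic root graph, and a chord of a cycle of the root graph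
  would be the centre of a wheel.

  If there is a claw, the key fact is that a connected set attached to exactly three vertices of a
  hole produces an ISK4 or a wheel. It yields first an induced theta (three internally disjoint paths
  between non-adjacent \<open>v\<close> and \<open>w\<close>, without edges between different paths) at the centre of the claw,
  and then that a connected set outside a theta which attaches to the interiors of two of its paths
  exists only if the theta is \<open>K\<^sub>2\<^sub>,\<^sub>3\<close> and some vertex of the set completes it to \<open>K\<^sub>3\<^sub>,\<^sub>3\<close>. In that case a
  maximal complete bipartite induced subgraph is the whole graph. Otherwise \<open>{v, w}\<close> is a proper
  2-cutset, unless the graph is the theta itself, which has only two vertices of degree three and
  hence contains no subdivision of \<open>K\<^sub>4\<close>.
\<close>

text \<open>The key fact acts as a counting principle. Wheel-freeness leaves an outside vertex at
  most two neighbours on a hole, so in most configurations it remains to exhibit a hole and a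
  connected set off it that sees exactly three of its vertices; the case distinctions choose the
  hole and the set so that the count is three. The obstacle is to get paths with controlled
  attachments. Each of them is a shortest connection inside a connected set, and such sets come from
  deleting a clique: a single vertex, an edge, an edge with its common neighbour, or the attachments
  of a component to a complete bipartite subgraph. K_{3,3} is a genuine exception, since it contains
  neither an ISK4 nor a wheel; this is why a vertex that sees all three paths of a theta can be
  excluded only if some path has more than one inner vertex.\<close>

fun path_arcs :: "'a list \<Rightarrow> ('a \<times> 'a) set" where
  "path_arcs (x # y # zs) = {(x, y), (y, x)} \<union> path_arcs (y # zs)"
| "path_arcs _ = {}"

lemma path_arcs_subset: "path_arcs xs \<subseteq> set xs \<times> set xs"
  by (induction xs rule: path_arcs.induct) auto

lemma path_arcs_sym: "(x, y) \<in> path_arcs xs \<Longrightarrow> (y, x) \<in> path_arcs xs"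
  by (induction xs rule: path_arcs.induct) auto

lemma path_arcs_append: "path_arcs (xs @ y # zs) = path_arcs (xs @ [y]) \<union> path_arcs (y # zs)"
proof (induction xs rule: path_arcs.induct)
  case (1 x y zs) then show ?case by auto
next
  case ("2_2" v) then show ?case by (cases zs) auto
qed auto

lemma path_arcs_snoc: "xs \<noteq> [] \<Longrightarrow> path_arcs (xs @ [y]) = path_arcs xs \<union> {(last xs, y), (y, last xs)}"
  by (induction xs rule: path_arcs.induct) auto

text \<open>Replacing an edge by a path therefore creates no arc between branch vertices, unless the
  path is that edge. This keeps the replacements in \<open>K4_subdivision_replace_list\<close>
  independent of each other.\<close>

lemma path_arcs_ends:
  assumes "(x, y) \<in> path_arcs (u # xs @ [v])" "x \<notin> set xs" "y \<notin> set xs" "u \<notin> set xs" "v \<notin> set xs" "u \<noteq> v"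
  shows "xs = [] \<and> ((x, y) = (u, v) \<or> (x, y) = (v, u))"
proof (cases xs)
  case Nil then show ?thesis using assms by auto
next
  case (Cons z zs)
  have "(a, b) \<in> path_arcs (z # zs @ [v]) \<Longrightarrow> v \<notin> set (z # zs) \<Longrightarrow> a \<in> set (z # zs) \<or> b \<in> set (z # zs)" for a b
    by (induction zs arbitrary: z) auto
  then show ?thesis using assms Cons by auto
qed

subsection \<open>Induced paths and holes\<close>

text \<open>The combinatorics is done for an adjacency relation, with vertex lists as paths. The
  digraphs of the theorem enter only where spiders, wheels, cutsets and root graphs are
  translated.\<close>

locale sym_rel =
  fixes E :: "'a \<Rightarrow> 'a \<Rightarrow> bool" (infix "\<sim>" 50)
  assumes adj_sym: "x \<sim> y \<Longrightarrow> y \<sim> x" and adj_irrefl: "\<not> x \<sim> x"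
begin

lemma adj_commute: "x \<sim> y \<longleftrightarrow> y \<sim> x"
  using adj_sym by blast

lemma adj_neq: "x \<sim> y \<Longrightarrow> x \<noteq> y"
  using adj_irrefl by auto

fun ipath :: "'a list \<Rightarrow> bool" where
  "ipath [] = True"
| "ipath (x # xs) = (ipath xs \<and> x \<notin> set xs \<and> (xs \<noteq> [] \<longrightarrow> x \<sim> hd xs) \<and> (\<forall>y\<in>set (tl xs). \<not> x \<sim> y))"

lemma ipath_append: "ipath (xs @ ys) \<longleftrightarrow> ipath xs \<and> ipath ys \<and>
   (xs \<noteq> [] \<longrightarrow> ys \<noteq> [] \<longrightarrow> last xs \<sim> hd ys) \<and>
   (\<forall>x\<in>set xs. \<forall>y\<in>set ys. x \<noteq> y \<and> (x \<sim> y \<longrightarrow> x = last xs \<and> y = hd ys))"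
proof (induction xs)
  case (Cons x xs)
  show ?case
  proof (cases "xs = []")
    case True then show ?thesis by (cases ys) auto
  next
    case False
    then have h: "tl (xs @ ys) = tl xs @ ys" "hd (xs @ ys) = hd xs" by auto
    have lx: "last xs \<in> set xs" using False by simp
    show ?thesis using Cons False lx by (auto simp: h)
  qed
qed auto

lemma ipath_distinct: "ipath xs \<Longrightarrow> distinct xs"
  by (induction xs) auto

lemma ipath_Cons2: "ipath (x # y # ys) \<longleftrightarrow> ipath (y # ys) \<and> x \<sim> y \<and> x \<notin> set (y # ys) \<and> (\<forall>z\<in>set ys. \<not> x \<sim> z)"
  by auto

lemma ipath_rev: "ipath (rev xs) \<longleftrightarrow> ipath xs"
proof -
  have "ipath xs \<Longrightarrow> ipath (rev xs)" for xs
  proof (induction xs)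
    case (Cons x xs)
    show ?case
    proof (cases xs)
      case (Cons y ys)
      then show ?thesis using Cons.prems Cons.IH
        by (auto simp: ipath_append adj_commute last_rev)
    qed simp
  qed simp
  from this[of xs] this[of "rev xs"] show ?thesis by auto
qed

lemma ipath_adj_iff: "ipath xs \<Longrightarrow> x \<in> set xs \<Longrightarrow> y \<in> set xs \<Longrightarrow> x \<sim> y \<longleftrightarrow> (x, y) \<in> path_arcs xs"
proof (induction xs arbitrary: x y rule: path_arcs.induct)
  case (1 a b zs)
  have sub: "(u, w) \<in> path_arcs (b # zs) \<Longrightarrow> u \<in> set (b # zs) \<and> w \<in> set (b # zs)" for u w
    using path_arcs_subset[of "b # zs"] by blast
  have p: "ipath (b # zs)" "a \<sim> b" "a \<notin> set (b # zs)" "\<And>z. z \<in> set zs \<Longrightarrow> \<not> a \<sim> z"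
    using "1.prems"(1) unfolding ipath_Cons2 by auto
  consider "x = a" "y = a" | "x = a" "y \<in> set (b # zs)" | "x \<in> set (b # zs)" "y = a"
    | "x \<in> set (b # zs)" "y \<in> set (b # zs)"
    using "1.prems" by (metis set_ConsD)
  then show ?case
  proof cases
    case 1 then show ?thesis using p(3) sub[of a a] adj_irrefl by (auto simp: adj_neq)
  next
    case 2
    have "x \<sim> y \<longleftrightarrow> y = b" using 2 p by auto
    moreover have "(x, y) \<in> path_arcs (a # b # zs) \<longleftrightarrow> y = b" using 2 p(3) sub[of a y] by auto
    ultimately show ?thesis by simp
  next
    case 3
    have "x \<sim> y \<longleftrightarrow> x = b" using 3 p adj_sym[of a b] adj_sym[of x a] by auto
    moreover have "(x, y) \<in> path_arcs (a # b # zs) \<longleftrightarrow> x = b" using 3 p(3) sub[of x a] by auto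
    ultimately show ?thesis by simp
  next
    case 4
    then have "(x, y) \<in> path_arcs (a # b # zs) \<longleftrightarrow> (x, y) \<in> path_arcs (b # zs)" using p(3) by auto
    then show ?thesis using "1.IH"[OF p(1) 4] by simp
  qed
qed (auto simp: adj_irrefl)

lemma ipath_sub: "ipath (xs @ ys @ zs) \<Longrightarrow> ipath ys"
  by (simp add: ipath_append)

text \<open>Triangles are admitted here, because rims of wheels may be triangles; \<open>hole\<close> excludes them.\<close>

definition hole_at :: "'a \<Rightarrow> 'a list \<Rightarrow> bool" where
  "hole_at x xs \<longleftrightarrow> ipath xs \<and> x \<notin> set xs \<and> 2 \<le> length xs \<and> (\<forall>y\<in>set xs. x \<sim> y \<longleftrightarrow> y = hd xs \<or> y = last xs)"

lemma hole_at_rev: "hole_at x xs \<Longrightarrow> hole_at x (rev xs)"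
  by (auto simp: hole_at_def ipath_rev hd_rev last_rev)

lemma hole_at_rotate:
  assumes "hole_at x (y # ys)" shows "hole_at y (ys @ [x])"
proof -
  have ip: "ipath (y # ys)" and x: "x \<notin> set (y # ys)"
    and xa: "\<And>u. u \<in> set (y # ys) \<Longrightarrow> x \<sim> u \<longleftrightarrow> u = y \<or> u = last (y # ys)" and ne: "ys \<noteq> []"
    using assms by (auto simp: hole_at_def)
  have d: "y \<notin> set ys" "distinct ys" using ip ipath_distinct by auto
  have ya: "y \<sim> u \<longleftrightarrow> u = hd ys" if "u \<in> set ys" for u
    using ip that ne by (cases ys) auto
  have "u \<sim> x \<longleftrightarrow> u = last ys" if "u \<in> set ys" for u
    using xa[of u] that d ne adj_commute[of u x] by auto
  then have "ipath (ys @ [x])" using ip x ne by (auto simp: ipath_append)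
  moreover have "y \<sim> u \<longleftrightarrow> u = hd (ys @ [x]) \<or> u = last (ys @ [x])" if "u \<in> set (ys @ [x])" for u
    using that ya[of u] xa[of y] adj_commute[of x y] x ne by auto
  moreover have "2 \<le> length (ys @ [x])" using ne by (cases ys) auto
  ultimately show ?thesis using d x by (auto simp: hole_at_def)
qed

lemma hole_at_adj_iff:
  assumes "hole_at x xs" "a \<in> insert x (set xs)" "b \<in> insert x (set xs)"
  shows "a \<sim> b \<longleftrightarrow> (a, b) \<in> path_arcs (x # xs @ [x])"
proof -
  have ip: "ipath xs" and x: "x \<notin> set xs" and ne: "xs \<noteq> []"
    and ends: "\<And>u. u \<in> set xs \<Longrightarrow> x \<sim> u \<longleftrightarrow> u = hd xs \<or> u = last xs"
    using assms(1) by (auto simp: hole_at_def)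
  obtain y ys where xs: "xs = y # ys" using ne by (meson neq_Nil_conv)
  have "path_arcs (x # xs @ [x]) = path_arcs (x # xs) \<union> {(last xs, x), (x, last xs)}"
    using path_arcs_snoc[of "x # xs" x] ne by simp
  then have P: "path_arcs (x # xs @ [x]) = {(x, hd xs), (hd xs, x), (last xs, x), (x, last xs)} \<union> path_arcs xs"
    using xs by auto
  have sub: "path_arcs xs \<subseteq> set xs \<times> set xs" by (rule path_arcs_subset)
  have "hd xs \<in> set xs" "last xs \<in> set xs" using ne by auto
  then show ?thesis using assms(2,3) ends x sub ipath_adj_iff[OF ip] adj_commute[of a b] adj_irrefl[of x]
    unfolding P by auto
qed

definition hole :: "'a set \<Rightarrow> bool" where
  "hole C \<longleftrightarrow> (\<exists>x xs. hole_at x xs \<and> 3 \<le> length xs \<and> C = insert x (set xs))"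

text \<open>The base point of a hole carries no information: rotating by one vertex at a time brings
  any vertex to the front.\<close>

lemma hole_at_everywhere:
  assumes "hole_at x xs" "p \<in> insert x (set xs)"
  shows "\<exists>ys. hole_at p ys \<and> insert p (set ys) = insert x (set xs) \<and> length ys = length xs"
proof -
  have "\<exists>ys. hole_at p ys \<and> insert p (set ys) = insert x (set xs) \<and> length ys = length xs"
    if "hole_at x xs" "xs = as @ p # bs" for as bs x xs
    using that
  proof (induction as arbitrary: x xs bs)
    case Nil
    then have "hole_at p (bs @ [x])" using hole_at_rotate by simp
    then show ?case using Nil by (intro exI[of _ "bs @ [x]"]) auto
  next
    case (Cons a as)
    then have "hole_at a (as @ p # (bs @ [x]))" using hole_at_rotate[of x a "as @ p # bs"] by simp
    from Cons.IH[OF this refl] show ?case using Cons.prems by auto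
  qed
  then show ?thesis using assms by (metis insertE split_list)
qed

lemma hole_at_elim:
  assumes "hole C" "p \<in> C"
  obtains xs where "hole_at p xs" "3 \<le> length xs" "C = insert p (set xs)"
  using assms hole_at_everywhere unfolding hole_def by metis

subsection \<open>Connected sets\<close>

text \<open>Reachability inside the set. The empty set counts as connected, so deleting a clique
  that is the whole vertex set needs no exception later.\<close>

definition conn :: "'a set \<Rightarrow> bool" where
  "conn S \<longleftrightarrow> (\<forall>x\<in>S. \<forall>y\<in>S. (x, y) \<in> {(a, b). a \<in> S \<and> b \<in> S \<and> a \<sim> b}\<^sup>*)"

lemma rtrancl_sub_sym:
  "(x, y) \<in> {(a, b). a \<in> S \<and> b \<in> S \<and> a \<sim> b}\<^sup>* \<Longrightarrow> (y, x) \<in> {(a, b). a \<in> S \<and> b \<in> S \<and> a \<sim> b}\<^sup>*"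
proof -
  have "sym {(a, b). a \<in> S \<and> b \<in> S \<and> a \<sim> b}" using adj_sym by (auto intro: symI)
  then show "(x, y) \<in> {(a, b). a \<in> S \<and> b \<in> S \<and> a \<sim> b}\<^sup>* \<Longrightarrow> (y, x) \<in> {(a, b). a \<in> S \<and> b \<in> S \<and> a \<sim> b}\<^sup>*"
    using sym_rtrancl symD by metis
qed

lemma rtrancl_sub_mono:
  "(x, y) \<in> {(a, b). a \<in> S \<and> b \<in> S \<and> a \<sim> b}\<^sup>* \<Longrightarrow> S \<subseteq> T \<Longrightarrow> (x, y) \<in> {(a, b). a \<in> T \<and> b \<in> T \<and> a \<sim> b}\<^sup>*"
  by (erule rtrancl_mono[THEN subsetD, rotated]) auto

lemma conn_empty [simp]: "conn {}" and conn_single [simp]: "conn {x}"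
  by (auto simp: conn_def)

lemma conn_union:
  assumes "conn S" "conn T" "x \<in> S" "y \<in> T" "x = y \<or> x \<sim> y"
  shows "conn (S \<union> T)"
proof -
  let ?R = "{(a, b). a \<in> S \<union> T \<and> b \<in> S \<union> T \<and> a \<sim> b}"
  have xy: "(x, y) \<in> ?R\<^sup>*" using assms(3,4,5) by auto
  have S: "(a, b) \<in> ?R\<^sup>*" if "a \<in> S" "b \<in> S" for a b
    using assms(1) that rtrancl_sub_mono[of a b S "S \<union> T"] by (auto simp: conn_def)
  have T: "(a, b) \<in> ?R\<^sup>*" if "a \<in> T" "b \<in> T" for a b
    using assms(2) that rtrancl_sub_mono[of a b T "S \<union> T"] by (auto simp: conn_def)
  have ST: "(a, b) \<in> ?R\<^sup>*" if "a \<in> S" "b \<in> T" for a b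
    using S[OF that(1) assms(3)] xy T[OF assms(4) that(2)] by auto
  show ?thesis unfolding conn_def
    using S T ST rtrancl_sub_sym[of _ _ "S \<union> T"] by blast
qed

lemma conn_insert: "conn S \<Longrightarrow> y \<in> S \<Longrightarrow> x \<sim> y \<Longrightarrow> conn (insert x S)"
  using conn_union[of "{x}" S x y] by simp

lemma ipath_conn: "ipath xs \<Longrightarrow> conn (set xs)"
proof (induction xs)
  case (Cons x xs)
  then show ?case by (cases xs) (auto intro!: conn_insert[of _ "hd xs"])
qed simp

text \<open>Take a shortest walk in \<open>S\<close> from an \<open>A\<close>-vertex to a
  \<open>B\<close>-vertex. A chord, a repeated vertex, or a further vertex satisfying
  \<open>A\<close> or \<open>B\<close> would each allow a shorter one.\<close>

lemma min_path:
  assumes "conn S" "a \<in> S" "A a" "b \<in> S" "B b"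
  obtains xs where "xs \<noteq> []" "ipath xs" "set xs \<subseteq> S" "A (hd xs)" "B (last xs)"
    "\<And>x. x \<in> set xs \<Longrightarrow> A x \<Longrightarrow> x = hd xs" "\<And>x. x \<in> set xs \<Longrightarrow> B x \<Longrightarrow> x = last xs"
proof -
  define W where "W xs \<longleftrightarrow> xs \<noteq> [] \<and> successively (\<sim>) xs \<and> set xs \<subseteq> S \<and> A (hd xs) \<and> B (last xs)" for xs
  have ex: "\<exists>xs. xs \<noteq> [] \<and> successively (\<sim>) xs \<and> set xs \<subseteq> S \<and> hd xs = a \<and> last xs = b"
  proof -
    have "(a, b) \<in> {(a, b). a \<in> S \<and> b \<in> S \<and> a \<sim> b}\<^sup>*" using assms by (auto simp: conn_def)
    then show ?thesis
    proof (induction rule: converse_rtrancl_induct)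
      case base then show ?case using assms by (intro exI[of _ "[b]"]) auto
    next
      case (step y z)
      then obtain xs where "xs \<noteq> []" "successively (\<sim>) xs" "set xs \<subseteq> S" "hd xs = z" "last xs = b" by auto
      then show ?case using step by (intro exI[of _ "y # xs"]) (auto simp: successively_Cons)
    qed
  qed
  then have "\<exists>xs. W xs" using assms unfolding W_def by metis
  then obtain xs where xs: "W xs" and min: "\<And>ys. W ys \<Longrightarrow> length xs \<le> length ys"
    using ex_has_least_nat[of W _ length] by metis
  \<comment> \<open>All the properties below are instances of this: a segment whose removal leaves a
    walk of the same kind is empty.\<close>
  have cut: "ys = []" if "xs = us @ ys @ vs" "W (us @ vs)" for us ys vs
    using min[OF that(2)] that(1) by simp
  have "A x \<Longrightarrow> x = hd xs" if xin: "x \<in> set xs" for x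
  proof -
    assume "A x"
    obtain us vs where e: "xs = us @ x # vs" using xin by (meson split_list)
    have "W (x # vs)" using xs e \<open>A x\<close> by (auto simp: W_def successively_append_iff)
    then have "us = []" using cut[of "[]" us "x # vs"] e by simp
    then show ?thesis using e by simp
  qed
  moreover have "B x \<Longrightarrow> x = last xs" if xin: "x \<in> set xs" for x
  proof -
    assume "B x"
    obtain us vs where e: "xs = us @ x # vs" using xin by (meson split_list)
    have "W (us @ [x])" using xs e \<open>B x\<close>
      by (auto simp: W_def successively_append_iff successively_Cons hd_append split: if_splits)
    then have "vs = []" using cut[of "us @ [x]" vs "[]"] e by simp
    then show ?thesis using e by simp
  qed
  moreover have "ipath xs"
  proof -
    have chord: "ys = []" if e: "xs = us @ x # ys @ y # vs" and "x \<sim> y" for us x ys y vs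
    proof -
      have "W (us @ x # y # vs)" using xs that
        by (auto simp: W_def successively_append_iff successively_Cons hd_append split: if_splits)
      then show ?thesis using cut[of "us @ [x]" ys "y # vs"] e by simp
    qed
    have dup: False if e: "xs = us @ x # ys @ x # vs" for us x ys vs
    proof -
      have "W (us @ x # vs)" using xs that
        by (auto simp: W_def successively_append_iff successively_Cons hd_append split: if_splits)
      then show ?thesis using cut[of "us" "x # ys" "x # vs"] e by simp
    qed
    have "ipath vs" if "xs = us @ vs" for us vs
      using that
    proof (induction vs arbitrary: us)
      case (Cons v vs)
      have "ipath vs" using Cons.IH[of "us @ [v]"] Cons.prems by simp
      moreover have "v \<notin> set vs" using dup Cons.prems by (metis split_list)
      moreover have "vs \<noteq> [] \<longrightarrow> v \<sim> hd vs" using xs Cons.prems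
        by (cases vs) (auto simp: W_def successively_append_iff)
      moreover have "\<not> v \<sim> y" if y: "y \<in> set (tl vs)" for y
      proof
        assume "v \<sim> y"
        obtain w ws where vs: "vs = w # ws" using y by (cases vs) auto
        have "y \<in> set ws" using y vs by simp
        then obtain as bs where "ws = as @ y # bs" by (meson split_list)
        then have "xs = us @ v # (w # as) @ y # bs" using Cons.prems vs by simp
        from chord[OF this \<open>v \<sim> y\<close>] show False by simp
      qed
      ultimately show ?case by simp
    qed simp
    then show ?thesis by simp
  qed
  ultimately show ?thesis using that xs unfolding W_def by blast
qed

text \<open>The target is \<open>T\<close> together with its neighbours. A shortest path never
  enters \<open>T\<close>, because the vertex before would already be a neighbour of
  \<open>T\<close>; and a path of one vertex satisfies \<open>A\<close>, which excludes
  \<open>T\<close>.\<close>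

lemma min_path_adj:
  assumes "conn S" "a \<in> S" "A a" "t \<in> S" "t \<in> T \<or> (\<exists>y\<in>T. t \<sim> y)" and T: "\<And>x. x \<in> T \<Longrightarrow> \<not> A x"
  obtains xs where "xs \<noteq> []" "ipath xs" "set xs \<subseteq> S" "A (hd xs)" "\<exists>y\<in>T. last xs \<sim> y" "set xs \<inter> T = {}"
    "\<And>x. x \<in> set xs \<Longrightarrow> A x \<Longrightarrow> x = hd xs" "\<And>x y. x \<in> set xs \<Longrightarrow> y \<in> T \<Longrightarrow> x \<sim> y \<Longrightarrow> x = last xs"
proof -
  define B where "B x \<longleftrightarrow> x \<in> T \<or> (\<exists>y\<in>T. x \<sim> y)" for x
  have "B t" using assms(5) unfolding B_def .
  from min_path[where A = A and B = B, OF assms(1-4) this] obtain xs where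
    xs: "xs \<noteq> []" "ipath xs" "set xs \<subseteq> S" "A (hd xs)" "B (last xs)"
    "\<And>x. x \<in> set xs \<Longrightarrow> A x \<Longrightarrow> x = hd xs" "\<And>x. x \<in> set xs \<Longrightarrow> B x \<Longrightarrow> x = last xs" by blast
  have lT: "last xs \<notin> T"
  proof
    assume l: "last xs \<in> T"
    show False
    proof (cases "butlast xs = []")
      case True
      then have "hd xs = last xs" using xs(1) by (cases xs) auto
      then show False using xs(4) T l by metis
    next
      case False
      have e: "xs = butlast xs @ [last xs]" using xs(1) by simp
      then have "last (butlast xs) \<sim> last xs" using xs(2) False ipath_append[of "butlast xs" "[last xs]"] by simp
      moreover have l': "last (butlast xs) \<in> set (butlast xs)" using False by simp
      ultimately have "last (butlast xs) = last xs" using xs(7)[of "last (butlast xs)"] l unfolding B_def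
        by (meson in_set_butlastD)
      then show False using ipath_distinct[OF xs(2)] e l' by (metis distinct_append disjoint_iff list.set_intros(1))
    qed
  qed
  show ?thesis
  proof (rule that[OF xs(1-4) _ _ xs(6)])
    show "\<exists>y\<in>T. last xs \<sim> y" using xs(5) lT unfolding B_def by blast
    show "set xs \<inter> T = {}" using xs(7) lT unfolding B_def by blast
    fix x y assume "x \<in> set xs" "y \<in> T" "x \<sim> y"
    then show "x = last xs" using xs(7)[of x] unfolding B_def by blast
  qed
qed

end

subsection \<open>Subdivisions of the complete graph on four vertices\<close>

lemma K4_subdivision_subdivide:
  assumes "K4_subdivision \<lparr>pverts = W, parcs = R\<rparr>" "(u, v) \<in> R" "w \<notin> W"
  shows "K4_subdivision \<lparr>pverts = insert w W, parcs = R - {(u, v), (v, u)} \<union> {(u, w), (w, u), (w, v), (v, w)}\<rparr>"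
proof -
  let ?H = "\<lparr>pverts = W, parcs = R\<rparr>"
  obtain K :: "'a pair_pre_digraph" where K: "complete_digraph 4 (with_proj K)" "subdivision_pair K ?H"
    using assms(1) unfolding K4_subdivision_def by blast
  have "subdivision_pair K (subdivide ?H (u, v) w)"
    using subdivision_pair_divide[of "(u, v)" ?H w K] assms K by simp
  moreover have "subdivide ?H (u, v) w = \<lparr>pverts = insert w W, parcs = R - {(u, v), (v, u)} \<union> {(u, w), (w, u), (w, v), (v, w)}\<rparr>"
    by (simp add: subdivide.simps)
  ultimately show ?thesis using K unfolding K4_subdivision_def by metis
qed

text \<open>Subdividing the edge by the first inner vertex leaves an edge from that vertex to
  \<open>v\<close>, on which the rest of the path is placed by induction.\<close>

lemma K4_subdivision_replace:
  assumes "K4_subdivision \<lparr>pverts = W, parcs = R\<rparr>" "R \<subseteq> W \<times> W" "sym R" "(u, v) \<in> R"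
    and "u \<noteq> v" "distinct xs" "set xs \<inter> W = {}"
  shows "K4_subdivision \<lparr>pverts = W \<union> set xs, parcs = R - {(u, v), (v, u)} \<union> path_arcs (u # xs @ [v])\<rparr>"
  using assms
proof (induction xs arbitrary: u W R)
  case Nil
  then have "R - {(u, v), (v, u)} \<union> path_arcs (u # [] @ [v]) = R"
    by (auto dest: symD)
  then show ?case using Nil by simp
next
  case (Cons x xs)
  let ?R = "R - {(u, v), (v, u)} \<union> {(u, x), (x, u), (x, v), (v, x)}"
  have x: "x \<notin> W" using Cons.prems by auto
  have uv: "u \<in> W" "v \<in> W" "x \<noteq> v" using Cons.prems x by auto
  have "sym ?R" using \<open>sym R\<close> by (auto simp: sym_def)
  moreover have "?R \<subseteq> insert x W \<times> insert x W" using Cons.prems by auto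
  ultimately have IH: "K4_subdivision \<lparr>pverts = insert x W \<union> set xs, parcs = ?R - {(x, v), (v, x)} \<union> path_arcs (x # xs @ [v])\<rparr>"
    using Cons.IH[OF K4_subdivision_subdivide[OF Cons.prems(1,4) x]] Cons.prems uv x by auto
  have xR: "(x, z) \<notin> R" "(z, x) \<notin> R" for z using Cons.prems(2) x by auto
  have "?R - {(x, v), (v, x)} \<union> path_arcs (x # xs @ [v]) = R - {(u, v), (v, u)} \<union> path_arcs (u # (x # xs) @ [v])"
    using xR uv x Cons.prems(5) by auto
  then show ?case using IH by simp
qed

lemma K4_subdivision_complete:
  assumes "distinct [p, q, r, s]"
  shows "K4_subdivision \<lparr>pverts = {p, q, r, s}, parcs = {(x, y). x \<in> {p, q, r, s} \<and> y \<in> {p, q, r, s} \<and> x \<noteq> y}\<rparr>"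
    (is "K4_subdivision ?K")
proof -
  have K: "complete_digraph 4 (with_proj ?K)"
    unfolding complete_digraph_pair_def using assms by auto
  interpret pair_graph ?K using K by (rule pair_graphI_complete)
  have "pair_bidirected_digraph ?K" by unfold_locales
  then show ?thesis unfolding K4_subdivision_def using K subdivision_pair_base by blast
qed

lemma sym_path_arcs: "sym (path_arcs xs)"
  by (rule symI) (rule path_arcs_sym)

text \<open>\<open>D\<close> collects the arcs that are final; \<open>ts\<close> lists the edges
  still to be replaced, with the interiors of their paths. Since these edges are distinct and
  outside \<open>D\<close>, removing one of them destroys neither a finished path nor another
  pending edge.\<close>

lemma K4_subdivision_replace_list:
  assumes "K4_subdivision \<lparr>pverts = W, parcs = D \<union> (\<Union>(u, xs, v)\<in>set ts. {(u, v), (v, u)})\<rparr>"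
    and "D \<subseteq> W \<times> W" "sym D" "U \<subseteq> W"
    and "\<And>u xs v. (u, xs, v) \<in> set ts \<Longrightarrow> u \<in> U \<and> v \<in> U \<and> u \<noteq> v \<and> (u, v) \<notin> D \<and> (v, u) \<notin> D"
    and "distinct (map (\<lambda>(u, xs, v). {u, v}) ts)"
    and "distinct (concat (map (fst \<circ> snd) ts))"
    and "set (concat (map (fst \<circ> snd) ts)) \<inter> W = {}"
  shows "K4_subdivision \<lparr>pverts = W \<union> set (concat (map (fst \<circ> snd) ts)),
    parcs = D \<union> (\<Union>(u, xs, v)\<in>set ts. path_arcs (u # xs @ [v]))\<rparr>"
  using assms
proof (induction ts arbitrary: W D)
  case (Cons t ts)
  obtain u xs v where t: "t = (u, xs, v)" by (cases t)
  let ?e = "{(u, v), (v, u)}"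
  let ?B = "\<Union>(u, xs, v)\<in>set ts. {(u, v), (v, u)}"
  let ?P = "path_arcs (u # xs @ [v])"
  have uv: "u \<in> U" "v \<in> U" "u \<noteq> v" "(u, v) \<notin> D" "(v, u) \<notin> D" using Cons.prems(5)[of u xs v] t by auto
  have tsU: "a \<in> U \<and> b \<in> U \<and> a \<noteq> b \<and> (a, b) \<notin> D \<and> (b, a) \<notin> D \<and> {a, b} \<noteq> {u, v}" if ab: "(a, ys, b) \<in> set ts" for a ys b
  proof -
    have "{u, v} \<notin> (\<lambda>(u, xs, v). {u, v}) ` set ts" using Cons.prems(6) t by simp
    moreover have "{a, b} \<in> (\<lambda>(u, xs, v). {u, v}) ` set ts" using ab by (rule rev_image_eqI) simp
    ultimately have "{a, b} \<noteq> {u, v}" by metis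
    then show ?thesis using Cons.prems(5)[of a ys b] ab by simp
  qed
  have B: "?B \<subseteq> W \<times> W" "sym ?B" "?B \<inter> ?e = {}"
  proof -
    show "?B \<subseteq> W \<times> W" using tsU \<open>U \<subseteq> W\<close> by blast
    show "sym ?B" by (auto simp: sym_def)
    show "?B \<inter> ?e = {}" using tsU by fastforce
  qed
  have xs: "distinct xs" "set xs \<inter> W = {}" using Cons.prems(7,8) t by auto
  have xsU: "set xs \<inter> U = {}" using xs \<open>U \<subseteq> W\<close> by auto
  have eq: "D \<union> (\<Union>(u, xs, v)\<in>set (t # ts). {(u, v), (v, u)}) = D \<union> ?e \<union> ?B" using t by auto
  have "K4_subdivision \<lparr>pverts = W \<union> set xs, parcs = (D \<union> ?e \<union> ?B) - ?e \<union> ?P\<rparr>"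
  proof (rule K4_subdivision_replace)
    show "K4_subdivision \<lparr>pverts = W, parcs = D \<union> ?e \<union> ?B\<rparr>" using Cons.prems(1) unfolding eq .
    show "D \<union> ?e \<union> ?B \<subseteq> W \<times> W" using B(1) Cons.prems(2) uv(1,2) \<open>U \<subseteq> W\<close> by blast
    have "sym ?e" by (auto simp: sym_def)
    then show "sym (D \<union> ?e \<union> ?B)" using B(2) Cons.prems(3) by (intro sym_Un)
  qed (use uv xs in auto)
  moreover have "(D \<union> ?e \<union> ?B) - ?e \<union> ?P = (D \<union> ?P) \<union> ?B" using B(3) uv by blast
  ultimately have K: "K4_subdivision \<lparr>pverts = W \<union> set xs, parcs = (D \<union> ?P) \<union> ?B\<rparr>" by simp
  have "K4_subdivision \<lparr>pverts = (W \<union> set xs) \<union> set (concat (map (fst \<circ> snd) ts)),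
    parcs = (D \<union> ?P) \<union> (\<Union>(u, xs, v)\<in>set ts. path_arcs (u # xs @ [v]))\<rparr>"
  proof (rule Cons.IH[OF K])
    have "set (u # xs @ [v]) \<subseteq> W \<union> set xs" using uv \<open>U \<subseteq> W\<close> by auto
    then have "?P \<subseteq> (W \<union> set xs) \<times> (W \<union> set xs)" using path_arcs_subset[of "u # xs @ [v]"] by blast
    then show "D \<union> ?P \<subseteq> (W \<union> set xs) \<times> (W \<union> set xs)" using Cons.prems(2) by blast
    show "sym (D \<union> ?P)" using Cons.prems(3) by (intro sym_Un sym_path_arcs)
    show "U \<subseteq> W \<union> set xs" using \<open>U \<subseteq> W\<close> by auto
    fix a ys b assume ab: "(a, ys, b) \<in> set ts"
    have "(a, b) \<notin> ?P" "(b, a) \<notin> ?P"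
      using path_arcs_ends[of a b u xs v] path_arcs_ends[of b a u xs v] tsU[OF ab] uv xsU by blast+
    then show "a \<in> U \<and> b \<in> U \<and> a \<noteq> b \<and> (a, b) \<notin> D \<union> ?P \<and> (b, a) \<notin> D \<union> ?P"
      using tsU[OF ab] by blast
  qed (use Cons.prems(6,7,8) t in \<open>auto simp del: set_concat\<close>)
  moreover have "(W \<union> set xs) \<union> set (concat (map (fst \<circ> snd) ts)) = W \<union> set (concat (map (fst \<circ> snd) (t # ts)))"
    "(D \<union> ?P) \<union> (\<Union>(u, xs, v)\<in>set ts. path_arcs (u # xs @ [v])) = D \<union> (\<Union>(u, xs, v)\<in>set (t # ts). path_arcs (u # xs @ [v]))"
    using t by (auto simp del: set_concat)
  ultimately show ?case by simp
qed simp

lemma K4_subdivision_six_paths: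
  assumes d: "distinct ([p, q, r, s] @ xs1 @ xs2 @ xs3 @ xs4 @ xs5 @ xs6)"
  shows "K4_subdivision \<lparr>pverts = set ([p, q, r, s] @ xs1 @ xs2 @ xs3 @ xs4 @ xs5 @ xs6),
    parcs = path_arcs (p # xs1 @ [q]) \<union> path_arcs (q # xs2 @ [r]) \<union> path_arcs (r # xs3 @ [p])
      \<union> path_arcs (s # xs4 @ [p]) \<union> path_arcs (s # xs5 @ [q]) \<union> path_arcs (s # xs6 @ [r])\<rparr>"
proof -
  let ?ts = "[(p, xs1, q), (q, xs2, r), (r, xs3, p), (s, xs4, p), (s, xs5, q), (s, xs6, r)]"
  have "{(x, y). x \<in> {p, q, r, s} \<and> y \<in> {p, q, r, s} \<and> x \<noteq> y} = {} \<union> (\<Union>(u, xs, v)\<in>set ?ts. {(u, v), (v, u)})"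
    using d by auto
  then have K: "K4_subdivision \<lparr>pverts = {p, q, r, s}, parcs = {} \<union> (\<Union>(u, xs, v)\<in>set ?ts. {(u, v), (v, u)})\<rparr>"
    using K4_subdivision_complete[of p q r s] d by simp
  have "K4_subdivision \<lparr>pverts = {p, q, r, s} \<union> set (concat (map (fst \<circ> snd) ?ts)),
    parcs = {} \<union> (\<Union>(u, xs, v)\<in>set ?ts. path_arcs (u # xs @ [v]))\<rparr>"
    by (rule K4_subdivision_replace_list[OF K, where U = "{p, q, r, s}"])
      (use d in \<open>auto simp: sym_def doubleton_eq_iff\<close>)
  moreover have "{p, q, r, s} \<union> set (concat (map (fst \<circ> snd) ?ts)) = set ([p, q, r, s] @ xs1 @ xs2 @ xs3 @ xs4 @ xs5 @ xs6)"
    by auto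
  moreover have "{} \<union> (\<Union>(u, xs, v)\<in>set ?ts. path_arcs (u # xs @ [v])) = path_arcs (p # xs1 @ [q]) \<union> path_arcs (q # xs2 @ [r]) \<union> path_arcs (r # xs3 @ [p])
      \<union> path_arcs (s # xs4 @ [p]) \<union> path_arcs (s # xs5 @ [q]) \<union> path_arcs (s # xs6 @ [r])"
    by (simp add: Un_assoc)
  ultimately show ?thesis by simp
qed

text \<open>
  A subdivision of the complete graph on \<open>p\<close>, \<open>q\<close>, \<open>r\<close>, \<open>s\<close>: a cycle through \<open>p\<close>, \<open>q\<close>, \<open>r\<close> and three
  legs from \<open>s\<close>; the lists are the interiors of the subdivided edges.
\<close>

definition spider :: "('a \<Rightarrow> 'a \<Rightarrow> bool) \<Rightarrow> 'a set \<Rightarrow> bool" where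
  "spider E S \<longleftrightarrow> (\<exists>p q r s b1 b2 b3 l1 l2 l3.
     distinct (p # b1 @ q # b2 @ r # b3 @ s # l1 @ l2 @ l3) \<and>
     S = set (p # b1 @ q # b2 @ r # b3 @ s # l1 @ l2 @ l3) \<and>
     (\<forall>x\<in>S. \<forall>y\<in>S. E x y \<longleftrightarrow> (x, y) \<in> path_arcs (p # b1 @ q # b2 @ r # b3 @ [p])
      \<union> path_arcs (s # l1 @ [p]) \<union> path_arcs (s # l2 @ [q]) \<union> path_arcs (s # l3 @ [r])))"

text \<open>The equivalence in \<open>spider\<close> makes the arcs of the subgraph induced by
  \<open>S\<close> exactly those of the six paths, so the subdivision is an induced one.\<close>

lemma (in pair_graph) spider_has_ISK4:
  assumes "spider (\<lambda>x y. (x, y) \<in> parcs G) S" "S \<subseteq> pverts G"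
  shows "has_ISK4 G"
proof -
  obtain p q r s b1 b2 b3 l1 l2 l3 where d: "distinct (p # b1 @ q # b2 @ r # b3 @ s # l1 @ l2 @ l3)"
    and S: "S = set (p # b1 @ q # b2 @ r # b3 @ s # l1 @ l2 @ l3)"
    and E: "\<forall>x\<in>S. \<forall>y\<in>S. (x, y) \<in> parcs G \<longleftrightarrow> (x, y) \<in> path_arcs (p # b1 @ q # b2 @ r # b3 @ [p])
      \<union> path_arcs (s # l1 @ [p]) \<union> path_arcs (s # l2 @ [q]) \<union> path_arcs (s # l3 @ [r])"
    using assms(1) unfolding spider_def by blast
  let ?R = "{e \<in> parcs G. fst e \<in> S \<and> snd e \<in> S}"
  let ?P = "path_arcs (p # b1 @ [q]) \<union> path_arcs (q # b2 @ [r]) \<union> path_arcs (r # b3 @ [p])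
      \<union> path_arcs (s # l1 @ [p]) \<union> path_arcs (s # l2 @ [q]) \<union> path_arcs (s # l3 @ [r])"
  have C: "path_arcs (p # b1 @ q # b2 @ r # b3 @ [p]) = path_arcs (p # b1 @ [q]) \<union> path_arcs (q # b2 @ [r]) \<union> path_arcs (r # b3 @ [p])"
    using path_arcs_append[of "p # b1" q "b2 @ r # b3 @ [p]"] path_arcs_append[of "q # b2" r "b3 @ [p]"] by auto
  have "set (p # b1 @ [q]) \<subseteq> S" "set (q # b2 @ [r]) \<subseteq> S" "set (r # b3 @ [p]) \<subseteq> S"
    "set (s # l1 @ [p]) \<subseteq> S" "set (s # l2 @ [q]) \<subseteq> S" "set (s # l3 @ [r]) \<subseteq> S"
    using S by auto
  then have "?P \<subseteq> S \<times> S" using path_arcs_subset by blast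
  then have R: "?R = ?P" using E unfolding C by auto
  have "K4_subdivision \<lparr>pverts = set ([p, q, r, s] @ b1 @ b2 @ b3 @ l1 @ l2 @ l3), parcs = ?P\<rparr>"
    by (rule K4_subdivision_six_paths) (use d in auto)
  moreover have "set ([p, q, r, s] @ b1 @ b2 @ b3 @ l1 @ l2 @ l3) = S" using S by auto
  ultimately have K: "K4_subdivision \<lparr>pverts = S, parcs = ?R\<rparr>" using R by simp
  have "with_proj \<lparr>pverts = S, parcs = ?R\<rparr> = with_proj G \<restriction> S"
    by (simp add: with_proj_def induce_subgraph_def)
  then show ?thesis unfolding has_ISK4_def using K induced_induce[of S] assms(2) by metis
qed

text \<open>The wheel is the subgraph induced by the rim and \<open>v\<close>. The work lies in
  turning the vertex list of the rim into the closed arc walk that \<open>chordless_cycle\<close>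
  expects.\<close>

lemma (in pair_graph) hole_has_wheel:
  assumes "sym_rel.hole_at (\<lambda>x y. (x, y) \<in> parcs G) x xs" "insert v (insert x (set xs)) \<subseteq> pverts G"
    and "v \<notin> insert x (set xs)" "3 \<le> card {u \<in> insert x (set xs). (v, u) \<in> parcs G}"
  shows "has_wheel G"
proof -
  interpret sym_rel "\<lambda>x y. (x, y) \<in> parcs G"
    by unfold_locales (auto intro: arcs_symmetric dest: no_loops')
  let ?S = "insert v (insert x (set xs))"
  let ?W = "\<lparr>pverts = ?S, parcs = {e \<in> parcs G. fst e \<in> ?S \<and> snd e \<in> ?S}\<rparr>"
  have W: "with_proj ?W = with_proj G \<restriction> ?S"
    by (simp add: with_proj_def induce_subgraph_def)
  have ind: "induced_subgraph (with_proj ?W) (with_proj G)" unfolding W using induced_induce assms(2) by blast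
  interpret W: pair_graph ?W
    using ind W pair_finite_verts pair_finite_arcs finite_subset[OF assms(2)]
    by unfold_locales (auto simp: symmetric_def sym_def dest: no_loops intro: arcs_symmetric)
  have ip: "ipath xs" and x: "x \<notin> set xs" and len: "2 \<le> length xs"
    using assms(1) by (auto simp: hole_at_def)
  \<comment> \<open>Pairs of consecutive entries. For the closed list \<open>x # xs @ [x]\<close>
    these are the arcs of the rim, each in one direction only.\<close>
  define arcs_of :: "'a list \<Rightarrow> ('a \<times> 'a) list" where "arcs_of zs = zip (butlast zs) (tl zs)" for zs
  have ao_Cons: "arcs_of (a # b # zs) = (a, b) # arcs_of (b # zs)" for a b zs by (simp add: arcs_of_def)
  have ao1: "arcs_of [a] = []" for a by (simp add: arcs_of_def)
  have sym_ao: "set (arcs_of zs) \<union> (set (arcs_of zs))\<inverse> = path_arcs zs" for zs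
  proof (induction zs rule: path_arcs.induct)
    case (1 a b zs)
    have "set (arcs_of (a # b # zs)) \<union> (set (arcs_of (a # b # zs)))\<inverse>
        = {(a, b), (b, a)} \<union> (set (arcs_of (b # zs)) \<union> (set (arcs_of (b # zs)))\<inverse>)"
      unfolding ao_Cons by auto
    then show ?case using "1.IH" by simp
  qed (simp_all add: arcs_of_def)
  have pv: "zs \<noteq> [] \<Longrightarrow> pawalk_verts (hd zs) (arcs_of zs) = zs" for zs
    by (induction zs rule: path_arcs.induct) (auto simp: ao_Cons ao1)
  have pc: "zs \<noteq> [] \<Longrightarrow> pcas (hd zs) (arcs_of zs) (last zs)" for zs
    by (induction zs rule: path_arcs.induct) (auto simp: ao_Cons ao1)
  have len_ao: "length (arcs_of zs) = length zs - 1" for zs by (simp add: arcs_of_def)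
  have dom: "fst ` set (arcs_of zs) \<union> snd ` set (arcs_of zs) = set zs" if "2 \<le> length zs" for zs
    using that
  proof (induction zs rule: path_arcs.induct)
    case (1 a b zs) then show ?case by (cases zs) (auto simp: ao_Cons ao1)
  qed auto
  let ?zs = "x # xs @ [x]"
  let ?p = "arcs_of ?zs"
  have fp: "fst ` set ?p \<union> snd ` set ?p = insert x (set xs)" using dom[of ?zs] by auto
  note adj = hole_at_adj_iff[OF assms(1)]
  have rim: "chordless_cycle ?W ?p"
    unfolding chordless_cycle_def undirected_cycle_def
  proof (intro conjI)
    have "set ?p \<subseteq> path_arcs ?zs" using sym_ao[of ?zs] by blast
    moreover have "path_arcs ?zs \<subseteq> insert x (set xs) \<times> insert x (set xs)" using path_arcs_subset[of ?zs] by auto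
    ultimately have "set ?p \<subseteq> parcs ?W" using adj by auto
    moreover have "distinct (tl (pawalk_verts x ?p))" using pv[of ?zs] ipath_distinct[OF ip] x by simp
    ultimately show "pre_digraph.cycle (with_proj ?W) ?p"
      unfolding pre_digraph.cycle_def pre_digraph.awalk_def
      using pc[of ?zs] len_ao[of ?zs] len
      by (intro exI[of _ x]) (auto simp: cas_with_proj_eq awalk_verts_with_proj_eq)
    show "3 \<le> length ?p" using len_ao[of ?zs] len by simp
    have "graph_of_arcs ?p = \<lparr>pverts = insert x (set xs), parcs = path_arcs ?zs\<rparr>"
      unfolding graph_of_arcs_def fp sym_ao ..
    moreover have "path_arcs ?zs = {e \<in> parcs ?W. fst e \<in> insert x (set xs) \<and> snd e \<in> insert x (set xs)}"
      using adj \<open>path_arcs ?zs \<subseteq> _\<close> by auto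
    ultimately have "with_proj (graph_of_arcs ?p) = with_proj ?W \<restriction> insert x (set xs)"
      by (simp add: with_proj_def induce_subgraph_def)
    then show "induced_subgraph (with_proj (graph_of_arcs ?p)) (with_proj ?W)"
      using W.induced_induce[of "insert x (set xs)"] by auto
  qed
  have V: "pverts (graph_of_arcs ?p) = insert x (set xs)" using fp by (simp add: graph_of_arcs_def)
  have "{u \<in> insert x (set xs). (v, u) \<in> parcs ?W} = {u \<in> insert x (set xs). (v, u) \<in> parcs G}" by auto
  then have "wheel ?W" unfolding wheel_def using rim V assms(3,4) W.pair_graph by (intro conjI exI[of _ ?p] exI[of _ v]) simp_all
  then show ?thesis unfolding has_wheel_def using ind by blast
qed

context sym_rel begin

lemma hole_at_hole: "hole_at x xs \<Longrightarrow> 3 \<le> length xs \<Longrightarrow> hole (insert x (set xs))"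
  unfolding hole_def by blast

text \<open>List the cycle from \<open>p\<close>; if \<open>r\<close> comes before \<open>q\<close>,
  reverse the list.\<close>

lemma hole_three:
  assumes "hole C" "p \<in> C" "q \<in> C" "r \<in> C" "distinct [p, q, r]"
  obtains b1 b2 b3 where "hole_at p (b1 @ q # b2 @ r # b3)" "C = insert p (set (b1 @ q # b2 @ r # b3))"
    "3 \<le> length (b1 @ q # b2 @ r # b3)"
proof -
  obtain xs where xs: "hole_at p xs" "3 \<le> length xs" "C = insert p (set xs)"
    using hole_at_elim assms by metis
  have "q \<in> set xs" using assms xs by auto
  then obtain as bs where e: "xs = as @ q # bs" by (meson split_list)
  then consider "r \<in> set bs" | "r \<in> set as" using assms xs by auto
  then show ?thesis
  proof cases
    case 1
    then obtain cs ds where "bs = cs @ r # ds" by (meson split_list)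
    then show ?thesis using that[of as cs ds] xs e by simp
  next
    case 2
    then obtain cs ds where "as = cs @ r # ds" by (meson split_list)
    then have "rev xs = rev bs @ q # rev ds @ r # rev cs" using e by simp
    then show ?thesis using that[of "rev bs" "rev ds" "rev cs"] hole_at_rev[OF xs(1)] xs
      by (metis length_rev set_rev)
  qed
qed

text \<open>The adjacencies are checked blockwise: within the cycle, between cycle and legs in both
  directions, and within the legs. An empty leg means that \<open>s\<close> itself is adjacent to
  the cycle, as \<open>last (s # [])\<close> is \<open>s\<close>.\<close>

lemma spiderI:
  assumes C: "hole_at p (b1 @ q # b2 @ r # b3)"
    and CF: "insert p (set (b1 @ q # b2 @ r # b3)) \<inter> set (s # l1 @ l2 @ l3) = {}"
    and legs: "ipath (s # l1)" "ipath (s # l2)" "ipath (s # l3)"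
    and cross: "\<And>x y. x \<in> set l1 \<Longrightarrow> y \<in> set l2 \<Longrightarrow> x \<noteq> y \<and> \<not> x \<sim> y"
      "\<And>x y. x \<in> set l1 \<Longrightarrow> y \<in> set l3 \<Longrightarrow> x \<noteq> y \<and> \<not> x \<sim> y"
      "\<And>x y. x \<in> set l2 \<Longrightarrow> y \<in> set l3 \<Longrightarrow> x \<noteq> y \<and> \<not> x \<sim> y"
    and att: "\<And>x y. x \<in> set (s # l1 @ l2 @ l3) \<Longrightarrow> y \<in> insert p (set (b1 @ q # b2 @ r # b3)) \<Longrightarrow>
      x \<sim> y \<longleftrightarrow> (x = last (s # l1) \<and> y = p) \<or> (x = last (s # l2) \<and> y = q) \<or> (x = last (s # l3) \<and> y = r)"
  shows "spider (\<sim>) (insert p (set (b1 @ q # b2 @ r # b3)) \<union> set (s # l1 @ l2 @ l3))"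
proof -
  let ?C = "insert p (set (b1 @ q # b2 @ r # b3))"
  let ?F = "set (s # l1 @ l2 @ l3)"
  let ?A = "path_arcs (s # l1) \<union> path_arcs (s # l2) \<union> path_arcs (s # l3)"
  let ?X = "{(last (s # l1), p), (last (s # l2), q), (last (s # l3), r)}"
  let ?cyc = "path_arcs (p # b1 @ q # b2 @ r # b3 @ [p])"
  have dC: "distinct (p # b1 @ q # b2 @ r # b3)"
    using C ipath_distinct unfolding hole_at_def by (metis distinct.simps(2))
  have dF: "distinct (s # l1 @ l2 @ l3)"
  proof -
    have "set l1 \<inter> set l2 = {}" "set l1 \<inter> set l3 = {}" "set l2 \<inter> set l3 = {}" using cross by blast+
    then show ?thesis using legs[THEN ipath_distinct] by auto
  qed
  have "set (p # b1 @ q # b2 @ r # b3) \<inter> ?F = {}" using CF by (simp only: list.set)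
  then have "distinct ((p # b1 @ q # b2 @ r # b3) @ (s # l1 @ l2 @ l3))"
    using dC dF by (simp only: distinct_append)
  then have d: "distinct (p # b1 @ q # b2 @ r # b3 @ s # l1 @ l2 @ l3)"
    by (simp only: append_Cons append_assoc append_Nil)
  have sn: "path_arcs (s # l @ [z]) = path_arcs (s # l) \<union> {(last (s # l), z), (z, last (s # l))}" for l z
    using path_arcs_snoc[of "s # l" z] by simp
  have R: "?cyc \<union> path_arcs (s # l1 @ [p]) \<union> path_arcs (s # l2 @ [q]) \<union> path_arcs (s # l3 @ [r])
     = ?cyc \<union> ?A \<union> ?X \<union> ?X\<inverse>"
    unfolding sn by auto
  have subC: "?cyc \<subseteq> ?C \<times> ?C"
  proof -
    have "set (p # b1 @ q # b2 @ r # b3 @ [p]) = ?C" by auto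
    then show ?thesis using path_arcs_subset by metis
  qed
  have "path_arcs (s # l1) \<subseteq> ?F \<times> ?F" "path_arcs (s # l2) \<subseteq> ?F \<times> ?F" "path_arcs (s # l3) \<subseteq> ?F \<times> ?F"
    using path_arcs_subset[of "s # l1"] path_arcs_subset[of "s # l2"] path_arcs_subset[of "s # l3"] by auto
  then have subF: "?A \<subseteq> ?F \<times> ?F" by blast
  have "last (s # l1) \<in> ?F" "last (s # l2) \<in> ?F" "last (s # l3) \<in> ?F" by auto
  then have subX: "?X \<subseteq> ?F \<times> ?C" by auto
  have iff: "x \<sim> y \<longleftrightarrow> (x, y) \<in> ?cyc \<union> ?A \<union> ?X \<union> ?X\<inverse>" if "x \<in> ?C \<union> ?F" "y \<in> ?C \<union> ?F" for x y
  proof -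
    consider "x \<in> ?C" "y \<in> ?C" | "x \<in> ?F" "y \<in> ?C" | "x \<in> ?C" "y \<in> ?F" | "x \<in> ?F" "y \<in> ?F"
      using \<open>x \<in> ?C \<union> ?F\<close> \<open>y \<in> ?C \<union> ?F\<close> by blast
    then show ?thesis
    proof cases
      case 1
      then have "x \<sim> y \<longleftrightarrow> (x, y) \<in> ?cyc" using hole_at_adj_iff[OF C, of x y] by simp
      moreover have "(x, y) \<notin> ?A \<union> ?X \<union> ?X\<inverse>" using subF subX 1 CF by blast
      ultimately show ?thesis by blast
    next
      case 2
      then have "x \<sim> y \<longleftrightarrow> (x, y) \<in> ?X" using att[of x y] by blast
      moreover have "(x, y) \<notin> ?A \<union> ?cyc \<union> ?X\<inverse>" using subF subC subX 2 CF by blast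
      ultimately show ?thesis by blast
    next
      case 3
      then have "x \<sim> y \<longleftrightarrow> (y, x) \<in> ?X" using att[of y x] adj_commute[of x y] by blast
      moreover have "(x, y) \<notin> ?A \<union> ?cyc \<union> ?X" using subF subC subX 3 CF by blast
      ultimately show ?thesis by blast
    next
      case 4
      have F: "?F = insert s (set l1 \<union> set l2 \<union> set l3)" by auto
      have "x \<sim> y \<longleftrightarrow> (x, y) \<in> ?A"
      proof
        assume "x \<sim> y"
        have "(x \<in> set (s # l1) \<and> y \<in> set (s # l1)) \<or> (x \<in> set (s # l2) \<and> y \<in> set (s # l2)) \<or> (x \<in> set (s # l3) \<and> y \<in> set (s # l3))"
          using 4 cross[of x y] cross[of y x] \<open>x \<sim> y\<close> adj_sym[OF \<open>x \<sim> y\<close>] unfolding F by auto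
        then show "(x, y) \<in> ?A" using \<open>x \<sim> y\<close> legs[THEN ipath_adj_iff] by blast
      next
        assume "(x, y) \<in> ?A"
        then show "x \<sim> y" using path_arcs_subset legs[THEN ipath_adj_iff] by blast
      qed
      moreover have "(x, y) \<notin> ?cyc \<union> ?X \<union> ?X\<inverse>" using subC subX 4 CF by blast
      ultimately show ?thesis by blast
    qed
  qed
  have S: "?C \<union> ?F = set (p # b1 @ q # b2 @ r # b3 @ s # l1 @ l2 @ l3)" by auto
  show ?thesis unfolding spider_def
    apply (rule exI[of _ p], rule exI[of _ q], rule exI[of _ r], rule exI[of _ s])
    apply (rule exI[of _ b1], rule exI[of _ b2], rule exI[of _ b3])
    apply (rule exI[of _ l1], rule exI[of _ l2], rule exI[of _ l3])
    apply (intro conjI d S ballI)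
    unfolding R by (rule iff)
qed

end

subsection \<open>Connected sets attached to a hole\<close>

locale ISK4_wheel_free_rel = sym_rel E for E :: "'a \<Rightarrow> 'a \<Rightarrow> bool" (infix "\<sim>" 50) +
  fixes V :: "'a set"
  assumes finite_V: "finite V"
    and adj_V: "x \<sim> y \<Longrightarrow> x \<in> V"
    and no_spider: "S \<subseteq> V \<Longrightarrow> \<not> spider (\<sim>) S"
    and no_wheel: "hole_at x xs \<Longrightarrow> insert v (insert x (set xs)) \<subseteq> V \<Longrightarrow> v \<notin> insert x (set xs) \<Longrightarrow>
      card {u \<in> insert x (set xs). v \<sim> u} \<le> 2"
begin

lemma wheelD:
  assumes "hole_at x xs" "insert v (insert x (set xs)) \<subseteq> V" "v \<notin> insert x (set xs)"
    and "{a, b, c} \<subseteq> insert x (set xs)" "distinct [a, b, c]" "v \<sim> a" "v \<sim> b" "v \<sim> c"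
  shows False
proof -
  have "{a, b, c} \<subseteq> {u \<in> insert x (set xs). v \<sim> u}" using assms by auto
  then have "card {a, b, c} \<le> card {u \<in> insert x (set xs). v \<sim> u}" by (intro card_mono) auto
  then show False using no_wheel[OF assms(1-3)] assms(5) by auto
qed

lemma hole_wheelD:
  assumes "hole C" "C \<subseteq> V" "v \<in> V" "v \<notin> C" "{a, b, c} \<subseteq> C" "distinct [a, b, c]" "v \<sim> a" "v \<sim> b" "v \<sim> c"
  shows False
  using assms wheelD unfolding hole_def by (metis insert_subset)

lemma no_spiderI:
  assumes C: "hole_at p (b1 @ q # b2 @ r # b3)"
    and V: "insert p (set (b1 @ q # b2 @ r # b3)) \<union> set (s # l1 @ l2 @ l3) \<subseteq> V"
    and CF: "insert p (set (b1 @ q # b2 @ r # b3)) \<inter> set (s # l1 @ l2 @ l3) = {}"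
    and legs: "ipath (s # l1)" "ipath (s # l2)" "ipath (s # l3)"
    and cross: "\<And>x y. x \<in> set l1 \<Longrightarrow> y \<in> set l2 \<Longrightarrow> x \<noteq> y \<and> \<not> x \<sim> y"
      "\<And>x y. x \<in> set l1 \<Longrightarrow> y \<in> set l3 \<Longrightarrow> x \<noteq> y \<and> \<not> x \<sim> y"
      "\<And>x y. x \<in> set l2 \<Longrightarrow> y \<in> set l3 \<Longrightarrow> x \<noteq> y \<and> \<not> x \<sim> y"
    and att: "\<And>x y. x \<in> set (s # l1 @ l2 @ l3) \<Longrightarrow> y \<in> insert p (set (b1 @ q # b2 @ r # b3)) \<Longrightarrow>
      x \<sim> y \<longleftrightarrow> (x = last (s # l1) \<and> y = p) \<or> (x = last (s # l2) \<and> y = q) \<or> (x = last (s # l3) \<and> y = r)"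
  shows False
  using no_spider[OF V] spiderI[OF C CF legs cross att] by blast

text \<open>If \<open>r\<close> has one neighbour \<open>u\<close> on the path, then
  \<open>u\<close> is the centre of a spider: two legs run along the path, the third is the edge to
  \<open>r\<close>. If it has more, the path replaces the part of \<open>C\<close> from
  \<open>p\<close> through \<open>r\<close> to \<open>q\<close>. In this new hole \<open>r\<close>
  has exactly two neighbours, and the old arc from \<open>r\<close> to \<open>p\<close> is the third
  leg of a spider with centre \<open>r\<close>.\<close>

lemma attach_path_False:
  assumes C: "hole C" "C \<subseteq> V" and pqr: "p \<in> C" "q \<in> C" "r \<in> C" "distinct [p, q, r]"
    and fs: "ipath fs" "fs \<noteq> []" "set fs \<subseteq> V" "set fs \<inter> C = {}"
    and p: "\<And>x. x \<in> set fs \<Longrightarrow> x \<sim> p \<longleftrightarrow> x = hd fs"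
    and q: "\<And>x. x \<in> set fs \<Longrightarrow> x \<sim> q \<longleftrightarrow> x = last fs"
    and r: "\<exists>x\<in>set fs. x \<sim> r"
    and other: "\<And>x y. x \<in> set fs \<Longrightarrow> y \<in> C \<Longrightarrow> x \<sim> y \<Longrightarrow> y = p \<or> y = q \<or> y = r"
  shows False
proof -
  obtain c1 c2 b where H: "hole_at p (c1 @ r # c2 @ q # b)"
    and Ceq: "C = insert p (set (c1 @ r # c2 @ q # b))" and "3 \<le> length (c1 @ r # c2 @ q # b)"
    using pqr(4) by (auto intro: hole_three[OF C(1) pqr(1,3,2)])
  have dC: "distinct (p # c1 @ r # c2 @ q # b)"
    using H ipath_distinct unfolding hole_at_def by (metis distinct.simps(2))
  have dfs: "distinct fs" using fs ipath_distinct by blast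
  obtain u where u: "u \<in> set fs" "u \<sim> r" using r by blast
  then obtain m1 m2 where m: "fs = m1 @ u # m2" by (meson split_list)
  show False
  proof (cases "\<exists>w\<in>set fs. w \<sim> r \<and> w \<noteq> u")
    case False
    have lastm1: "last (u # rev m1) = hd fs" using m by (cases m1) (auto)
    have lastm2: "last (u # m2) = last fs" using m by auto
    show False
    proof (rule no_spiderI[of p c1 r c2 q b u "rev m1" "[]" m2])
      show "insert p (set (c1 @ r # c2 @ q # b)) \<union> set (u # rev m1 @ [] @ m2) \<subseteq> V"
        using fs C unfolding m Ceq by auto
      show "insert p (set (c1 @ r # c2 @ q # b)) \<inter> set (u # rev m1 @ [] @ m2) = {}"
        using fs(4) unfolding m Ceq by auto
      have "ipath (rev (m1 @ [u]))" using fs(1) unfolding ipath_rev m by (simp add: ipath_append)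
      then show "ipath (u # rev m1)" by simp
      show "ipath (u # m2)" using fs(1) unfolding m by (simp add: ipath_append)
      show "x \<noteq> y \<and> \<not> x \<sim> y" if "x \<in> set (rev m1)" "y \<in> set m2" for x y
        using fs(1) that dfs unfolding m by (auto simp: ipath_append)
      show "x \<sim> y \<longleftrightarrow> (x = last (u # rev m1) \<and> y = p) \<or> (x = last [u] \<and> y = r) \<or> (x = last (u # m2) \<and> y = q)"
        if "x \<in> set (u # rev m1 @ [] @ m2)" "y \<in> insert p (set (c1 @ r # c2 @ q # b))" for x y
      proof -
        have x: "x \<in> set fs" and y: "y \<in> C" using that m Ceq by auto
        have r': "x \<sim> r \<longleftrightarrow> x = u" using False x u by blast
        consider "y = p" | "y = q" | "y = r" | "y \<noteq> p" "y \<noteq> q" "y \<noteq> r" by blast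
        then show ?thesis unfolding lastm1 lastm2
          using p[OF x] q[OF x] r' other[OF x y] pqr(4) by cases auto
      qed
    qed (use H in auto)
  next
    case True
    then obtain w where w: "w \<in> set fs" "w \<sim> r" "w \<noteq> u" by blast
    let ?Z = "insert p (set (fs @ q # b))"
    have ne: "hd fs \<in> set fs" "last fs \<in> set fs" using fs by auto
    have H2: "ipath (c1 @ r # c2 @ q # b)" "\<And>y. y \<in> set (c1 @ r # c2 @ q # b) \<Longrightarrow> p \<sim> y \<longleftrightarrow> y = hd (c1 @ r # c2 @ q # b) \<or> y = last (c1 @ r # c2 @ q # b)"
      using H unfolding hole_at_def by blast+
    have hd_notin: "hd (c1 @ r # c2 @ q # b) \<notin> set (q # b)" using dC by (cases c1) auto
    have oth: "\<not> x \<sim> y" if "x \<in> set fs" "y \<in> set b" for x y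
      using other[OF that(1), of y] that dC unfolding Ceq by auto
    have Z: "hole_at p (fs @ q # b)"
      unfolding hole_at_def
    proof (intro conjI ballI)
      show "ipath (fs @ q # b)"
        using fs H2(1) ne q oth unfolding ipath_append[of fs] Ceq by (auto simp: ipath_append)
      show "p \<notin> set (fs @ q # b)" using fs(4) dC unfolding Ceq by auto
      show "2 \<le> length (fs @ q # b)" using fs(2) by (cases fs) auto
      fix y assume y: "y \<in> set (fs @ q # b)"
      show "p \<sim> y \<longleftrightarrow> y = hd (fs @ q # b) \<or> y = last (fs @ q # b)"
      proof (cases "y \<in> set fs")
        case True
        then have "y \<noteq> last (q # b)" using fs(4) unfolding Ceq by auto
        then show ?thesis using True p[OF True] fs(2) adj_commute[of p y] by auto
      next
        case False
        then have "y \<in> set (q # b)" using y by auto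
        moreover have "y \<noteq> hd fs" using False ne by auto
        ultimately show ?thesis using H2(2)[of y] hd_notin fs(2) by auto
      qed
    qed
    have rZ: "r \<notin> ?Z" using fs(4) dC unfolding Ceq by auto
    have ZV: "insert r ?Z \<subseteq> V" using C(2) fs(3) unfolding Ceq by auto
    have uw: "r \<sim> u" "r \<sim> w" using u w adj_sym by auto
    \<comment> \<open>\<open>u\<close> and \<open>w\<close> are two neighbours of \<open>r\<close>
      on the new hole; a third one would make a wheel.\<close>
    have only: "z = u \<or> z = w" if "z \<in> ?Z" "r \<sim> z" for z
    proof (rule ccontr)
      assume "\<not> (z = u \<or> z = w)"
      then show False using wheelD[OF Z ZV rZ, of u w z] that u w uw by auto
    qed
    have np: "\<not> r \<sim> p" "\<not> r \<sim> q" using only[of p] only[of q] u w fs(4) pqr Ceq by auto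
    \<comment> \<open>As \<open>p\<close> is not adjacent to \<open>r\<close>, the old arc between
      them has inner vertices, and these form the third leg.\<close>
    have c1: "c1 \<noteq> []" using np(1) H2(2)[of r] adj_commute[of r p] by auto
    obtain x1 x2 n1 n2 n3 where fs_eq: "fs = n1 @ x1 # n2 @ x2 # n3" and x12: "{x1, x2} = {u, w}"
    proof -
      have "w \<in> set m1 \<or> w \<in> set m2" using w m by auto
      then show ?thesis
      proof
        assume "w \<in> set m1"
        then obtain k1 k2 where "m1 = k1 @ w # k2" by (meson split_list)
        then show ?thesis using that[of k1 w k2 u m2] m by auto
      next
        assume "w \<in> set m2"
        then obtain k1 k2 where "m2 = k1 @ w # k2" by (meson split_list)
        then show ?thesis using that[of m1 u k1 w k2] m by auto
      qed
    qed
    have xx: "r \<sim> x1" "r \<sim> x2" "\<And>z. z \<in> ?Z \<Longrightarrow> r \<sim> z \<Longrightarrow> z = x1 \<or> z = x2"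
    proof -
      have "x1 \<in> {u, w}" "x2 \<in> {u, w}" "u \<in> {x1, x2}" "w \<in> {x1, x2}" using x12 by blast+
      then show "r \<sim> x1" "r \<sim> x2" "\<And>z. z \<in> ?Z \<Longrightarrow> r \<sim> z \<Longrightarrow> z = x1 \<or> z = x2" using uw only by blast+
    qed
    have lastc1: "last (r # rev c1) = hd c1" using c1 by (cases c1) auto
    have ic: "ipath (c1 @ [r])" using H2(1) by (simp add: ipath_append)
    have Z': "fs @ q # b = n1 @ x1 # n2 @ x2 # (n3 @ q # b)" using fs_eq by simp
    show False
    proof (rule no_spiderI[of p n1 x1 n2 x2 "n3 @ q # b" r "rev c1" "[]" "[]"])
      show "hole_at p (n1 @ x1 # n2 @ x2 # (n3 @ q # b))" using Z unfolding Z' .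
      show "insert p (set (n1 @ x1 # n2 @ x2 # (n3 @ q # b))) \<union> set (r # rev c1 @ [] @ []) \<subseteq> V"
        using ZV C(2) unfolding Z'[symmetric] Ceq by auto
      show "insert p (set (n1 @ x1 # n2 @ x2 # (n3 @ q # b))) \<inter> set (r # rev c1 @ [] @ []) = {}"
        using fs(4) dC unfolding Z'[symmetric] Ceq by auto
      show "ipath (r # rev c1)" using ic ipath_rev[of "c1 @ [r]"] by simp
      show "x \<sim> y \<longleftrightarrow> (x = last (r # rev c1) \<and> y = p) \<or> (x = last [r] \<and> y = x1) \<or> (x = last [r] \<and> y = x2)"
        if x: "x \<in> set (r # rev c1 @ [] @ [])" and y: "y \<in> insert p (set (n1 @ x1 # n2 @ x2 # (n3 @ q # b)))" for x y
      proof -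
        have y: "y \<in> ?Z" using y unfolding Z'[symmetric] .
        have x12Z: "x1 \<in> set fs" "x2 \<in> set fs" using fs_eq by auto
        show ?thesis
        proof (cases "x = r")
          case True
          have "r \<noteq> hd c1" using c1 dC by auto
          then show ?thesis using True xx(1,2) xx(3)[OF y] lastc1 by auto
        next
          case False
          then have x: "x \<in> set c1" using x by auto
          have "x \<sim> y \<longleftrightarrow> x = hd c1 \<and> y = p"
          proof (cases "y = p")
            case True
            have "x \<noteq> last (q # b)" using x dC by (cases b) auto
            then have "p \<sim> x \<longleftrightarrow> x = hd c1" using H2(2)[of x] x c1 by auto
            then show ?thesis using True adj_commute[of x y] by simp
          next
            case ny: False
            have "\<not> x \<sim> y"
            proof (cases "y \<in> set fs")
              case True
              have "x \<in> C" "x \<notin> {p, q, r}" using x dC Ceq by auto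
              then show ?thesis using other[OF True] adj_sym[of x y] by blast
            next
              case False
              then have "y \<in> set (q # b)" using y ny by auto
              then show ?thesis using H2(1) x dC unfolding ipath_append[of c1] by auto
            qed
            then show ?thesis using ny by simp
          qed
          then show ?thesis using False lastc1 by auto
        qed
      qed
    qed auto
  qed
qed

text \<open>Reroute \<open>C\<close> from \<open>p\<close> to \<open>q\<close> through the edge
  \<open>t1 t2\<close> and its two legs. On the new hole \<open>t3\<close> is the centre of a
  spider, with direct edges to \<open>t1\<close> and \<open>t2\<close> and its own leg to
  \<open>r\<close>.\<close>

lemma attach_triangle_nonadj_False:
  assumes C: "hole C" "C \<subseteq> V" and pqr: "p \<in> C" "q \<in> C" "r \<in> C" "distinct [p, q, r]"
    and X: "ipath (t1 # l1)" "ipath (t2 # l2)" "ipath (t3 # l3)"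
    and F: "F = set ((t1 # l1) @ (t2 # l2) @ (t3 # l3))" "F \<subseteq> V" "F \<inter> C = {}"
    and t: "t1 \<sim> t2" "t1 \<sim> t3" "t2 \<sim> t3"
    and cross: "\<And>x y. x \<in> set (t1 # l1) \<Longrightarrow> y \<in> set (t2 # l2) \<Longrightarrow> x \<noteq> y \<and> (x \<sim> y \<longrightarrow> x = t1 \<and> y = t2)"
      "\<And>x y. x \<in> set (t1 # l1) \<Longrightarrow> y \<in> set (t3 # l3) \<Longrightarrow> x \<noteq> y \<and> (x \<sim> y \<longrightarrow> x = t1 \<and> y = t3)"
      "\<And>x y. x \<in> set (t2 # l2) \<Longrightarrow> y \<in> set (t3 # l3) \<Longrightarrow> x \<noteq> y \<and> (x \<sim> y \<longrightarrow> x = t2 \<and> y = t3)"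
    and att: "\<And>x y. x \<in> F \<Longrightarrow> y \<in> C \<Longrightarrow>
      x \<sim> y \<longleftrightarrow> (x = last (t1 # l1) \<and> y = p) \<or> (x = last (t2 # l2) \<and> y = q) \<or> (x = last (t3 # l3) \<and> y = r)"
    and nadj: "\<not> p \<sim> q"
  shows False
proof -
  obtain b2 b3 b1 where H: "hole_at r (b3 @ p # b1 @ q # b2)"
    and Ceq: "C = insert r (set (b3 @ p # b1 @ q # b2))" and "3 \<le> length (b3 @ p # b1 @ q # b2)"
    using pqr(4) by (auto intro: hole_three[OF C(1) pqr(3,1,2)])
  let ?xs = "b3 @ p # b1 @ q # b2"
  have H2: "ipath ?xs" "\<And>y. y \<in> set ?xs \<Longrightarrow> r \<sim> y \<longleftrightarrow> y = hd ?xs \<or> y = last ?xs"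
    using H unfolding hole_at_def by blast+
  have dC: "distinct (r # ?xs)"
    using H ipath_distinct unfolding hole_at_def by (metis distinct.simps(2))
  \<comment> \<open>An edge from \<open>p\<close> to \<open>q\<close> would be a chord of the
    rerouted cycle. Its absence means that the replaced arc has inner vertices.\<close>
  have b1: "b1 \<noteq> []"
  proof
    assume "b1 = []"
    then have "ipath (p # q # b2)" using H2(1) ipath_append[of b3 "p # q # b2"] by simp
    then show False using nadj by simp
  qed
  let ?X1 = "rev (t1 # l1)" and ?X2 = "t2 # l2"
  have in_F: "set ?X1 \<subseteq> F" "set ?X2 \<subseteq> F" "set (t3 # l3) \<subseteq> F" using F(1) by auto
  have ends: "hd ?X1 = last (t1 # l1)" "last ?X1 = t1" by (auto simp: hd_rev)
  have nF: "x \<in> F \<Longrightarrow> x \<notin> C" for x using F(3) by auto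
  have diff: "x \<noteq> y" if "x \<in> set (t1 # l1)" "y \<in> set (t2 # l2) \<union> set (t3 # l3)" for x y using cross that by blast
  have diff2: "x \<noteq> y" if "x \<in> set (t2 # l2)" "y \<in> set (t3 # l3)" for x y using cross that by blast
  have lasts: "last (t1 # l1) \<in> set (t1 # l1)" "last (t2 # l2) \<in> set (t2 # l2)" "last (t3 # l3) \<in> set (t3 # l3)"
    by (rule last_in_set, simp)+
  have a1: "x \<sim> y \<longleftrightarrow> x = last (t1 # l1) \<and> y = p" if x: "x \<in> set (t1 # l1)" and y: "y \<in> C" for x y
  proof -
    have "x \<noteq> last (t2 # l2)" "x \<noteq> last (t3 # l3)" using diff[OF x] lasts by blast+
    moreover have "x \<in> F" using x in_F by auto
    ultimately show ?thesis using att[OF _ y, of x] by blast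
  qed
  have a2: "x \<sim> y \<longleftrightarrow> x = last (t2 # l2) \<and> y = q" if x: "x \<in> set (t2 # l2)" and y: "y \<in> C" for x y
  proof -
    have "last (t1 # l1) \<noteq> x" "x \<noteq> last (t3 # l3)" using diff[OF lasts(1), of x] diff2[OF x] x lasts by blast+
    moreover have "x \<in> F" using x in_F by auto
    ultimately show ?thesis using att[OF _ y, of x] by blast
  qed
  have a3: "x \<sim> y \<longleftrightarrow> x = last (t3 # l3) \<and> y = r" if x: "x \<in> set (t3 # l3)" and y: "y \<in> C" for x y
  proof -
    have "last (t1 # l1) \<noteq> x" "last (t2 # l2) \<noteq> x" using diff[OF lasts(1), of x] diff2[OF lasts(2), of x] x by blast+
    moreover have "x \<in> F" using x in_F by auto
    ultimately show ?thesis using att[OF _ y, of x] by blast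
  qed
  let ?ys = "(b3 @ [p]) @ ?X1 @ ?X2 @ (q # b2)"
  have sub: "set (b3 @ [p]) \<subseteq> C" "set (q # b2) \<subseteq> C" using Ceq by auto
  have i12: "ipath (?X2 @ (q # b2))"
    unfolding ipath_append[of ?X2]
  proof (intro conjI impI ballI)
    show "ipath ?X2" by (rule X)
    show "ipath (q # b2)" using H2(1) ipath_append[of "b3 @ p # b1" "q # b2"] by simp
    show "last ?X2 \<sim> hd (q # b2)" using a2[of "last ?X2" q] lasts pqr by simp
    fix x y assume xy: "x \<in> set ?X2" "y \<in> set (q # b2)"
    show "x \<noteq> y" using xy sub nF[of x] in_F by blast
    assume "x \<sim> y"
    then show "x = last ?X2" "y = hd (q # b2)" using a2[of x y] xy sub by auto
  qed
  have i1: "ipath (?X1 @ ?X2 @ (q # b2))"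
    unfolding ipath_append[of ?X1]
  proof (intro conjI impI ballI)
    show "ipath ?X1" using X(1) unfolding ipath_rev .
    show "ipath (?X2 @ (q # b2))" by (rule i12)
    show "last ?X1 \<sim> hd (?X2 @ (q # b2))" using t by simp
    fix x y assume x: "x \<in> set ?X1" and y: "y \<in> set (?X2 @ (q # b2))"
    then have x': "x \<in> set (t1 # l1)" by simp
    have "y \<in> set ?X2 \<or> y \<in> C \<and> y \<noteq> p" using y sub dC by auto
    then have "x \<noteq> y \<and> (x \<sim> y \<longrightarrow> x = t1 \<and> y = t2)"
      using cross(1)[OF x'] a1[OF x'] nF[of x] in_F x by blast
    then show "x \<noteq> y" "x \<sim> y \<Longrightarrow> x = last ?X1" "x \<sim> y \<Longrightarrow> y = hd (?X2 @ (q # b2))" by auto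
  qed
  have ip: "ipath ?ys"
    unfolding ipath_append[of "b3 @ [p]"]
  proof (intro conjI impI ballI)
    show "ipath (b3 @ [p])" using H2(1) by (simp add: ipath_append)
    show "ipath (?X1 @ ?X2 @ (q # b2))" by (rule i1)
    have "last (b3 @ [p]) \<sim> last (t1 # l1)" using a1[of "last (t1 # l1)" p] lasts pqr(1) adj_sym by simp
    then show "last (b3 @ [p]) \<sim> hd (?X1 @ ?X2 @ (q # b2))" using ends by (metis hd_append2 list.simps(3) rev_is_Nil_conv)
    fix x y assume x: "x \<in> set (b3 @ [p])" and y: "y \<in> set (?X1 @ ?X2 @ (q # b2))"
    have xC: "x \<in> C" using x sub by auto
    have h: "hd (?X1 @ ?X2 @ (q # b2)) = last (t1 # l1)" using ends by (metis hd_append2 list.simps(3) rev_is_Nil_conv)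
    have bb: "x \<noteq> z \<and> \<not> x \<sim> z" if "z \<in> set (q # b2)" for z
    proof -
      have "ipath ((b3 @ [p]) @ b1 @ (q # b2))" using H2(1) by simp
      moreover have "z \<noteq> hd (b1 @ (q # b2))" using b1 that dC by (cases b1) auto
      ultimately show ?thesis using x that unfolding ipath_append[of "b3 @ [p]"] by auto
    qed
    consider "y \<in> set (t1 # l1)" | "y \<in> set (t2 # l2)" | "y \<in> set (q # b2)" using y by auto
    then have "x \<noteq> y \<and> (x \<sim> y \<longrightarrow> x = p \<and> y = last (t1 # l1))"
    proof cases
      case 1
      then have "y \<in> F" using in_F by auto
      then show ?thesis using a1[OF 1 xC] adj_commute[of x y] nF[of y] xC by auto
    next
      case 2
      then have "y \<in> F" using in_F by auto
      moreover have "x \<noteq> q" using bb[of q] by auto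
      ultimately show ?thesis using a2[OF 2 xC] adj_commute[of x y] nF[of y] xC by auto
    next
      case 3 then show ?thesis using bb by blast
    qed
    then show "x \<noteq> y" "x \<sim> y \<Longrightarrow> x = last (b3 @ [p])" "x \<sim> y \<Longrightarrow> y = hd (?X1 @ ?X2 @ (q # b2))"
      using h by auto
  qed
  have hdys: "hd ?ys = hd ?xs" and lastys: "last ?ys = last ?xs" by (cases b3) auto
  have Z: "hole_at r ?ys"
    unfolding hole_at_def
  proof (intro conjI ballI)
    show "ipath ?ys" by (rule ip)
    show "r \<notin> set ?ys" using dC nF[of r] pqr(3) in_F by auto
    show "2 \<le> length ?ys" by simp
    fix y assume y: "y \<in> set ?ys"
    show "r \<sim> y \<longleftrightarrow> y = hd ?ys \<or> y = last ?ys"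
    proof (cases "y \<in> F")
      case True
      have "r \<noteq> p" "r \<noteq> q" using pqr(4) by auto
      have "y \<in> set (t1 # l1) \<or> y \<in> set (t2 # l2)" using y nF[OF True] sub by auto
      then have "\<not> r \<sim> y" using a1[of y r] a2[of y r] pqr adj_commute[of r y] by auto
      moreover have "hd ?xs \<in> C" "last ?xs \<in> C" unfolding Ceq by (simp_all add: hd_append last_append)
      ultimately show ?thesis using hdys lastys nF[OF True] by auto
    next
      case False
      then have "y \<in> set ?xs" using y in_F by auto
      then show ?thesis using H2(2)[of y] hdys lastys by simp
    qed
  qed
  have ys: "?ys = (b3 @ p # rev l1) @ t1 # [] @ t2 # (l2 @ q # b2)" by simp
  have ysV: "set ?ys \<subseteq> C \<union> set (t1 # l1) \<union> set (t2 # l2)" using sub by auto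
  show False
  proof (rule no_spiderI[of r "b3 @ p # rev l1" t1 "[]" t2 "l2 @ q # b2" t3 l3 "[]" "[]"])
    show "hole_at r ((b3 @ p # rev l1) @ t1 # [] @ t2 # (l2 @ q # b2))" using Z unfolding ys .
    have S: "insert r (set ?ys) \<subseteq> C \<union> set (t1 # l1) \<union> set (t2 # l2)" using ysV pqr(3) by blast
    have S': "insert r (set ((b3 @ p # rev l1) @ t1 # [] @ t2 # (l2 @ q # b2))) \<subseteq> C \<union> set (t1 # l1) \<union> set (t2 # l2)"
      using S unfolding ys .
    have SV: "C \<union> set (t1 # l1) \<union> set (t2 # l2) \<union> set (t3 # l3) \<subseteq> V" using in_F C(2) F(2) by auto
    have e: "set (t3 # l3 @ [] @ []) = set (t3 # l3)" by simp
    show "insert r (set ((b3 @ p # rev l1) @ t1 # [] @ t2 # (l2 @ q # b2))) \<union> set (t3 # l3 @ [] @ []) \<subseteq> V"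
      unfolding e using S' SV by blast
    show "insert r (set ((b3 @ p # rev l1) @ t1 # [] @ t2 # (l2 @ q # b2))) \<inter> set (t3 # l3 @ [] @ []) = {}"
    proof -
      have "x \<notin> C" "x \<notin> set (t1 # l1)" "x \<notin> set (t2 # l2)" if "x \<in> set (t3 # l3)" for x
        using that nF in_F diff[of x x] diff2[of x x] by blast+
      then show ?thesis unfolding e using S' by blast
    qed
    show "ipath (t3 # l3)" by (rule X)
    fix x y assume x: "x \<in> set (t3 # l3 @ [] @ [])" and y: "y \<in> insert r (set ((b3 @ p # rev l1) @ t1 # [] @ t2 # (l2 @ q # b2)))"
    have x: "x \<in> set (t3 # l3)" using x by simp
    have "y \<in> insert r (set ?ys)" using y unfolding ys .
    then consider "y \<in> C" | "y \<in> set (t1 # l1)" | "y \<in> set (t2 # l2)" using S by blast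
    then show "x \<sim> y \<longleftrightarrow> (x = last (t3 # l3) \<and> y = r) \<or> (x = last [t3] \<and> y = t1) \<or> (x = last [t3] \<and> y = t2)"
    proof cases
      case 1
      have "t1 \<notin> C" "t2 \<notin> C" using nF in_F by auto
      then show ?thesis using a3[OF x 1] 1 by auto
    next
      case 2
      have "y \<notin> C" "y \<noteq> t2" using nF in_F 2 diff[of y t2] by auto
      then show ?thesis using cross(2)[OF 2 x] t adj_commute[of x y] pqr(3) by auto
    next
      case 3
      have "y \<notin> C" "y \<noteq> t1" using nF in_F 3 diff[of t1 y] by auto
      then show ?thesis using cross(3)[OF 3 x] t adj_commute[of x y] pqr(3) by auto
    qed
  qed auto
qed

text \<open>A \<open>hole\<close> has at least four vertices. This provides the non-adjacent pair
  that rerouting through a triangle needs.\<close>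

lemma hole_not_triangle:
  assumes "hole C" "p \<in> C" "q \<in> C" "r \<in> C" "distinct [p, q, r]"
  shows "\<not> p \<sim> q \<or> \<not> p \<sim> r \<or> \<not> q \<sim> r"
proof (rule ccontr)
  assume a: "\<not> ?thesis"
  obtain xs where xs: "hole_at p xs" "3 \<le> length xs" "C = insert p (set xs)"
    using hole_at_elim assms by metis
  have qr: "q \<in> set xs" "r \<in> set xs" "q = hd xs \<or> q = last xs" "r = hd xs \<or> r = last xs"
    using assms xs a unfolding hole_at_def by auto
  obtain x ys y where e: "xs = x # ys @ [y]" "ys \<noteq> []"
  proof -
    obtain x y z zs where "xs = x # y # z # zs" using xs(2) by (auto simp: numeral_3_eq_3 Suc_le_length_iff)
    then have "xs = x # butlast (y # z # zs) @ [last (z # zs)]" "butlast (y # z # zs) \<noteq> []" by simp_all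
    then show ?thesis using that by blast
  qed
  have "{q, r} = {x, y}" using qr(3,4) e assms(5) by auto
  then have "x \<sim> y" using a adj_sym by (metis doubleton_eq_iff)
  moreover have "\<not> x \<sim> y" using xs(1) e unfolding hole_at_def by (cases ys) auto
  ultimately show False by blast
qed

text \<open>Some two of the three attachments are not adjacent, and the configuration is symmetric
  under relabelling the legs.\<close>

lemma attach_triangle_False:
  assumes C: "hole C" "C \<subseteq> V" and pqr: "p \<in> C" "q \<in> C" "r \<in> C" "distinct [p, q, r]"
    and X: "ipath (t1 # l1)" "ipath (t2 # l2)" "ipath (t3 # l3)"
    and F: "F = set ((t1 # l1) @ (t2 # l2) @ (t3 # l3))" "F \<subseteq> V" "F \<inter> C = {}"
    and t: "t1 \<sim> t2" "t1 \<sim> t3" "t2 \<sim> t3"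
    and cross: "\<And>x y. x \<in> set (t1 # l1) \<Longrightarrow> y \<in> set (t2 # l2) \<Longrightarrow> x \<noteq> y \<and> (x \<sim> y \<longrightarrow> x = t1 \<and> y = t2)"
      "\<And>x y. x \<in> set (t1 # l1) \<Longrightarrow> y \<in> set (t3 # l3) \<Longrightarrow> x \<noteq> y \<and> (x \<sim> y \<longrightarrow> x = t1 \<and> y = t3)"
      "\<And>x y. x \<in> set (t2 # l2) \<Longrightarrow> y \<in> set (t3 # l3) \<Longrightarrow> x \<noteq> y \<and> (x \<sim> y \<longrightarrow> x = t2 \<and> y = t3)"
    and att: "\<And>x y. x \<in> F \<Longrightarrow> y \<in> C \<Longrightarrow>
      x \<sim> y \<longleftrightarrow> (x = last (t1 # l1) \<and> y = p) \<or> (x = last (t2 # l2) \<and> y = q) \<or> (x = last (t3 # l3) \<and> y = r)"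
  shows False
proof -
  have cross': "\<And>x y. x \<in> set (t3 # l3) \<Longrightarrow> y \<in> set (t1 # l1) \<Longrightarrow> x \<noteq> y \<and> (x \<sim> y \<longrightarrow> x = t3 \<and> y = t1)"
     "\<And>x y. x \<in> set (t3 # l3) \<Longrightarrow> y \<in> set (t2 # l2) \<Longrightarrow> x \<noteq> y \<and> (x \<sim> y \<longrightarrow> x = t3 \<and> y = t2)"
     "\<And>x y. x \<in> set (t2 # l2) \<Longrightarrow> y \<in> set (t1 # l1) \<Longrightarrow> x \<noteq> y \<and> (x \<sim> y \<longrightarrow> x = t2 \<and> y = t1)"
    using cross adj_sym by blast+
  have d: "distinct [p, r, q]" "distinct [q, r, p]" using pqr(4) by auto
  have F': "F = set ((t1 # l1) @ (t3 # l3) @ (t2 # l2))" "F = set ((t2 # l2) @ (t3 # l3) @ (t1 # l1))"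
    unfolding F(1) by auto
  consider "\<not> p \<sim> q" | "\<not> p \<sim> r" | "\<not> q \<sim> r" using hole_not_triangle[OF C(1) pqr] by blast
  then show False
  proof cases
    case 1
    show False by (rule attach_triangle_nonadj_False[OF C pqr X F t cross att 1])
  next
    case 2
    show False
      by (rule attach_triangle_nonadj_False[OF C pqr(1,3,2) d(1) X(1,3,2) F'(1) F(2,3) t(2,1) adj_sym[OF t(3)] cross(2,1) cross'(2) _ 2])
        (use att in \<open>blast+\<close>)
  next
    case 3
    show False
      by (rule attach_triangle_nonadj_False[OF C pqr(2,3,1) d(2) X(2,3,1) F'(2) F(2,3) t(3) adj_sym[OF t(1)] adj_sym[OF t(2)] cross(3) cross'(3,1) _ 3])
        (use att in \<open>blast+\<close>)
  qed
qed

text \<open>Walk on \<open>ms\<close> from its end at \<open>q\<close> back to the last neighbour of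
  \<open>e\<close>, then turn into \<open>e # es\<close>. This is an induced path from
  \<open>q\<close> to \<open>r\<close> that also sees \<open>p\<close>, so
  \<open>attach_path_False\<close> applies with \<open>p\<close> as the middle vertex.\<close>

lemma attach_turn_False:
  assumes C: "hole C" "C \<subseteq> V" and pqr: "p \<in> C" "q \<in> C" "r \<in> C" "distinct [p, q, r]"
    and ms: "ms \<noteq> []" "ipath ms" and gs: "ipath (e # es)" and S: "set ms \<union> set (e # es) \<subseteq> V - C"
    and gM: "set (e # es) \<inter> set ms = {}" and eadj: "\<exists>m\<in>set ms. e \<sim> m"
    and far: "\<And>x m. x \<in> set es \<Longrightarrow> m \<in> set ms \<Longrightarrow> \<not> x \<sim> m"
    and q: "\<And>x. x \<in> set ms \<Longrightarrow> x \<sim> q \<longleftrightarrow> x = last ms" and noR: "\<And>x. x \<in> set ms \<Longrightarrow> \<not> x \<sim> r"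
    and r: "\<And>x. x \<in> set (e # es) \<Longrightarrow> x \<sim> r \<longleftrightarrow> x = last (e # es)"
    and noQ: "\<And>x. x \<in> set (e # es) \<Longrightarrow> \<not> x \<sim> q" and P: "\<exists>x\<in>set (e # es). x \<sim> p"
    and other: "\<And>x y. x \<in> set ms \<union> set (e # es) \<Longrightarrow> y \<in> C \<Longrightarrow> x \<sim> y \<Longrightarrow> y = p \<or> y = q \<or> y = r"
  shows False
proof -
  obtain m1 f m2 where m: "ms = m1 @ f # m2" "e \<sim> f" "\<forall>x\<in>set m2. \<not> e \<sim> x"
    using split_list_last_prop[OF eadj] by metis
  let ?fs = "rev (f # m2) @ e # es"
  have ip: "ipath ?fs" unfolding ipath_append[of "rev (f # m2)"]
  proof (intro conjI impI ballI)
    show "ipath (rev (f # m2))" unfolding ipath_rev using ms(2) unfolding m(1) ipath_append[of m1] by blast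
    show "ipath (e # es)" by (rule gs)
    show "last (rev (f # m2)) \<sim> hd (e # es)" using m(2) adj_sym by simp
    fix x y assume x: "x \<in> set (rev (f # m2))" and y: "y \<in> set (e # es)"
    have "x \<in> set ms" using x m(1) by auto
    then show "x \<noteq> y" using y gM by auto
    assume "x \<sim> y"
    then have "y = e" using far[of y x] y \<open>x \<in> set ms\<close> adj_sym[of x y] by auto
    then show "y = hd (e # es)" by simp
    show "x = last (rev (f # m2))" using m(3) x \<open>x \<sim> y\<close> \<open>y = e\<close> adj_sym by auto
  qed
  have hd: "hd ?fs = last ms" using m(1) by (simp add: hd_append hd_rev)
  have lastfs: "last ?fs = last (e # es)" by simp
  have sub: "set (rev (f # m2)) \<subseteq> set ms" using m(1) by auto
  have d: "distinct [q, r, p]" using pqr(4) by auto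
  show False
  proof (rule attach_path_False[OF C pqr(2,3,1) d ip])
    show "?fs \<noteq> []" by simp
    show "set ?fs \<subseteq> V" "set ?fs \<inter> C = {}" using sub S by auto
    fix x assume "x \<in> set ?fs"
    then have x: "x \<in> set ms \<or> x \<in> set (e # es)" using sub by auto
    have "last ms \<notin> set (e # es)" "last (e # es) \<notin> set ms" using gM last_in_set[OF ms(1)] last_in_set[of "e # es"] by blast+
    then show "x \<sim> q \<longleftrightarrow> x = hd ?fs" "x \<sim> r \<longleftrightarrow> x = last ?fs"
      unfolding hd lastfs using x q r noQ noR by blast+
  next
    show "\<exists>x\<in>set ?fs. x \<sim> p" using P by auto
    fix x y assume "x \<in> set ?fs" "y \<in> C" "x \<sim> y"
    then show "y = q \<or> y = r \<or> y = p" using other[of x y] sub by auto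
  qed
qed

text \<open>Join neighbours of \<open>p\<close> and \<open>q\<close> by a shortest path
  \<open>ms\<close> in \<open>F\<close>, and link \<open>ms\<close> to a neighbour of
  \<open>r\<close> by a shortest path \<open>gs\<close>. Either three legs meet in a vertex or in a
  triangle, or one induced path sees all three attachments. The only recursive case is that
  \<open>gs\<close> sees both \<open>p\<close> and \<open>q\<close>: then \<open>gs\<close> alone is
  a smaller set with the same attachments.\<close>

lemma attach_three_False:
  assumes C: "hole C" "C \<subseteq> V" and pqr: "p \<in> C" "q \<in> C" "r \<in> C" "distinct [p, q, r]"
    and F: "conn F" "F \<subseteq> V" "F \<inter> C = {}"
    and att: "\<And>y. y \<in> C \<Longrightarrow> (\<exists>x\<in>F. x \<sim> y) \<longleftrightarrow> y = p \<or> y = q \<or> y = r"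
  shows False
  using F att
proof (induction "card F" arbitrary: F rule: less_induct)
  case less
  have F: "conn F" "F \<subseteq> V" "F \<inter> C = {}"
    and att: "\<And>y. y \<in> C \<Longrightarrow> (\<exists>x\<in>F. x \<sim> y) \<longleftrightarrow> y = p \<or> y = q \<or> y = r" by fact+
  have finF: "finite F" using F(2) finite_V finite_subset by blast
  have other: "y = p \<or> y = q \<or> y = r" if "x \<in> F" "y \<in> C" "x \<sim> y" for x y using att that by blast
  obtain a b c where abc: "a \<in> F" "a \<sim> p" "b \<in> F" "b \<sim> q" "c \<in> F" "c \<sim> r"
    using att[OF pqr(1)] att[OF pqr(2)] att[OF pqr(3)] by auto
  obtain ms where ms: "ms \<noteq> []" "ipath ms" "set ms \<subseteq> F" "hd ms \<sim> p" "last ms \<sim> q"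
    "\<And>x. x \<in> set ms \<Longrightarrow> x \<sim> p \<Longrightarrow> x = hd ms" "\<And>x. x \<in> set ms \<Longrightarrow> x \<sim> q \<Longrightarrow> x = last ms"
    by (rule min_path[OF F(1) abc(1) _ abc(3), of "\<lambda>x. x \<sim> p" "\<lambda>x. x \<sim> q"]) (use abc in auto)
  have mp: "x \<sim> p \<longleftrightarrow> x = hd ms" and mq: "x \<sim> q \<longleftrightarrow> x = last ms" if "x \<in> set ms" for x
    using ms(4-7) that by blast+
  have msV: "set ms \<subseteq> V" "set ms \<inter> C = {}" using ms(3) F by auto
  show False
  proof (cases "\<exists>x\<in>set ms. x \<sim> r")
    case True
    show False
      by (rule attach_path_False[OF C pqr ms(2,1) msV mp mq True]) (use other ms(3) in \<open>blast+\<close>)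
  next
    case noR: False
    obtain gs' where gs': "gs' \<noteq> []" "ipath gs'" "set gs' \<subseteq> F" "hd gs' \<sim> r" "\<exists>m\<in>set ms. last gs' \<sim> m" "set gs' \<inter> set ms = {}"
      "\<And>x. x \<in> set gs' \<Longrightarrow> x \<sim> r \<Longrightarrow> x = hd gs'" "\<And>x y. x \<in> set gs' \<Longrightarrow> y \<in> set ms \<Longrightarrow> x \<sim> y \<Longrightarrow> x = last gs'"
      by (rule min_path_adj[where A = "\<lambda>x. x \<sim> r" and T = "set ms" and t = "hd ms", OF F(1) abc(5,6)])
        (use ms(1,3) noR in auto)
    \<comment> \<open>Reversed so that the head is next to \<open>ms\<close> and the last vertex is
      the one seeing \<open>r\<close>.\<close>
    define gs where "gs = rev gs'"
    have gs: "gs \<noteq> []" "ipath gs" "set gs \<subseteq> F" "\<exists>m\<in>set ms. hd gs \<sim> m" "last gs \<sim> r" "set gs \<inter> set ms = {}"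
      "\<And>x. x \<in> set gs \<Longrightarrow> x \<sim> r \<Longrightarrow> x = last gs" "\<And>x y. x \<in> set gs \<Longrightarrow> y \<in> set ms \<Longrightarrow> x \<sim> y \<Longrightarrow> x = hd gs"
      using gs' unfolding gs_def by (simp_all add: ipath_rev hd_rev last_rev)
    obtain e es where ge: "gs = e # es" using gs(1) by (meson neq_Nil_conv)
    have gM: "set gs \<inter> set ms = {}" by (rule gs(6))
    have eM: "e \<notin> set ms" using gM ge by auto
    have eadj: "\<exists>m\<in>set ms. e \<sim> m" using gs(4) ge by auto
    have es_far: "x \<notin> set ms \<and> (\<forall>m\<in>set ms. \<not> x \<sim> m)" if "x \<in> set es" for x
    proof -
      have "x \<noteq> e" using gs(2) ge that by auto
      then show ?thesis using gs(8)[of x] gM ge that by auto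
    qed
    have gr: "x \<sim> r \<longleftrightarrow> x = last gs" if "x \<in> set gs" for x using gs(5,7) that by blast
    have gsV: "set gs \<subseteq> V" "set gs \<inter> C = {}" using gs(3) F by auto
    have oms: "y = p \<or> y = q" if "x \<in> set ms" "y \<in> C" "x \<sim> y" for x y
      using other[of x y] that ms(3) noR by blast
    have S: "set ms \<union> set gs \<subseteq> V - C" using msV gsV by blast
    have oall: "y = p \<or> y = q \<or> y = r" if "x \<in> set ms \<union> set gs" "y \<in> C" "x \<sim> y" for x y
      using other[of x y] that ms(3) gs(3) by blast
    show False
    proof (cases "\<exists>x\<in>set gs. x \<sim> p"; cases "\<exists>x\<in>set gs. x \<sim> q")
      assume P: "\<exists>x\<in>set gs. x \<sim> p" and Q: "\<exists>x\<in>set gs. x \<sim> q"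
      have "set gs \<subset> F" using gs(3) gM ms(1,3) by (metis Int_absorb1 psubsetI set_empty)
      then have "card (set gs) < card F" using finF by (rule psubset_card_mono[rotated])
      moreover have "(\<exists>x\<in>set gs. x \<sim> y) \<longleftrightarrow> y = p \<or> y = q \<or> y = r" if "y \<in> C" for y
      proof
        assume "\<exists>x\<in>set gs. x \<sim> y" then show "y = p \<or> y = q \<or> y = r" using other that gs(3) by blast
      next
        assume "y = p \<or> y = q \<or> y = r"
        moreover have "\<exists>x\<in>set gs. x \<sim> r" using gs(1,5) last_in_set by blast
        ultimately show "\<exists>x\<in>set gs. x \<sim> y" using P Q by blast
      qed
      ultimately show False using less.hyps[OF _ ipath_conn[OF gs(2)] gsV] by blast
    next
      assume P: "\<exists>x\<in>set gs. x \<sim> p" and Q: "\<not> (\<exists>x\<in>set gs. x \<sim> q)"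
      show False
      proof (rule attach_turn_False[OF C pqr ms(1,2)])
        show "ipath (e # es)" using gs(2) ge by simp
        show "x \<sim> q \<longleftrightarrow> x = last ms" if "x \<in> set ms" for x by (rule mq[OF that])
      qed (use S gM eadj es_far noR gr P Q oall in \<open>(unfold ge[symmetric])?; blast\<close>)+
    next
      assume P: "\<not> (\<exists>x\<in>set gs. x \<sim> p)" and Q: "\<exists>x\<in>set gs. x \<sim> q"
      \<comment> \<open>Reversing \<open>ms\<close> exchanges the roles of \<open>p\<close> and
        \<open>q\<close>.\<close>
      have d: "distinct [q, p, r]" using pqr(4) by auto
      show False
      proof (rule attach_turn_False[OF C pqr(2,1,3) d, of "rev ms"])
        show "rev ms \<noteq> []" "ipath (rev ms)" "ipath (e # es)" using ms(1,2) gs(2) ge by (simp_all add: ipath_rev)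
        show "x \<sim> p \<longleftrightarrow> x = last (rev ms)" if "x \<in> set (rev ms)" for x using mp that by (simp add: last_rev)
      qed (use S gM eadj es_far noR gr P Q oall in \<open>(unfold ge[symmetric] set_rev)?; blast\<close>)+
    next
      assume P: "\<not> (\<exists>x\<in>set gs. x \<sim> p)" and Q: "\<not> (\<exists>x\<in>set gs. x \<sim> q)"
      have ogs: "y = r" if "x \<in> set gs" "y \<in> C" "x \<sim> y" for x y
        using other[of x y] that gs(3) P Q by blast
      have M_att: "x \<sim> y \<longleftrightarrow> (x = hd ms \<and> y = p) \<or> (x = last ms \<and> y = q)" if "x \<in> set ms" "y \<in> C" for x y
        using oms[OF that] mp[OF that(1)] mq[OF that(1)] by blast
      have G_att: "x \<sim> y \<longleftrightarrow> x = last gs \<and> y = r" if "x \<in> set gs" "y \<in> C" for x y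
        using ogs[OF that] gr[OF that(1)] by blast
      have cross: "x \<noteq> y \<and> \<not> x \<sim> y" if "x \<in> set ms" "y \<in> set es" for x y
        using es_far[OF that(2)] that adj_sym by blast
      have ies: "ipath es" "e \<notin> set es" "ipath (e # es)" using gs(2) ge by auto
      have hl: "hd ms \<in> set ms" "last ms \<in> set ms" "last gs \<in> set gs" using ms(1) gs(1) by auto
      obtain b1 b2 b3 where H: "hole_at p (b1 @ q # b2 @ r # b3)" and Ceq: "C = insert p (set (b1 @ q # b2 @ r # b3))"
        using hole_three[OF C(1) pqr] by metis
      \<comment> \<open>\<open>u\<close> is the first neighbour of \<open>e\<close> on
        \<open>ms\<close>, and \<open>w\<close> below the last one if there are several. Neighbours
        in between are discarded together with the stretch of \<open>ms\<close> they lie on.\<close>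
      obtain m1 u m2 where m: "ms = m1 @ u # m2" "e \<sim> u" "\<forall>x\<in>set m1. \<not> e \<sim> x"
        using split_list_first_prop[OF eadj] by metis
      have im: "ipath (rev (m1 @ [u]))" "ipath (u # m2)" unfolding ipath_rev
        using ms(2) ipath_append[of "m1 @ [u]" m2] ipath_append[of m1 "u # m2"] unfolding m(1) by simp_all
      have l1: "last (u # rev m1) = hd ms" using m(1) by (cases m1) auto
      have l2: "last (u # m2) = last ms" using m(1) by auto
      have m1m2: "x \<noteq> y \<and> \<not> x \<sim> y" if "x \<in> set m1" "y \<in> set m2" for x y
        using ms(2) that ipath_distinct[OF ms(2)] unfolding m(1) ipath_append[of m1] by auto
      show False
      proof (cases "\<exists>w\<in>set m2. e \<sim> w")
        \<comment> \<open>The legs meet at \<open>u\<close>, the only neighbour of \<open>e\<close>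
          on \<open>ms\<close>.\<close>
        case False
        have l3: "last (u # gs) = last gs" using gs(1) by simp
        show False
        proof (rule no_spiderI[OF H, of u "rev m1" m2 gs])
          have S: "set (u # rev m1 @ m2 @ gs) = set ms \<union> set gs" using m(1) by auto
          show "insert p (set (b1 @ q # b2 @ r # b3)) \<union> set (u # rev m1 @ m2 @ gs) \<subseteq> V"
            "insert p (set (b1 @ q # b2 @ r # b3)) \<inter> set (u # rev m1 @ m2 @ gs) = {}"
            unfolding S Ceq[symmetric] using C(2) msV gsV by auto
          show "ipath (u # rev m1)" "ipath (u # m2)" using im by simp_all
          have "u \<notin> set gs" using gM m(1) by auto
          moreover have "\<forall>y\<in>set es. \<not> u \<sim> y" using cross[of u] m(1) by auto
          ultimately show "ipath (u # gs)" using gs(2) ge m(2) adj_sym by auto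
          show "x \<noteq> y \<and> \<not> x \<sim> y" if "x \<in> set (rev m1)" "y \<in> set m2" for x y using m1m2 that by simp
          show "x \<noteq> y \<and> \<not> x \<sim> y" if "x \<in> set (rev m1)" "y \<in> set gs" for x y
          proof -
            have "x \<in> set ms" "\<not> e \<sim> x" using that m by auto
            then show ?thesis using cross[of x y] that ge gM adj_sym[of x e] by auto
          qed
          show "x \<noteq> y \<and> \<not> x \<sim> y" if "x \<in> set m2" "y \<in> set gs" for x y
          proof -
            have "x \<in> set ms" "\<not> e \<sim> x" using that m False by auto
            then show ?thesis using cross[of x y] that ge gM adj_sym[of x e] by auto
          qed
          fix x y assume x: "x \<in> set (u # rev m1 @ m2 @ gs)" and y: "y \<in> insert p (set (b1 @ q # b2 @ r # b3))"
          have y: "y \<in> C" using y Ceq by simp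
          show "x \<sim> y \<longleftrightarrow> (x = last (u # rev m1) \<and> y = p) \<or> (x = last (u # m2) \<and> y = q) \<or> (x = last (u # gs) \<and> y = r)"
            unfolding l1 l2 l3 using x[unfolded S] M_att[OF _ y, of x] G_att[OF _ y, of x] hl gM by blast
        qed
      next
        case True
        obtain n w m3 where n: "m2 = n @ w # m3" "e \<sim> w" "\<forall>x\<in>set m3. \<not> e \<sim> x"
          using split_list_last_prop[OF True] by metis
        have lw: "last (w # m3) = last ms" using m(1) n(1) by auto
        have iw: "ipath (w # m3)" using im(2) ipath_append[of "u # n" "w # m3"] unfolding n(1) by simp
        have sub: "set (u # rev m1) \<subseteq> set ms" "set (w # m3) \<subseteq> set ms" using m(1) n(1) by auto
        have dms: "distinct ms" using ipath_distinct ms(2) by blast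
        have X: "x \<noteq> y \<and> (x \<sim> y \<longrightarrow> n = [] \<and> x = u \<and> y = w)" if x: "x \<in> set (u # rev m1)" and y: "y \<in> set (w # m3)" for x y
        proof -
          have i: "ipath ((m1 @ [u]) @ n @ (w # m3))" using ms(2) m(1) n(1) by simp
          have x: "x \<in> set (m1 @ [u])" using x by auto
          show ?thesis
          proof (cases n)
            case Nil
            then show ?thesis using i x y unfolding ipath_append[of "m1 @ [u]"] by auto
          next
            case (Cons z zs)
            have "y \<noteq> z" using dms y m(1) n(1) Cons by auto
            then show ?thesis using i x y unfolding ipath_append[of "m1 @ [u]"] Cons by auto
          qed
        qed
        have e1: "\<not> e \<sim> x" if "x \<in> set m1" for x using m(3) that by blast
        have XG1: "x \<noteq> y \<and> (x \<sim> y \<longrightarrow> x = u \<and> y = e)" if "x \<in> set (u # rev m1)" "y \<in> set (e # es)" for x y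
        proof -
          have "x \<in> set ms" using sub that by blast
          then show ?thesis using that cross[of x y] eM m(3) adj_sym[of x e] by auto
        qed
        have XG2: "x \<noteq> y \<and> (x \<sim> y \<longrightarrow> x = w \<and> y = e)" if "x \<in> set (w # m3)" "y \<in> set (e # es)" for x y
        proof -
          have "x \<in> set ms" using sub that by blast
          then show ?thesis using that cross[of x y] eM n(3) adj_sym[of x e] by auto
        qed
        have att': "x \<sim> y \<longleftrightarrow> (x = last (u # rev m1) \<and> y = p) \<or> (x = last (w # m3) \<and> y = q) \<or> (x = last (e # es) \<and> y = r)"
          if "x \<in> set ms \<union> set gs" "y \<in> C" for x y
          unfolding l1 lw ge[symmetric] using that(1) M_att[OF _ that(2), of x] G_att[OF _ that(2), of x] hl gM by blast
        have FF: "set ((u # rev m1) @ (w # m3) @ (e # es)) \<subseteq> set ms \<union> set gs" using sub ge by auto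
        show False
        \<comment> \<open>If \<open>w\<close> follows \<open>u\<close> directly, then
          \<open>e\<close>, \<open>u\<close>, \<open>w\<close> form a triangle with three legs;
          otherwise the legs meet at \<open>e\<close>.\<close>
        proof (cases n)
          case Nil
          show False
          proof (rule attach_triangle_False[OF C pqr _ iw ies(3) refl])
            show "ipath (u # rev m1)" using im by simp
            show "set ((u # rev m1) @ (w # m3) @ (e # es)) \<subseteq> V" "set ((u # rev m1) @ (w # m3) @ (e # es)) \<inter> C = {}"
              using FF msV gsV by blast+
            show "u \<sim> w" using im(2) n(1) Nil by simp
            show "u \<sim> e" "w \<sim> e" using m(2) n(2) adj_sym by blast+
            show "x \<noteq> y \<and> (x \<sim> y \<longrightarrow> x = u \<and> y = w)" if "x \<in> set (u # rev m1)" "y \<in> set (w # m3)" for x y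
              using X[OF that] by blast
          qed (use XG1 XG2 att' FF in blast)+
        next
          case (Cons z zs)
          have S: "set (e # (u # rev m1) @ (w # m3) @ es) = set ((u # rev m1) @ (w # m3) @ (e # es))" by auto
          show False
          proof (rule no_spiderI[OF H, of e "u # rev m1" "w # m3" es])
            show "insert p (set (b1 @ q # b2 @ r # b3)) \<union> set (e # (u # rev m1) @ (w # m3) @ es) \<subseteq> V"
              "insert p (set (b1 @ q # b2 @ r # b3)) \<inter> set (e # (u # rev m1) @ (w # m3) @ es) = {}"
              unfolding S Ceq[symmetric] using C(2) FF msV gsV by blast+
            have "e \<notin> set (u # rev m1)" "e \<notin> set (w # m3)" using sub eM by blast+
            then show "ipath (e # u # rev m1)" "ipath (e # w # m3)" using im(1) iw m(2,3) n(2,3) by auto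
            show "ipath (e # es)" by (rule ies(3))
            show "x \<noteq> y \<and> \<not> x \<sim> y" if "x \<in> set (u # rev m1)" "y \<in> set (w # m3)" for x y
              using X[OF that] Cons by blast
            show "x \<noteq> y \<and> \<not> x \<sim> y" if "x \<in> set (u # rev m1)" "y \<in> set es" for x y
              using sub cross[of x y] that by blast
            show "x \<noteq> y \<and> \<not> x \<sim> y" if "x \<in> set (w # m3)" "y \<in> set es" for x y
              using sub cross[of x y] that by blast
            fix x y assume x: "x \<in> set (e # (u # rev m1) @ (w # m3) @ es)" and y: "y \<in> insert p (set (b1 @ q # b2 @ r # b3))"
            have y: "y \<in> C" using y Ceq by simp
            have x: "x \<in> set ms \<union> set gs" using x FF S by blast
            have "last (e # u # rev m1) = last (u # rev m1)" "last (e # w # m3) = last (w # m3)" by simp_all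
            then show "x \<sim> y \<longleftrightarrow> (x = last (e # u # rev m1) \<and> y = p) \<or> (x = last (e # w # m3) \<and> y = q) \<or> (x = last (e # es) \<and> y = r)"
              using att'[OF x y] by presburger
          qed
        qed
      qed
    qed
  qed
qed

end

subsection \<open>Thetas\<close>

text \<open>The assumption is positive: deleting a clique leaves a connected set, in which
  \<open>min_path\<close> finds paths. The empty clique is included, so \<open>V\<close> itself is
  connected.\<close>

locale no_clique_cutset_rel = ISK4_wheel_free_rel +
  assumes clique_conn: "K \<subseteq> V \<Longrightarrow> (\<And>x y. x \<in> K \<Longrightarrow> y \<in> K \<Longrightarrow> x \<noteq> y \<Longrightarrow> x \<sim> y) \<Longrightarrow> conn (V - K)"
begin

text \<open>The path closed up by \<open>c\<close> is a rim on which \<open>b\<close> sees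
  \<open>c\<close>, \<open>a\<close> and \<open>y\<close>. For empty \<open>R1\<close> this rim is a
  triangle.\<close>

lemma diamond_aux:
  assumes "ipath (a # R1 @ [z])" "set (a # R1 @ [z]) \<subseteq> V" "b \<in> V" "c \<in> V" "b \<notin> set (a # R1 @ [z])" "c \<notin> set (a # R1 @ [z])"
    and "b \<sim> c" "b \<sim> a" "c \<sim> a" "c \<sim> z" "\<And>x. x \<in> set R1 \<Longrightarrow> \<not> c \<sim> x" "y \<in> set (R1 @ [z])" "b \<sim> y"
  shows False
proof -
  have H: "hole_at c (a # R1 @ [z])"
    unfolding hole_at_def using assms by auto
  have "a \<noteq> y" using assms(1,12) by auto
  moreover have "b \<noteq> c" "c \<noteq> y" "c \<noteq> a" using assms adj_neq by auto
  ultimately show False using wheelD[OF H, of b c a y] assms by auto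
qed

text \<open>Adjacent \<open>a\<close> and \<open>d\<close> would give K_4, a wheel with a triangular
  rim. Otherwise take a path from \<open>a\<close> to \<open>d\<close> avoiding \<open>b\<close> and
  \<open>c\<close>. Let \<open>y\<close> be its first vertex after \<open>a\<close> that sees one of
  \<open>b\<close>, \<open>c\<close>, and \<open>z\<close> the first from \<open>y\<close> on that
  sees the other, possibly \<open>y\<close> itself. That other vertex closes the path up to
  \<open>z\<close> into a rim, and the first one is the centre.\<close>

lemma common_nbr_unique:
  assumes "b \<sim> c" "a \<sim> b" "a \<sim> c" "d \<sim> b" "d \<sim> c"
  shows "a = d"
proof (rule ccontr)
  assume ad: "a \<noteq> d"
  have V: "a \<in> V" "b \<in> V" "c \<in> V" "d \<in> V" using adj_V assms adj_sym by blast+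
  have ne: "a \<noteq> b" "a \<noteq> c" "b \<noteq> c" "d \<noteq> b" "d \<noteq> c" using assms adj_neq by blast+
  show False
  proof (cases "a \<sim> d")
    case True
    have "hole_at a [b, c]" unfolding hole_at_def using assms ne by auto
    then show False using wheelD[of a "[b, c]" d a b c] V ne ad assms True adj_sym by auto
  next
    case False
    have "conn (V - {b, c})" by (rule clique_conn) (use V assms adj_sym in auto)
    then obtain ps where ps: "ps \<noteq> []" "ipath ps" "set ps \<subseteq> V - {b, c}" "hd ps = a" "last ps = d"
      using min_path[of "V - {b, c}" a "\<lambda>x. x = a" d "\<lambda>x. x = d"] V ne ad by auto
    obtain Q where Q: "ps = a # Q" using ps by (metis list.collapse)
    have "Q \<noteq> []" using ps(5) Q ad by auto
    note Q = Q this
    have "\<exists>x\<in>set Q. x \<sim> b \<or> x \<sim> c" using ps(5) Q assms(4) by (metis last_ConsR last_in_set)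
    from split_list_first_prop[OF this] obtain R1 y R2 where R: "Q = R1 @ y # R2" "y \<sim> b \<or> y \<sim> c" "\<forall>x\<in>set R1. \<not> (x \<sim> b \<or> x \<sim> c)"
      by metis
    have last: "last (y # R2) = d" using ps(5) Q R by simp
    \<comment> \<open>\<open>b'\<close> is the vertex seen by \<open>y\<close> and \<open>c'\<close>
      the other one; \<open>y\<close> decides which is \<open>b\<close> and which is
      \<open>c\<close>.\<close>
    have main: False if b': "y \<sim> b'" and bc: "b' \<sim> c'" "a \<sim> b'" "a \<sim> c'" "d \<sim> b'" "d \<sim> c'" "{b', c'} = {b, c}" for b' c'
    proof -
      have "\<exists>x\<in>set (y # R2). x \<sim> c'" using last bc(5) by (metis last_in_set list.distinct(1))
      from split_list_first_prop[OF this] obtain S1 z S2 where S: "y # R2 = S1 @ z # S2" "z \<sim> c'" "\<forall>x\<in>set S1. \<not> x \<sim> c'"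
        by metis
      have e: "ps = (a # (R1 @ S1) @ [z]) @ S2" using Q R S by simp
      have "y \<in> set ((R1 @ S1) @ [z])" using S(1) by (cases S1) auto
      moreover have "\<not> c' \<sim> x" if x: "x \<in> set (R1 @ S1)" for x
      proof -
        have "c' = b \<or> c' = c" using bc(6) by blast
        then show ?thesis using x S(3) R(3) adj_commute[of c' x] by auto
      qed
      moreover have "ipath (a # (R1 @ S1) @ [z])" using ps(2) unfolding e ipath_append[of "a # (R1 @ S1) @ [z]"] by blast
      moreover have "set (a # (R1 @ S1) @ [z]) \<subseteq> V - {b', c'}" using ps(3) bc(6) unfolding e by auto
      moreover have "b' \<in> V" "c' \<in> V" using V bc(6) by auto
      ultimately show False using diamond_aux[of a "R1 @ S1" z b' c' y] bc b' S(2) adj_sym by blast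
    qed
    then show False using R(2) assms main[of b c] main[of c b] adj_sym by blast
  qed
qed

text \<open>Delete \<open>v\<close>, \<open>w\<close> and their common neighbour, which form a
  clique. \<open>E0\<close> survives the deletion, so a path \<open>ds\<close> leads from it to the
  rest of \<open>C\<close>. If its end \<open>d\<close> sees one vertex \<open>x\<close> there,
  \<open>E1\<close> with \<open>ds\<close> is attached exactly to \<open>v\<close>,
  \<open>w\<close>, \<open>x\<close>. If \<open>d\<close> sees two, it sees neither \<open>v\<close>
  nor \<open>w\<close>, and a path from \<open>d\<close> to the first vertex seeing \<open>v\<close>
  or \<open>w\<close> adds exactly one of these as third attachment.\<close>

lemma attach_edge_False:
  assumes C: "hole C" "C \<subseteq> V" and vw: "v \<in> C" "w \<in> C" "v \<sim> w"
    and E0: "conn E0" "E0 \<subseteq> E1" "\<exists>x\<in>E0. x \<sim> v \<or> x \<sim> w" "\<And>x. x \<in> E0 \<Longrightarrow> \<not> (x \<sim> v \<and> x \<sim> w)"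
    and E1: "conn E1" "E1 \<subseteq> V" "E1 \<inter> C = {}" "\<exists>x\<in>E1. x \<sim> v" "\<exists>x\<in>E1. x \<sim> w"
    and only: "\<And>x y. x \<in> E1 \<Longrightarrow> y \<in> C \<Longrightarrow> x \<sim> y \<Longrightarrow> y = v \<or> y = w"
  shows False
proof -
  define K where "K = {v, w} \<union> {x. x \<sim> v \<and> x \<sim> w}"
  have KV: "K \<subseteq> V" using vw C adj_V unfolding K_def by auto
  have vw': "v \<noteq> w" "w \<sim> v" using vw adj_neq adj_sym by blast+
  have "conn (V - K)"
  proof (rule clique_conn[OF KV])
    fix x y assume "x \<in> K" "y \<in> K" "x \<noteq> y"
    then show "x \<sim> y" unfolding K_def using vw vw' common_nbr_unique[of v w x y] adj_sym by blast
  qed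
  obtain e0 where e0: "e0 \<in> E0" using E0(3) by blast
  obtain t where t: "t \<in> C" "t \<noteq> v" "t \<noteq> w"
  proof -
    obtain xs where xs: "hole_at v xs" "3 \<le> length xs" "C = insert v (set xs)" using hole_at_elim C vw by metis
    obtain x y z zs where e: "xs = x # y # z # zs" using xs(2) by (auto simp: numeral_3_eq_3 Suc_le_length_iff)
    have "distinct xs" using xs(1) ipath_distinct unfolding hole_at_def by blast
    then have "x \<noteq> y" using e by simp
    then obtain t where "t \<in> set xs - {w}" using e by (cases "x = w") auto
    moreover have "v \<notin> set xs" using xs(1) unfolding hole_at_def by blast
    ultimately show ?thesis using that[of t] xs(3) by auto
  qed
  have tK: "c \<notin> K" if "c \<in> C" "c \<noteq> v" "c \<noteq> w" for c
    using hole_not_triangle[OF C(1) that(1) vw(1,2)] that vw vw' unfolding K_def by auto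
  have E0K: "E0 \<subseteq> V - K" using E0(2,4) E1(2,3) vw unfolding K_def by auto
  let ?T = "C - {v, w}"
  obtain ds where ds: "ds \<noteq> []" "ipath ds" "set ds \<subseteq> V - K" "hd ds \<in> E0" "\<exists>y\<in>?T. last ds \<sim> y" "set ds \<inter> ?T = {}"
    "\<And>x. x \<in> set ds \<Longrightarrow> x \<in> E0 \<Longrightarrow> x = hd ds" "\<And>x y. x \<in> set ds \<Longrightarrow> y \<in> ?T \<Longrightarrow> x \<sim> y \<Longrightarrow> x = last ds"
    by (rule min_path_adj[OF \<open>conn (V - K)\<close>, of e0 "\<lambda>x. x \<in> E0" t ?T])
      (use e0 E0K E0(2) E1(3) t tK[of t] C in auto)
  define d where "d = last ds"
  have dds: "d \<in> set ds" using ds(1) unfolding d_def by simp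
  have nK: "x \<noteq> v" "x \<noteq> w" "\<not> (x \<sim> v \<and> x \<sim> w)" if "x \<in> set ds" for x
    using ds(3) that unfolding K_def by blast+
  have dsC: "set ds \<inter> C = {}" using ds(6) nK by blast
  have dsV: "set ds \<subseteq> V" using ds(3) by blast
  obtain x where x: "x \<in> C" "x \<noteq> v" "x \<noteq> w" "d \<sim> x" using ds(5) unfolding d_def by blast
  have att_ds: "y = v \<or> y = w \<or> (z = d \<and> d \<sim> y)" if "z \<in> set ds" "y \<in> C" "z \<sim> y" for y z
    using ds(8)[OF that(1)] that unfolding d_def by blast
  show False
  proof (cases "\<exists>y\<in>C - {v, w}. d \<sim> y \<and> y \<noteq> x")
    case False
    have E1C: "y = v \<or> y = w" if "z \<in> E1" "y \<in> C" "z \<sim> y" for y z using only that by blast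
    show False
    proof (rule attach_three_False[OF C vw(1,2) x(1), of "E1 \<union> set ds"])
      show "distinct [v, w, x]" using vw' x by auto
      show "conn (E1 \<union> set ds)" by (rule conn_union[OF E1(1) ipath_conn[OF ds(2)], of "hd ds" "hd ds"]) (use ds(1,4) E0(2) in auto)
      show "E1 \<union> set ds \<subseteq> V" "(E1 \<union> set ds) \<inter> C = {}" using E1 dsV dsC by auto
      show "(\<exists>z\<in>E1 \<union> set ds. z \<sim> y) \<longleftrightarrow> y = v \<or> y = w \<or> y = x" if y: "y \<in> C" for y
      proof
        assume "\<exists>z\<in>E1 \<union> set ds. z \<sim> y"
        then show "y = v \<or> y = w \<or> y = x" using E1C att_ds False y by blast
      next
        assume "y = v \<or> y = w \<or> y = x"
        then show "\<exists>z\<in>E1 \<union> set ds. z \<sim> y" using E1(4,5) x(4) dds by blast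
      qed
    qed
  next
    case True
    then obtain x' where x': "x' \<in> C" "x' \<noteq> v" "x' \<noteq> w" "d \<sim> x'" "x' \<noteq> x" by blast
    have d2: "y = x \<or> y = x'" if "y \<in> C" "d \<sim> y" for y
      using hole_wheelD[OF C, of d x x' y] dsV dds dsC x x' that by auto
    have cS: "conn (E0 \<union> set ds)" by (rule conn_union[OF E0(1) ipath_conn[OF ds(2)], of "hd ds" "hd ds"]) (use ds(1,4) in auto)
    obtain e where e: "e \<in> E0" "e \<sim> v \<or> e \<sim> w" using E0(3) by blast
    obtain qs where qs: "qs \<noteq> []" "ipath qs" "set qs \<subseteq> E0 \<union> set ds" "hd qs = d" "last qs \<sim> v \<or> last qs \<sim> w"
      "\<And>x. x \<in> set qs \<Longrightarrow> x = d \<Longrightarrow> x = hd qs" "\<And>x. x \<in> set qs \<Longrightarrow> x \<sim> v \<or> x \<sim> w \<Longrightarrow> x = last qs"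
      by (rule min_path[OF cS, of d "\<lambda>x. x = d" e "\<lambda>x. x \<sim> v \<or> x \<sim> w"]) (use e dds in auto)
    \<comment> \<open>Vertices of \<open>E0\<close> do not see both by assumption, those of
      \<open>ds\<close> because the common neighbours were deleted.\<close>
    have nb: "\<not> (z \<sim> v \<and> z \<sim> w)" if "z \<in> set qs" for z using that qs(3) E0(4) nK(3) by blast
    define r where "r = (if last qs \<sim> v then v else w)"
    have r: "r = v \<or> r = w" "last qs \<sim> r" using qs(5) unfolding r_def by auto
    have rv: "y = r" if "z \<in> set qs" "z \<sim> y" "y = v \<or> y = w" for y z
      using nb[OF that(1)] qs(7)[OF that(1)] that(2,3) unfolding r_def by auto
    have rC: "r \<in> C" using r(1) vw by blast
    show False
    proof (rule attach_three_False[OF C x(1) x'(1) rC _ ipath_conn[OF qs(2)]])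
      show "distinct [x, x', r]" using x x' r(1) by auto
      show "set qs \<subseteq> V" "set qs \<inter> C = {}" using qs(3) E0(2) E1(2,3) dsV dsC by blast+
      show "(\<exists>z\<in>set qs. z \<sim> y) \<longleftrightarrow> y = x \<or> y = x' \<or> y = r" if y: "y \<in> C" for y
      proof
        assume "\<exists>z\<in>set qs. z \<sim> y"
        then obtain z where z: "z \<in> set qs" "z \<sim> y" by blast
        show "y = x \<or> y = x' \<or> y = r"
        proof (cases "y = v \<or> y = w")
          case True then show ?thesis using rv z by blast
        next
          case False
          then have "z \<in> set ds" using only[of z y] qs(3) z y E0(2) by blast
          then show ?thesis using att_ds[of z y] z y False d2 by blast
        qed
      next
        assume "y = x \<or> y = x' \<or> y = r"
        moreover have "d \<in> set qs" "last qs \<in> set qs" using qs(1,4) hd_in_set by auto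
        ultimately show "\<exists>z\<in>set qs. z \<sim> y" using x(4) x'(4) r(2) by blast
      qed
    qed
  qed
qed

section \<open>From a claw to a theta\<close>

definition anti :: "'a list \<Rightarrow> 'a list \<Rightarrow> bool" where
  "anti xs ys \<longleftrightarrow> (\<forall>x\<in>set xs. \<forall>y\<in>set ys. x \<noteq> y \<and> \<not> x \<sim> y)"

definition theta :: "'a \<Rightarrow> 'a \<Rightarrow> 'a list \<Rightarrow> 'a list \<Rightarrow> 'a list \<Rightarrow> bool" where
  "theta v w q1 q2 q3 \<longleftrightarrow> v \<noteq> w \<and> \<not> v \<sim> w \<and> ipath (v # q1 @ [w]) \<and> ipath (v # q2 @ [w]) \<and> ipath (v # q3 @ [w])
    \<and> anti q1 q2 \<and> anti q1 q3 \<and> anti q2 q3 \<and> {v, w} \<union> set q1 \<union> set q2 \<union> set q3 \<subseteq> V"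

text \<open>Minimise over all pairs of non-adjacent neighbours of \<open>v\<close>, not just
  \<open>n1\<close> and \<open>n2\<close>. An inner vertex \<open>x\<close> adjacent to
  \<open>v\<close> would then be adjacent to both ends of the path, giving the edge
  \<open>v x\<close> two common neighbours.\<close>

lemma claw_hole:
  assumes "v \<sim> n1" "v \<sim> n2" "n1 \<noteq> n2" "\<not> n1 \<sim> n2"
  obtains ms where "hole_at v ms" "set ms \<subseteq> V" "3 \<le> length ms"
proof -
  have vV: "v \<in> V" using adj_V assms by blast
  have cv: "conn (V - {v})" by (rule clique_conn) (use vV in auto)
  define P where "P ms \<longleftrightarrow> ms \<noteq> [] \<and> ipath ms \<and> set ms \<subseteq> V - {v} \<and> v \<sim> hd ms \<and> v \<sim> last ms \<and> hd ms \<noteq> last ms \<and> \<not> hd ms \<sim> last ms" for ms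
  have nV: "n1 \<in> V - {v}" "n2 \<in> V - {v}" using assms adj_V adj_sym adj_neq by blast+
  obtain xs where "xs \<noteq> []" "ipath xs" "set xs \<subseteq> V - {v}" "hd xs = n1" "last xs = n2"
    by (rule min_path[OF cv nV(1) _ nV(2), of "\<lambda>x. x = n1" "\<lambda>x. x = n2"]) auto
  then have "P xs" using assms unfolding P_def by auto
  then obtain ms where ms: "P ms" and min: "\<And>ys. P ys \<Longrightarrow> length ms \<le> length ys"
    using ex_has_least_nat[of P _ length] by metis
  obtain a ns b where e: "ms = a # ns @ [b]"
    using ms unfolding P_def by (metis append_butlast_last_id last_ConsL list.exhaust_sel list.sel(1))
  have ine: "ns \<noteq> []" using ms e unfolding P_def by auto
  have ab: "v \<sim> a" "v \<sim> b" "a \<noteq> b" "\<not> a \<sim> b" and ip: "ipath (a # ns @ [b])" and sV: "set ms \<subseteq> V - {v}"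
    using ms e unfolding P_def by auto
  have nv: "\<not> v \<sim> x" if x: "x \<in> set ns" for x
  proof
    assume vx: "v \<sim> x"
    obtain i1 i2 where i: "ns = i1 @ x # i2" using x by (meson split_list)
    have ab': "a \<noteq> x" "x \<noteq> b" using ipath_distinct[OF ip] x by auto
    have i': "ipath (a # i1 @ [x])" "ipath (x # i2 @ [b])"
      using ip ipath_append[of "a # i1 @ [x]" "i2 @ [b]"] ipath_append[of "a # i1" "x # i2 @ [b]"] i by simp_all
    have ax: "a \<sim> x"
    proof (rule ccontr)
      assume "\<not> a \<sim> x"
      then have "P (a # i1 @ [x])" unfolding P_def using i' ab ab' vx sV e i by auto
      from min[OF this] show False using e i by simp
    qed
    have xb: "x \<sim> b"
    proof (rule ccontr)
      assume "\<not> x \<sim> b"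
      then have "P (x # i2 @ [b])" unfolding P_def using i' ab ab' vx sV e i by auto
      from min[OF this] show False using e i by simp
    qed
    show False using common_nbr_unique[of v x a b] vx ab ax xb adj_sym by blast
  qed
  have "hole_at v ms" unfolding hole_at_def e
  proof (intro conjI ballI)
    show "v \<notin> set (a # ns @ [b])" using sV e by auto
    fix y assume "y \<in> set (a # ns @ [b])"
    then show "v \<sim> y \<longleftrightarrow> y = hd (a # ns @ [b]) \<or> y = last (a # ns @ [b])" using ab nv[of y] by auto
  qed (use ip in auto)
  moreover have "3 \<le> length ms" using e ine by (cases ns) auto
  ultimately show ?thesis using that sV by blast
qed

text \<open>Each of the two neighbours of \<open>v\<close> on the hole equals or sees at most one
  leaf of the claw, as the edge from \<open>v\<close> to it has at most one common neighbour. So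
  some leaf avoids both. A shortest path from such neighbours of \<open>v\<close> to the rest of the
  hole ends in a vertex \<open>d\<close> with one neighbour \<open>m\<close> there: with two there
  would be three attachments, counting \<open>v\<close>. If \<open>m\<close> is adjacent to
  \<open>v\<close>, \<open>attach_edge_False\<close> applies; otherwise \<open>v\<close> and
  \<open>m\<close> are the ends of a theta.\<close>

lemma claw_theta:
  assumes claw: "v \<sim> n1" "v \<sim> n2" "v \<sim> n3" "distinct [n1, n2, n3]" "\<not> n1 \<sim> n2" "\<not> n1 \<sim> n3" "\<not> n2 \<sim> n3"
  shows "\<exists>w q1 q2 q3. theta v w q1 q2 q3"
proof -
  obtain ms where H: "hole_at v ms" and msV: "set ms \<subseteq> V" and len: "3 \<le> length ms"
    using claw_hole[OF claw(1,2) _ claw(5)] claw(4) by auto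
  have vV: "v \<in> V" using adj_V claw by blast
  let ?C = "insert v (set ms)"
  have C: "hole ?C" "?C \<subseteq> V" using hole_at_hole[OF H len] msV vV by auto
  have ims: "ipath ms" "v \<notin> set ms" and vadj: "\<And>y. y \<in> set ms \<Longrightarrow> v \<sim> y \<longleftrightarrow> y = hd ms \<or> y = last ms"
    using H unfolding hole_at_def by blast+
  have ne: "ms \<noteq> []" using len by auto
  have hl: "hd ms \<in> set ms" "last ms \<in> set ms" "v \<sim> hd ms" "v \<sim> last ms" "hd ms \<noteq> last ms"
  proof -
    show "hd ms \<in> set ms" "last ms \<in> set ms" using ne by auto
    then show "v \<sim> hd ms" "v \<sim> last ms" using vadj by blast+
    show "hd ms \<noteq> last ms" using ipath_distinct[OF ims(1)] len by (cases ms) auto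
  qed
  define A where "A x \<longleftrightarrow> v \<sim> x \<and> x \<noteq> hd ms \<and> x \<noteq> last ms \<and> \<not> x \<sim> hd ms \<and> \<not> x \<sim> last ms" for x
  have one: "x = y" if "x \<in> {n1, n2, n3}" "y \<in> {n1, n2, n3}" "x = m \<or> x \<sim> m" "y = m \<or> y \<sim> m" "v \<sim> m" for x y m
  proof (rule ccontr)
    assume xy: "x \<noteq> y"
    have nxy: "\<not> x \<sim> y" "v \<sim> x" "v \<sim> y" using claw that(1,2) xy adj_sym by auto
    then have "x \<sim> m" "y \<sim> m" using that(3,4) xy adj_sym by blast+
    then show False using common_nbr_unique[of v m x y] xy nxy that(5) adj_sym by blast
  qed
  have "\<exists>u\<in>{n1, n2, n3}. A u"
  proof (rule ccontr)
    assume nA: "\<not> (\<exists>u\<in>{n1, n2, n3}. A u)"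
    define H where "H u m \<longleftrightarrow> u = m \<or> u \<sim> m" for u m
    have cover: "H u (hd ms) \<or> H u (last ms)" if "u \<in> {n1, n2, n3}" for u
      using nA that claw(1-3) unfolding A_def H_def by auto
    have no: "\<not> (H n1 m \<and> H n2 m)" "\<not> (H n1 m \<and> H n3 m)" "\<not> (H n2 m \<and> H n3 m)" if "v \<sim> m" for m
      using one[of n1 n2 m] one[of n1 n3 m] one[of n2 n3 m] that claw(4) unfolding H_def by auto
    show False using cover[of n1] cover[of n2] cover[of n3] no[OF hl(3)] no[OF hl(4)] by blast
  qed
  then obtain u where u: "A u" by blast
  have cv: "conn (V - {v})" by (rule clique_conn) (use vV in auto)
  have "u \<in> V - {v}" using u adj_V adj_sym adj_neq unfolding A_def by blast
  moreover have "hd ms \<in> V - {v}" using hl ims msV by auto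
  moreover have "\<not> A x" if "x \<in> set ms" for x using vadj[OF that] unfolding A_def by blast
  ultimately obtain es where es: "es \<noteq> []" "ipath es" "set es \<subseteq> V - {v}" "A (hd es)" "\<exists>m\<in>set ms. last es \<sim> m" "set es \<inter> set ms = {}"
    "\<And>x. x \<in> set es \<Longrightarrow> A x \<Longrightarrow> x = hd es" "\<And>x y. x \<in> set es \<Longrightarrow> y \<in> set ms \<Longrightarrow> x \<sim> y \<Longrightarrow> x = last es"
    using min_path_adj[where A = A and T = "set ms" and t = "hd ms", OF cv _ u] hl(1) by blast
  define d where "d = last es"
  have d: "d \<in> set es" using es(1) unfolding d_def by simp
  have vA: "v \<sim> hd es" using es(4) unfolding A_def by blast
  have esM: "set es \<inter> set ms = {}" by (rule es(6))
  have esC: "set es \<inter> ?C = {}" "set es \<subseteq> V" using esM es(3) by auto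
  have attM: "x = d" if "x \<in> set es" "y \<in> set ms" "x \<sim> y" for x y using es(8)[OF that] unfolding d_def .
  obtain m where m: "m \<in> set ms" "d \<sim> m" using es(5) unfolding d_def by blast
  \<comment> \<open>A neighbour of \<open>v\<close> on the path either satisfies \<open>A\<close>
    and is the head, or sees a neighbour of \<open>v\<close> on the hole and is
    \<open>d\<close>.\<close>
  have hvd: "v \<sim> x \<Longrightarrow> x = hd es \<or> (x = d \<and> (x \<sim> hd ms \<or> x \<sim> last ms))" if "x \<in> set es" for x
  proof -
    assume "v \<sim> x"
    have "x \<noteq> hd ms" "x \<noteq> last ms" using esM hl that by auto
    then have "A x \<or> x \<sim> hd ms \<or> x \<sim> last ms" using \<open>v \<sim> x\<close> unfolding A_def by blast
    then show "x = hd es \<or> (x = d \<and> (x \<sim> hd ms \<or> x \<sim> last ms))" using es(7)[OF that] attM[OF that] hl by blast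
  qed
  show ?thesis
  proof (cases "\<exists>m'\<in>set ms. d \<sim> m' \<and> m' \<noteq> m")
    case True
    then obtain m' where m': "m' \<in> set ms" "d \<sim> m'" "m' \<noteq> m" by blast
    have only: "y = m \<or> y = m'" if "y \<in> ?C" "d \<sim> y" for y
      using hole_wheelD[OF C, of d m m' y] m m' that d esC by auto
    have False
    proof (rule attach_three_False[OF C, of v m m' "set es"])
      show "distinct [v, m, m']" using m m' ims by auto
      show "conn (set es)" by (rule ipath_conn[OF es(2)])
      show "(\<exists>x\<in>set es. x \<sim> y) \<longleftrightarrow> y = v \<or> y = m \<or> y = m'" if y: "y \<in> ?C" for y
      proof
        assume "\<exists>x\<in>set es. x \<sim> y"
        then show "y = v \<or> y = m \<or> y = m'" using attM only y by blast
      next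
        assume "y = v \<or> y = m \<or> y = m'"
        moreover have "hd es \<in> set es" using es(1) by simp
        ultimately show "\<exists>x\<in>set es. x \<sim> y" using m m' d vA adj_sym by blast
      qed
    qed (use m m' esC in auto)
    then show ?thesis ..
  next
    case False
    then have only: "y = m" if "y \<in> set ms" "d \<sim> y" for y using that by blast
    show ?thesis
    proof (cases "m = hd ms \<or> m = last ms")
      case True
      then have vm: "v \<sim> m" using hl by blast
      have "hd es \<noteq> d"
        using es(4) True m unfolding A_def by auto
      \<comment> \<open>\<open>d\<close> is the only vertex of the path that may see both
        \<open>v\<close> and \<open>m\<close>, so it is left out of the set used as
        \<open>E0\<close>.\<close>
      define es' where "es' = butlast es"
      have es'1: "es = es' @ [d]" using es(1) unfolding es'_def d_def by simp
      have "es' \<noteq> []"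
      proof
        assume "es' = []"
        then show False using es'1 \<open>hd es \<noteq> d\<close> by simp
      qed
      note es' = es'1 this
      have hd': "hd es \<in> set es'" using es' by (metis hd_append2 hd_in_set)
      have att1: "y = v \<or> y = m" if "x \<in> set es" "y \<in> ?C" "x \<sim> y" for x y
        using attM[of x y] only[of y] that by blast
      have nm: "\<not> x \<sim> m" if "x \<in> set es'" for x
      proof -
        have "x \<noteq> d" "x \<in> set es" using that ipath_distinct[OF es(2)] es' by auto
        then show ?thesis using attM[of x m] m by blast
      qed
      have False
      proof (rule attach_edge_False[OF C _ _ vm, of "set es'" "set es"])
        show "conn (set es')" using es(2) unfolding es'(1) ipath_append by (intro ipath_conn) blast
        show "conn (set es)" by (rule ipath_conn[OF es(2)])
        show "\<exists>x\<in>set es'. x \<sim> v \<or> x \<sim> m" using hd' vA adj_sym by blast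
        have "hd es \<in> set es" using es(1) by simp
        then show "\<exists>x\<in>set es. x \<sim> v" using vA adj_sym by blast
        show "\<exists>x\<in>set es. x \<sim> m" using d m by blast
      qed (use m nm esC es' att1 in auto)
      then show ?thesis ..
    next
      case False
      obtain p1 p2 where p: "ms = p1 @ m # p2" using m by (meson split_list)
      have pne: "p1 \<noteq> []" "p2 \<noteq> []" using False p by auto
      have nvm: "\<not> v \<sim> m" "v \<noteq> m" using vadj[OF m(1)] False m ims by auto
      have dms: "distinct ms" using ipath_distinct ims by blast
      have va: "v \<sim> x \<longleftrightarrow> x = hd p1" if "x \<in> set p1" for x
        using vadj[of x] that p pne dms by auto
      have vb: "v \<sim> x \<longleftrightarrow> x = last p2" if "x \<in> set p2" for x
      proof -
        have "set p1 \<inter> set p2 = {}" using dms p by simp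
        then have "hd p1 \<notin> set p2" using hd_in_set[OF pne(1)] by blast
        then show ?thesis using vadj[of x] that p pne by auto
      qed
      have vd: "v \<sim> x \<longleftrightarrow> x = hd es" if "x \<in> set es" for x
        using hvd[OF that] only[of "hd ms"] only[of "last ms"] hl False vA by blast
      have i1: "ipath (p1 @ [m])" "ipath (m # p2)" using ims(1) ipath_append[of "p1 @ [m]" p2] ipath_append[of p1 "m # p2"] p by simp_all
      have i2: "ipath (rev p2 @ [m])" using i1(2) ipath_rev[of "m # p2"] by simp
      have i3: "ipath (es @ [m])" unfolding ipath_append
        using es(1,2) m d_def attM[OF _ m(1)] esM by auto
      have leg: "ipath (v # q @ [m])" if "ipath (q @ [m])" "q \<noteq> []" "\<And>x. x \<in> set q \<Longrightarrow> v \<sim> x \<longleftrightarrow> x = hd q" "v \<notin> set q" for q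
        using that nvm ipath_distinct[OF that(1)] by (cases q) auto
      have "theta v m p1 (rev p2) es"
        unfolding theta_def
      proof (intro conjI nvm)
        show "ipath (v # p1 @ [m])" by (rule leg[OF i1(1) pne(1) va]) (use ims p in auto)
        show "ipath (v # rev p2 @ [m])" by (rule leg[OF i2]) (use ims p vb pne in \<open>auto simp: hd_rev\<close>)
        show "ipath (v # es @ [m])" by (rule leg[OF i3 es(1) vd]) (use es(3) in auto)
        show "anti p1 (rev p2)" using ims(1) dms unfolding p ipath_append[of p1] anti_def by auto
        have mm: "m \<notin> set p1" "m \<notin> set p2" using dms p by auto
        have "x \<noteq> y \<and> \<not> x \<sim> y" if "x \<in> set p1 \<union> set p2" "y \<in> set es" for x y
        proof -
          have xm: "x \<in> set ms" using that p by auto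
          moreover have "\<not> x \<sim> y" using attM[OF that(2) xm] only[OF xm] that mm adj_sym[of x y] by blast
          ultimately show ?thesis using esM that(2) by blast
        qed
        then show "anti p1 es" "anti (rev p2) es" unfolding anti_def by auto
        show "{v, m} \<union> set p1 \<union> set (rev p2) \<union> set es \<subseteq> V" using C(2) p esC by auto
      qed
      then show ?thesis by blast
    qed
  qed
qed

end

section \<open>Legs of a theta and the holes they form\<close>

context sym_rel begin

lemma ipath_legD:
  assumes "ipath (v # q @ [w])" "v \<noteq> w" "\<not> v \<sim> w"
  shows "q \<noteq> []" "ipath q" "v \<notin> set q" "w \<notin> set q" "ipath (v # q)" "ipath (q @ [w])"
    "\<And>x. x \<in> set q \<Longrightarrow> v \<sim> x \<longleftrightarrow> x = hd q" "\<And>x. x \<in> set q \<Longrightarrow> w \<sim> x \<longleftrightarrow> x = last q"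
proof -
  show q: "q \<noteq> []" using assms by auto
  show i: "ipath (q @ [w])" using assms by simp
  then show iq: "ipath q" "w \<notin> set q" unfolding ipath_append by auto
  show "v \<notin> set q" using assms(1) by auto
  have "ipath ((v # q) @ [w])" using assms(1) by simp
  then show "ipath (v # q)" unfolding ipath_append by blast
  show "v \<sim> x \<longleftrightarrow> x = hd q" if "x \<in> set q" for x using assms(1) q that ipath_distinct[OF iq(1)] by (cases q) auto
  show "w \<sim> x \<longleftrightarrow> x = last q" if "x \<in> set q" for x using i q that unfolding ipath_append adj_commute[of w x] by auto
qed

lemma ipath_legI:
  assumes "v \<noteq> w" "\<not> v \<sim> w" "ipath q" "q \<noteq> []" "v \<notin> set q" "w \<notin> set q"
    "\<And>x. x \<in> set q \<Longrightarrow> v \<sim> x \<longleftrightarrow> x = hd q" "\<And>x. x \<in> set q \<Longrightarrow> w \<sim> x \<longleftrightarrow> x = last q"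
  shows "ipath (v # q @ [w])"
proof -
  have "x \<sim> w \<longleftrightarrow> x = last q" if "x \<in> set q" for x using assms(8)[OF that] adj_commute[of x w] by simp
  then have i: "ipath (q @ [w])" unfolding ipath_append using assms(3,4,6) by auto
  obtain x xs where "q = x # xs" using assms(4) by (meson neq_Nil_conv)
  then show ?thesis using assms i ipath_distinct[OF assms(3)] by auto
qed

end

context no_clique_cutset_rel begin

lemma anti_sym: "anti xs ys \<Longrightarrow> anti ys xs"
  unfolding anti_def using adj_sym by blast

lemma theta_perm: "theta v w q1 q2 q3 \<Longrightarrow> theta v w q2 q1 q3" "theta v w q1 q2 q3 \<Longrightarrow> theta v w q1 q3 q2"
  unfolding theta_def using anti_sym by auto

lemma theta_rev: "theta v w q1 q2 q3 \<Longrightarrow> theta w v (rev q1) (rev q2) (rev q3)"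
proof -
  have "ipath (w # rev q @ [v])" if "ipath (v # q @ [w])" for q
    using that ipath_rev[of "v # q @ [w]"] by simp
  moreover have "anti (rev a) (rev b) = anti a b" for a b by (simp add: anti_def)
  ultimately show "theta v w q1 q2 q3 \<Longrightarrow> theta w v (rev q1) (rev q2) (rev q3)"
    unfolding theta_def using adj_commute[of v w] by (auto simp del: ipath.simps)
qed

text \<open>Facts about a single leg are stated for \<open>q1\<close> only; those for the other legs
  are obtained from the permuted thetas.\<close>

lemma theta_legD:
  assumes "theta v w q1 q2 q3"
  shows "q1 \<noteq> []" "ipath q1" "v \<notin> set q1" "w \<notin> set q1" "ipath (v # q1)" "ipath (q1 @ [w])"
    "\<And>x. x \<in> set q1 \<Longrightarrow> v \<sim> x \<longleftrightarrow> x = hd q1" "\<And>x. x \<in> set q1 \<Longrightarrow> w \<sim> x \<longleftrightarrow> x = last q1" "v \<noteq> w" "\<not> v \<sim> w"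
    "{v, w} \<union> set q1 \<union> set q2 \<union> set q3 \<subseteq> V"
    "\<And>x y. x \<in> set q1 \<Longrightarrow> y \<in> set q2 \<Longrightarrow> x \<noteq> y \<and> \<not> x \<sim> y"
    "\<And>x y. x \<in> set q1 \<Longrightarrow> y \<in> set q3 \<Longrightarrow> x \<noteq> y \<and> \<not> x \<sim> y"
    "\<And>x y. x \<in> set q2 \<Longrightarrow> y \<in> set q3 \<Longrightarrow> x \<noteq> y \<and> \<not> x \<sim> y"
proof -
  have t: "v \<noteq> w" "\<not> v \<sim> w" "ipath (v # q1 @ [w])" "anti q1 q2" "anti q1 q3" "anti q2 q3" "{v, w} \<union> set q1 \<union> set q2 \<union> set q3 \<subseteq> V"
    using assms unfolding theta_def by auto
  note l = ipath_legD[OF t(3,1,2)]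
  show "q1 \<noteq> []" "ipath q1" "v \<notin> set q1" "w \<notin> set q1" "ipath (v # q1)" "ipath (q1 @ [w])" "v \<noteq> w" "\<not> v \<sim> w"
    "{v, w} \<union> set q1 \<union> set q2 \<union> set q3 \<subseteq> V"
    by (rule l(1) l(2) l(3) l(4) l(5) l(6) t(1) t(2) t(7))+
  show "v \<sim> x \<longleftrightarrow> x = hd q1" "w \<sim> x \<longleftrightarrow> x = last q1" if "x \<in> set q1" for x
    using l(7,8)[OF that] by auto
  show "x \<noteq> y \<and> \<not> x \<sim> y" if "x \<in> set q1" "y \<in> set q2" for x y using t(4) that unfolding anti_def by blast
  show "x \<noteq> y \<and> \<not> x \<sim> y" if "x \<in> set q1" "y \<in> set q3" for x y using t(5) that unfolding anti_def by blast
  show "x \<noteq> y \<and> \<not> x \<sim> y" if "x \<in> set q2" "y \<in> set q3" for x y using t(6) that unfolding anti_def by blast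
qed

lemma theta_hole:
  assumes "theta v w q1 q2 q3"
  shows "hole ({v, w} \<union> set q1 \<union> set q2)" "{v, w} \<union> set q1 \<union> set q2 \<subseteq> V"
proof -
  note t1 = theta_legD[OF assms] and t2 = theta_legD[OF theta_perm(1)[OF assms]]
  have i2: "ipath (w # rev q2)" using t2(6) ipath_rev[of "q2 @ [w]"] by simp
  have H: "hole_at v (q1 @ w # rev q2)"
    unfolding hole_at_def
  proof (intro conjI ballI)
    show "ipath (q1 @ w # rev q2)" unfolding ipath_append[of q1]
      using t1 t2 i2 adj_commute[of _ w] by auto
    show "v \<notin> set (q1 @ w # rev q2)" using t1 t2 by auto
    show "2 \<le> length (q1 @ w # rev q2)" using t1(1) by (cases q1) auto
    fix y assume y: "y \<in> set (q1 @ w # rev q2)"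
    have "hd (q1 @ w # rev q2) = hd q1" "last (q1 @ w # rev q2) = hd q2" using t1(1) t2(1) by (auto simp: last_rev)
    moreover have "hd q1 \<in> set q1" "hd q2 \<in> set q2" using t1(1) t2(1) by auto
    ultimately show "v \<sim> y \<longleftrightarrow> y = hd (q1 @ w # rev q2) \<or> y = last (q1 @ w # rev q2)"
      using y t1(4,7,10,12) t2(4,7) by auto
  qed
  have "3 \<le> length (q1 @ w # rev q2)" using t1(1) t2(1) by (cases q1; cases q2) auto
  moreover have "insert v (set (q1 @ w # rev q2)) = {v, w} \<union> set q1 \<union> set q2" by auto
  ultimately show "hole ({v, w} \<union> set q1 \<union> set q2)" using hole_at_hole[OF H] by simp
  show "{v, w} \<union> set q1 \<union> set q2 \<subseteq> V" using t1(11) by auto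
qed

section \<open>Attachments to a theta\<close>

text \<open>The hole runs from \<open>d\<close> through \<open>x1\<close> to \<open>w\<close> and
  back through \<open>x2\<close>. The vertex \<open>v\<close>, the part of \<open>q2\<close> before
  \<open>x2\<close> and \<open>q3\<close> form a connected set attached exactly to
  \<open>x2\<close>, \<open>w\<close> and \<open>d\<close>; it misses \<open>x1\<close> because
  \<open>x1\<close> is not the neighbour of \<open>v\<close> on its leg.\<close>

lemma theta_vertex_aux:
  assumes th: "theta v w q1 q2 q3" and d: "d \<in> V" "d \<notin> {v, w} \<union> set q1 \<union> set q2 \<union> set q3"
    and x: "x1 \<in> set q1" "x2 \<in> set q2" "x3 \<in> set q3"
    and adj: "\<And>y. y \<in> {v, w} \<union> set q1 \<union> set q2 \<union> set q3 \<Longrightarrow> d \<sim> y \<longleftrightarrow> y = x1 \<or> y = x2 \<or> y = x3"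
    and x1: "x1 \<noteq> hd q1"
  shows False
proof -
  note t1 = theta_legD[OF th] and t2 = theta_legD[OF theta_perm(1)[OF th]]
    and t3 = theta_legD[OF theta_perm(1)[OF theta_perm(2)[OF th]]]
  obtain a b where ab: "q1 = a @ x1 # b" using x by (meson split_list)
  obtain c e where ce: "q2 = c @ x2 # e" using x by (meson split_list)
  have ane: "a \<noteq> []" using x1 ab by auto
  have d1: "distinct q1" "distinct q2" using ipath_distinct t1(2) t2(2) by auto
  have i1: "ipath (x1 # b)" "ipath (x2 # e)" "ipath (v # c)"
    using t1(2) t2(2) ipath_append[of a "x1 # b"] ipath_append[of c "x2 # e"] ab ce t2(5) ipath_append[of "v # c" "x2 # e"] by simp_all
  have l1: "last (x1 # b) = last q1" "last (x2 # e) = last q2" using ab ce by auto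
  have sub: "set (x1 # b) \<subseteq> set q1" "set (x2 # e) \<subseteq> set q2" using ab ce by auto
  let ?zs = "(x1 # b) @ [w] @ rev (x2 # e)"
  have dadj: "d \<sim> y \<longleftrightarrow> y = x1 \<or> y = x2" if "y \<in> set ?zs" for y
    using adj[of y] that sub t1(13) t2(13) x(3) t3(4) by auto
  have H: "hole_at d ?zs" unfolding hole_at_def
  proof (intro conjI ballI)
    have "ipath (x2 # e @ [w])" using t2(6) ipath_append[of c "x2 # e @ [w]"] ce by simp
    then have i: "ipath ([w] @ rev (x2 # e))" using ipath_rev[of "x2 # e @ [w]"] by simp
    show "ipath ?zs" unfolding ipath_append[of "x1 # b"]
    proof (intro conjI impI ballI)
      show "last (x1 # b) \<sim> hd ([w] @ rev (x2 # e))" using l1 t1(1) t1(8)[of "last q1"] adj_sym by auto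
      fix x y assume x': "x \<in> set (x1 # b)" and y: "y \<in> set ([w] @ rev (x2 # e))"
      have "y = w \<or> y \<in> set q2" using y sub by auto
      then have "x \<noteq> y \<and> (x \<sim> y \<longrightarrow> y = w \<and> x = last q1)" using x' sub t1(4,8,12) adj_commute[of x w] by blast
      then show "x \<noteq> y" "x \<sim> y \<Longrightarrow> x = last (x1 # b)" "x \<sim> y \<Longrightarrow> y = hd ([w] @ rev (x2 # e))" using l1 by auto
    qed (use i i1 in auto)
    show "d \<notin> set ?zs" using d sub by auto
    fix y assume "y \<in> set ?zs"
    then show "d \<sim> y \<longleftrightarrow> y = hd ?zs \<or> y = last ?zs" using dadj by auto
  qed auto
  let ?Z = "insert d (set ?zs)"
  have ZV: "?Z \<subseteq> V" using d sub t1(11) by auto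
  have "3 \<le> length ?zs" by auto
  then have hZ: "hole ?Z" using hole_at_hole[OF H] by blast
  let ?F = "set (v # c) \<union> set (v # q3)"
  have cq2: "set c \<subseteq> set q2" using ce by auto
  show False
  proof (rule attach_three_False[OF hZ ZV, of x2 w d ?F])
    show "distinct [x2, w, d]" using d t2(4) x by auto
    show "conn ?F" by (rule conn_union[OF ipath_conn[OF i1(3)] ipath_conn[OF t3(5)], of v v]) auto
    show "?F \<subseteq> V" using cq2 t1(11) by auto
    have "v \<notin> set q1" "v \<notin> set q2" "v \<notin> set q3" "v \<noteq> w" by (rule t1(3) t2(3) t3(3) t1(9))+
    moreover have "set c \<inter> set (x2 # e) = {}" using d1 ce by auto
    moreover have "set q3 \<inter> set q1 = {}" "set q3 \<inter> set q2 = {}" "set q1 \<inter> set q2 = {}"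
      using t1(12,13,14) by blast+
    moreover have "w \<notin> set q3" "w \<notin> set q2" by (rule t3(4) t2(4))+
    moreover have "d \<notin> ?F" using d cq2 by auto
    ultimately show "?F \<inter> ?Z = {}" using sub cq2 by auto
    have hv: "hd q1 \<notin> set (x1 # b)" using ane ab d1 by (cases a) auto
    have va: "v \<sim> y \<Longrightarrow> y = x2 \<or> y = d" if "y \<in> ?Z" for y
    proof -
      assume "v \<sim> y"
      have "y \<notin> set (x1 # b)" using \<open>v \<sim> y\<close> t1(7)[of y] sub hv by blast
      moreover have "y = x2" if "y \<in> set (x2 # e)"
      proof -
        have "y = hd q2" using \<open>v \<sim> y\<close> t2(7)[of y] sub that by blast
        then show ?thesis using that ce d1 by (cases c) auto
      qed
      ultimately show ?thesis using \<open>y \<in> ?Z\<close> \<open>v \<sim> y\<close> t1(10) by auto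
    qed
    have nvd: "\<not> v \<sim> d" using adj[of v] t1(3) t2(3) t3(3) x adj_commute[of v d] by auto
    have ca: "y = x2" if "z \<in> set c" "y \<in> ?Z" "z \<sim> y" for y z
    proof -
      have zq: "z \<in> set q2" using that cq2 by auto
      have ndz: "\<not> z \<sim> d"
      proof -
        have "z \<noteq> x2" using that d1 ce by auto
        then show ?thesis using adj[of z] zq t1(12)[OF x(1)] t1(14)[OF _ x(3)] x adj_commute[of z d] by blast
      qed
      have "y \<notin> set (x1 # b)" using that(3) t1(12)[of y z] zq sub adj_sym by blast
      moreover have "y \<noteq> w"
      proof
        assume "y = w"
        then have "z = last q2" using that zq t2(8) adj_sym by blast
        then show False using that(1) ce d1 by (auto split: if_splits)
      qed
      moreover have "y = x2" if "y \<in> set (x2 # e)"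
        using \<open>z \<sim> y\<close> t2(2) \<open>z \<in> set c\<close> that unfolding ce ipath_append[of c] by auto
      ultimately show ?thesis using that ndz by auto
    qed
    have q3a: "(y = w \<and> z = last q3) \<or> (y = d \<and> z = x3)" if "z \<in> set q3" "y \<in> ?Z" "z \<sim> y" for y z
    proof -
      have "y \<notin> set (x1 # b)" "y \<notin> set (x2 # e)" using that(1,3) t1(13)[of y z] t1(14)[of y z] sub adj_sym by blast+
      then have "y = w \<or> y = d" using that(2) by auto
      moreover have "z = last q3" if "y = w" using t3(8)[OF \<open>z \<in> set q3\<close>] \<open>z \<sim> y\<close> that adj_sym by blast
      moreover have "z = x3" if "y = d" using adj[of z] \<open>z \<in> set q3\<close> \<open>z \<sim> y\<close> that t1(13)[OF x(1)] t1(14)[OF x(2)] adj_commute[of z d] by blast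
      ultimately show ?thesis by blast
    qed
    show "(\<exists>z\<in>?F. z \<sim> y) \<longleftrightarrow> y = x2 \<or> y = w \<or> y = d" if y: "y \<in> ?Z" for y
    proof
      assume "\<exists>z\<in>?F. z \<sim> y"
      then obtain z where z: "z = v \<or> z \<in> set c \<or> z \<in> set q3" "z \<sim> y" by auto
      then show "y = x2 \<or> y = w \<or> y = d" using va[OF y] ca[OF _ y] q3a[OF _ y] by blast
    next
      assume "y = x2 \<or> y = w \<or> y = d"
      moreover have "\<exists>z\<in>?F. z \<sim> x2"
      proof (cases "c = []")
        case True
        then show ?thesis using t2(7)[of x2] x ce by auto
      next
        case False
        then have "last c \<sim> x2" using t2(2) unfolding ce ipath_append[of c] by auto
        then show ?thesis using False last_in_set by auto
      qed
      moreover have "last q3 \<sim> w" "last q3 \<in> set q3" using t3(1) t3(8)[of "last q3"] adj_sym by auto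
      moreover have "x3 \<sim> d" using adj[of x3] x adj_sym by auto
      ultimately show "\<exists>z\<in>?F. z \<sim> y" using x(3) by auto
    qed
  qed auto
qed

text \<open>Two holes, each made of two legs, cover the theta and allow \<open>d\<close> at most two
  neighbours each, so \<open>d\<close> sees only \<open>x1\<close>, \<open>x2\<close>,
  \<open>x3\<close>. Then \<open>theta_vertex_aux\<close> makes each of them the first vertex of its
  leg and, on the reversed theta, also the last.\<close>

lemma theta_vertex:
  assumes th: "theta v w q1 q2 q3" and d: "d \<in> V" "d \<notin> {v, w} \<union> set q1 \<union> set q2 \<union> set q3"
    and x: "x1 \<in> set q1" "x2 \<in> set q2" "x3 \<in> set q3" "d \<sim> x1" "d \<sim> x2" "d \<sim> x3"
  shows "q1 = [x1] \<and> q2 = [x2] \<and> q3 = [x3]"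
proof -
  note t1 = theta_legD[OF th]
  note h12 = theta_hole[OF th] and h13 = theta_hole[OF theta_perm(2)[OF th]]
  have dd: "x1 \<noteq> x2" "x1 \<noteq> x3" "x2 \<noteq> x3" using t1(12)[OF x(1,2)] t1(13)[OF x(1,3)] t1(14)[OF x(2,3)] by auto
  have adj: "d \<sim> y \<longleftrightarrow> y = x1 \<or> y = x2 \<or> y = x3" if y: "y \<in> {v, w} \<union> set q1 \<union> set q2 \<union> set q3" for y
  proof
    assume dy: "d \<sim> y"
    have "y \<in> {v, w} \<union> set q1 \<union> set q2 \<or> y \<in> {v, w} \<union> set q1 \<union> set q3" using y by auto
    then show "y = x1 \<or> y = x2 \<or> y = x3"
      using hole_wheelD[OF h12 d(1), of x1 x2 y] hole_wheelD[OF h13 d(1), of x1 x3 y] d(2) x dd dy by auto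
  qed (use x in auto)
  have single: "qa = [xa]" if t: "theta v w qa qb qc" and "set qa \<union> set qb \<union> set qc = set q1 \<union> set q2 \<union> set q3"
    "xa \<in> set qa" "xb \<in> set qb" "xc \<in> set qc" "{xa, xb, xc} = {x1, x2, x3}" for qa qb qc xa xb xc
  proof -
    have U: "{v, w} \<union> set qa \<union> set qb \<union> set qc = {v, w} \<union> set q1 \<union> set q2 \<union> set q3" using that(2) by blast
    have E: "(y = xa \<or> y = xb \<or> y = xc) = (y \<in> {x1, x2, x3})" for y unfolding that(6)[symmetric] by blast
    have adj': "d \<sim> y \<longleftrightarrow> y = xa \<or> y = xb \<or> y = xc" if "y \<in> {v, w} \<union> set qa \<union> set qb \<union> set qc" for y
    proof -
      have "y \<in> {v, w} \<union> set q1 \<union> set q2 \<union> set q3" using that U by blast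
      from adj[OF this] show ?thesis using E[of y] by simp
    qed
    have "xa = hd qa" using theta_vertex_aux[OF t d(1) _ that(3-5) adj'] d(2) U by blast
    moreover have "xa = hd (rev qa)"
    proof (rule ccontr)
      assume h: "xa \<noteq> hd (rev qa)"
      show False
        by (rule theta_vertex_aux[OF theta_rev[OF t] d(1), of xa xb xc])
          (use that(3-5) adj' d(2) U h in \<open>simp_all add: insert_commute\<close>)
    qed
    ultimately have "hd qa = last qa" by (simp add: hd_rev)
    moreover have "distinct qa" "qa \<noteq> []" using ipath_distinct theta_legD(1,2)[OF t] by auto
    ultimately have "qa = [hd qa]" by (cases qa) (auto split: if_splits)
    then show ?thesis using \<open>xa = hd qa\<close> by simp
  qed
  have "q1 = [x1]" by (rule single[OF th _ x(1,2,3)]) auto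
  moreover have "q2 = [x2]" by (rule single[OF theta_perm(1)[OF th] _ x(2,1,3)]) auto
  moreover have "q3 = [x3]" by (rule single[OF theta_perm(1)[OF theta_perm(2)[OF th]] _ x(3,1,2)]) auto
  ultimately show ?thesis by blast
qed

text \<open>With a single neighbour \<open>x\<close> of \<open>d\<close> on \<open>q1\<close>, the
  set \<open>S\<close> with \<open>q2\<close> would be attached to the hole of \<open>q1\<close> and
  \<open>q3\<close> exactly at \<open>v\<close>, \<open>w\<close> and \<open>x\<close>. With two
  neighbours on \<open>q1\<close>, a third one on this hole would give a wheel; hence
  \<open>d\<close> sees neither \<open>v\<close> nor \<open>w\<close>.\<close>

lemma theta_leg_two:
  assumes th: "theta v w q1 q2 q3" and S: "conn S" "S \<subseteq> V" "S \<inter> ({v, w} \<union> set q1 \<union> set q2 \<union> set q3) = {}"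
    and d: "d \<in> S" "\<exists>x\<in>set q1. d \<sim> x" "\<And>z x. z \<in> S \<Longrightarrow> x \<in> set q1 \<Longrightarrow> z \<sim> x \<Longrightarrow> z = d"
    and q2: "\<exists>z\<in>S. \<exists>x\<in>set q2. z \<sim> x" and q3: "\<And>z x. z \<in> S \<Longrightarrow> x \<in> set q3 \<Longrightarrow> \<not> z \<sim> x"
  shows "\<exists>a x b y c. q1 = a @ x # b @ y # c \<and> d \<sim> x \<and> d \<sim> y \<and> (\<forall>z\<in>{v, w} \<union> set q1. d \<sim> z \<longrightarrow> z = x \<or> z = y)"
proof -
  note t1 = theta_legD[OF th] and t2 = theta_legD[OF theta_perm(1)[OF th]]
    and t3 = theta_legD[OF theta_perm(1)[OF theta_perm(2)[OF th]]]
  note h13 = theta_hole[OF theta_perm(2)[OF th]]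
  obtain x where x: "x \<in> set q1" "d \<sim> x" using d(2) by blast
  have dV: "d \<in> V" "d \<notin> {v, w} \<union> set q1 \<union> set q3" using d(1) S by auto
  have "\<exists>y\<in>set q1. d \<sim> y \<and> y \<noteq> x"
  proof (rule ccontr)
    assume no: "\<not> ?thesis"
    obtain z0 x0 where z0: "z0 \<in> S" "x0 \<in> set q2" "z0 \<sim> x0" using q2 by blast
    show False
    proof (rule attach_three_False[OF h13, of v w x "S \<union> set q2"])
      show "distinct [v, w, x]" using t1 x by auto
      show "conn (S \<union> set q2)" by (rule conn_union[OF S(1) ipath_conn[OF t2(2)], of z0 x0]) (use z0 in auto)
      show "S \<union> set q2 \<subseteq> V" using S(2) t1(11) by auto
      have "set q2 \<inter> ({v, w} \<union> set q1 \<union> set q3) = {}" using t1(12,14) t2(3,4) by blast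
      then show "(S \<union> set q2) \<inter> ({v, w} \<union> set q1 \<union> set q3) = {}" using S(3) by blast
      show "(\<exists>z\<in>S \<union> set q2. z \<sim> y) \<longleftrightarrow> y = v \<or> y = w \<or> y = x" if y: "y \<in> {v, w} \<union> set q1 \<union> set q3" for y
      proof
        assume "\<exists>z\<in>S \<union> set q2. z \<sim> y"
        then obtain z where z: "z \<in> S \<or> z \<in> set q2" "z \<sim> y" by blast
        show "y = v \<or> y = w \<or> y = x"
        proof (cases "z \<in> S")
          case True
          then show ?thesis using d(3)[OF True, of y] q3[OF True, of y] no y z(2) by blast
        next
          case False
          then show ?thesis using z y t1(12)[of y z] t1(14)[of z y] adj_sym by blast
        qed
      next
        assume "y = v \<or> y = w \<or> y = x"
        moreover have "hd q2 \<in> set q2" "hd q2 \<sim> v" "last q2 \<in> set q2" "last q2 \<sim> w"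
          using t2(1,7,8) adj_sym by auto
        ultimately show "\<exists>z\<in>S \<union> set q2. z \<sim> y" using x d(1) by blast
      qed
    qed (use x in auto)
  qed
  then obtain y where y: "y \<in> set q1" "d \<sim> y" "y \<noteq> x" by blast
  have only: "z = x \<or> z = y" if "z \<in> {v, w} \<union> set q1" "d \<sim> z" for z
    using hole_wheelD[OF h13 dV, of x y z] x y that by auto
  obtain a b where ab: "q1 = a @ x # b" using x by (meson split_list)
  then have "y \<in> set a \<or> y \<in> set b" using y by auto
  then show ?thesis
  proof
    assume "y \<in> set a"
    then obtain k l where "a = k @ y # l" by (meson split_list)
    then have "q1 = k @ y # l @ x # b" using ab by simp
    then show ?thesis using x y only by blast
  next
    assume "y \<in> set b"
    then obtain k l where "b = k @ y # l" by (meson split_list)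
    then have "q1 = a @ x # k @ y # l" using ab by simp
    then show ?thesis using x y only by blast
  qed
qed

text \<open>By \<open>theta_leg_two\<close>, \<open>hd ds\<close> sees two vertices
  \<open>x1\<close>, \<open>y1\<close> of \<open>q1\<close> and \<open>last ds\<close> sees
  \<open>x2\<close>, \<open>y2\<close> on \<open>q2\<close>. Consider the hole through
  \<open>w\<close>, the legs beyond \<open>y1\<close> and \<open>y2\<close>, and \<open>ds\<close>.
  The start of \<open>q1\<close> up to \<open>x1\<close> is attached at \<open>hd ds\<close>, and at
  \<open>y1\<close> if \<open>x1\<close> and \<open>y1\<close> are consecutive; likewise for
  \<open>q2\<close>; \<open>q3\<close> is attached at \<open>w\<close>, and \<open>v\<close> only
  inside \<open>ds\<close>. In each case some union of these pieces, joined at \<open>v\<close>, has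
  exactly three attachments.\<close>

lemma theta_path_aux:
  assumes th: "theta v w q1 q2 q3"
    and ds: "ipath ds" "ds \<noteq> []" "set ds \<subseteq> V" "set ds \<inter> ({v, w} \<union> set q1 \<union> set q2 \<union> set q3) = {}"
    and a1: "\<exists>x\<in>set q1. hd ds \<sim> x" "\<And>z x. z \<in> set ds \<Longrightarrow> x \<in> set q1 \<Longrightarrow> z \<sim> x \<Longrightarrow> z = hd ds"
    and a2: "\<exists>x\<in>set q2. last ds \<sim> x" "\<And>z x. z \<in> set ds \<Longrightarrow> x \<in> set q2 \<Longrightarrow> z \<sim> x \<Longrightarrow> z = last ds"
    and a3: "\<And>z x. z \<in> set ds \<Longrightarrow> x \<in> set q3 \<Longrightarrow> \<not> z \<sim> x"
    and nw: "\<And>z. z \<in> set ds \<Longrightarrow> \<not> z \<sim> w"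
  shows False
proof -
  note t1 = theta_legD[OF th] and t2 = theta_legD[OF theta_perm(1)[OF th]]
    and t3 = theta_legD[OF theta_perm(1)[OF theta_perm(2)[OF th]]]
  have hl: "hd ds \<in> set ds" "last ds \<in> set ds" using ds(2) by auto
  have cds: "conn (set ds)" by (rule ipath_conn[OF ds(1)])
  have ds4: "set ds \<inter> ({v, w} \<union> set q2 \<union> set q1 \<union> set q3) = {}" using ds(4) by auto
  have q1e: "\<exists>z\<in>set ds. \<exists>x\<in>set q1. z \<sim> x" and q2e: "\<exists>z\<in>set ds. \<exists>x\<in>set q2. z \<sim> x" using a1(1) a2(1) hl by blast+
  have "\<exists>a x b y c. q1 = a @ x # b @ y # c \<and> hd ds \<sim> x \<and> hd ds \<sim> y \<and> (\<forall>z\<in>{v, w} \<union> set q1. hd ds \<sim> z \<longrightarrow> z = x \<or> z = y)"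
    by (rule theta_leg_two[OF th cds ds(3,4) hl(1) a1(1) _ q2e]) (use a1(2) a3 in blast)+
  then obtain p1 x1 b1 y1 c1 where e1: "q1 = p1 @ x1 # b1 @ y1 # c1" "hd ds \<sim> x1" "hd ds \<sim> y1"
    and o1: "\<forall>z\<in>{v, w} \<union> set q1. hd ds \<sim> z \<longrightarrow> z = x1 \<or> z = y1"
    by blast
  have "\<exists>a x b y c. q2 = a @ x # b @ y # c \<and> last ds \<sim> x \<and> last ds \<sim> y \<and> (\<forall>z\<in>{v, w} \<union> set q2. last ds \<sim> z \<longrightarrow> z = x \<or> z = y)"
    by (rule theta_leg_two[OF theta_perm(1)[OF th] cds ds(3) ds4 hl(2) a2(1) _ q1e]) (use a2(2) a3 in blast)+
  then obtain p2 x2 b2 y2 c2 where e2: "q2 = p2 @ x2 # b2 @ y2 # c2" "last ds \<sim> x2" "last ds \<sim> y2"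
    and o2: "\<forall>z\<in>{v, w} \<union> set q2. last ds \<sim> z \<longrightarrow> z = x2 \<or> z = y2"
    by blast
  have dq: "distinct q1" "distinct q2" using ipath_distinct t1(2) t2(2) by auto
  have in1: "x1 \<in> set q1" "y1 \<in> set q1" "x1 \<noteq> y1" and in2: "x2 \<in> set q2" "y2 \<in> set q2" "x2 \<noteq> y2"
    using e1 e2 dq by auto
  have vx: "v \<noteq> x1" "v \<noteq> y1" "v \<noteq> x2" "v \<noteq> y2" using t1(3) t2(3) in1 in2 by auto
  have nv: "\<not> v \<sim> hd ds" "\<not> v \<sim> last ds" using o1 o2 vx adj_sym by blast+
  have h12: "hole ({v, w} \<union> set q1 \<union> set q2)" "{v, w} \<union> set q1 \<union> set q2 \<subseteq> V" by (rule theta_hole[OF th])+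
  \<comment> \<open>A common end would have three neighbours on the hole of \<open>q1\<close> and
    \<open>q2\<close>.\<close>
  have dne: "hd ds \<noteq> last ds"
  proof
    assume "hd ds = last ds"
    moreover have "hd ds \<in> V" "hd ds \<notin> {v, w} \<union> set q1 \<union> set q2" using ds(3,4) hl by auto
    moreover have "x1 \<noteq> x2" "y1 \<noteq> x2" using t1(12) in1 in2 by blast+
    ultimately show False using hole_wheelD[OF h12, of "hd ds" x1 y1 x2] in1 in2 e1 e2 by auto
  qed
  let ?A = "y1 # c1" and ?B = "y2 # c2"
  let ?zs = "rev ?A @ ds @ ?B"
  have sub: "set ?A \<subseteq> set q1" "set ?B \<subseteq> set q2" using e1 e2 by auto
  have iA: "ipath ?A" "ipath ?B" using t1(2) t2(2) ipath_append[of "p1 @ x1 # b1" ?A] ipath_append[of "p2 @ x2 # b2" ?B] e1 e2 by simp_all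
  have lA: "last ?A = last q1" "last ?B = last q2" using e1 e2 by auto
  have x1A: "x1 \<notin> set ?A" "x2 \<notin> set ?B" using dq e1 e2 by auto
  have dsA: "z \<sim> y \<longleftrightarrow> z = hd ds \<and> y = y1" if "z \<in> set ds" "y \<in> set ?A" for z y
    using a1(2)[OF that(1), of y] o1 e1 that sub x1A by blast
  have dsB: "z \<sim> y \<longleftrightarrow> z = last ds \<and> y = y2" if "z \<in> set ds" "y \<in> set ?B" for z y
    using a2(2)[OF that(1), of y] o2 e2 that sub x1A by blast
  have disj: "z \<notin> set q1" "z \<notin> set q2" "z \<notin> set q3" "z \<noteq> v" "z \<noteq> w" if "z \<in> set ds" for z using ds(4) that by auto
  have izs: "ipath ?zs"
  proof -
    have i: "ipath (ds @ ?B)" unfolding ipath_append[of ds]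
    proof (intro conjI ds(1) iA impI ballI)
      show "last ds \<sim> hd ?B" using e2 by simp
      fix x y assume x: "x \<in> set ds" and y: "y \<in> set ?B"
      show "x \<noteq> y" using disj[OF x] y sub by blast
      assume "x \<sim> y" then show "x = last ds" "y = hd ?B" using dsB[OF x y] by auto
    qed
    show ?thesis unfolding ipath_append[of "rev ?A"]
    proof (intro conjI i impI ballI)
      show "ipath (rev ?A)" unfolding ipath_rev by (rule iA)
      have "hd (ds @ ?B) = hd ds" using ds(2) by simp
      then show "last (rev ?A) \<sim> hd (ds @ ?B)" using e1 adj_sym by simp
      fix x y assume x: "x \<in> set (rev ?A)" and y: "y \<in> set (ds @ ?B)"
      have x: "x \<in> set ?A" using x by simp
      have "x \<noteq> y \<and> (x \<sim> y \<longrightarrow> x = y1 \<and> y = hd ds)"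
      proof (cases "y \<in> set ds")
        case True
        then show ?thesis using dsA[OF True x] disj[OF True] x sub adj_commute[of x y] by blast
      next
        case False
        then have "y \<in> set ?B" using y by auto
        then show ?thesis using t1(12)[of x y] x sub by blast
      qed
      then show "x \<noteq> y" "x \<sim> y \<Longrightarrow> x = last (rev ?A)" "x \<sim> y \<Longrightarrow> y = hd (ds @ ?B)" using ds(2) by auto
    qed
  qed
  have "hd (rev xs @ ys) = last xs" if "xs \<noteq> []" for xs ys :: "'a list" using that by (simp add: hd_rev)
  from this[of ?A] have hz: "hd ?zs = last q1" "last ?zs = last q2"
    unfolding lA[symmetric] by simp_all
  have lq: "last q1 \<in> set q1" "last q2 \<in> set q2" "last q3 \<in> set q3" "last q3 \<sim> w"
    using t1(1) t2(1) t3(1) t3(8)[of "last q3"] adj_sym by auto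
  have H: "hole_at w ?zs" unfolding hole_at_def
  proof (intro conjI ballI izs)
    show "w \<notin> set ?zs" using t1(4) t2(4) sub disj(5)[of w] by auto
    fix y assume y: "y \<in> set ?zs"
    then consider "y \<in> set ?A" | "y \<in> set ds" | "y \<in> set ?B" by auto
    then show "w \<sim> y \<longleftrightarrow> y = hd ?zs \<or> y = last ?zs"
    proof cases
      case 1
      then have yq: "y \<in> set q1" using sub by blast
      then have "y \<noteq> last q2" using t1(12)[OF yq lq(2)] by blast
      then show ?thesis unfolding hz using t1(8)[OF yq] by blast
    next
      case 2
      then have "y \<noteq> last q1" "y \<noteq> last q2" using disj[OF 2] lq by auto
      then show ?thesis unfolding hz using nw[OF 2] adj_sym by blast
    next
      case 3
      then have yq: "y \<in> set q2" using sub by blast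
      then have "y \<noteq> last q1" using t1(12)[OF lq(1) yq] by blast
      then show ?thesis unfolding hz using t2(8)[OF yq] by blast
    qed
  qed simp
  let ?Z = "insert w (set ?zs)"
  have Zcases: "z = w \<or> z \<in> set ds \<or> z \<in> set ?A \<or> z \<in> set ?B" if "z \<in> ?Z" for z using that by auto
  have "3 \<le> length ?zs" using ds(2) by (cases ds) auto
  then have hZ: "hole ?Z" by (rule hole_at_hole[OF H])
  have ZV: "?Z \<subseteq> V" using sub ds(3) t1(11) by auto
  have Zin: "w \<in> ?Z" "hd ds \<in> ?Z" "last ds \<in> ?Z" "y1 \<in> ?Z" "y2 \<in> ?Z" "\<And>z. z \<in> set ds \<Longrightarrow> z \<in> ?Z" using hl by auto
  have att_v: "v \<sim> z \<longleftrightarrow> z \<in> set ds \<and> v \<sim> z" if "z \<in> ?Z" for z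
  proof -
    have "\<not> v \<sim> z" if "z \<in> set ?A"
    proof -
      have "hd q1 \<notin> set ?A" using e1 dq by (cases p1) auto
      then show ?thesis using t1(7)[of z] that sub by blast
    qed
    moreover have "\<not> v \<sim> z" if "z \<in> set ?B"
    proof -
      have "hd q2 \<notin> set ?B" using e2 dq by (cases p2) auto
      then show ?thesis using t2(7)[of z] that sub by blast
    qed
    ultimately show ?thesis using Zcases[OF that] t1(10) by blast
  qed
  let ?P1 = "set (p1 @ [x1])" and ?P2 = "set (p2 @ [x2])"
  have subP: "?P1 \<subseteq> set q1" "?P2 \<subseteq> set q2" "?P1 \<inter> set ?A = {}" "?P2 \<inter> set ?B = {}" using e1 e2 dq by auto
  have att_P1: "(\<exists>f\<in>?P1. f \<sim> z) \<longleftrightarrow> z = hd ds \<or> (b1 = [] \<and> z = y1)" if z: "z \<in> ?Z" for z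
  proof
    assume "\<exists>f\<in>?P1. f \<sim> z"
    then obtain f where f: "f \<in> ?P1" "f \<sim> z" by blast
    have fq: "f \<in> set q1" using f subP by blast
    from Zcases[OF z] consider "z = w" | "z \<in> set ds" | "z \<in> set ?A" | "z \<in> set ?B" by blast
    then show "z = hd ds \<or> (b1 = [] \<and> z = y1)"
    proof cases
      case 1
      then have "f = last q1" using t1(8)[OF fq] f(2) adj_sym by blast
      then have "f \<in> set ?A" using lA last_in_set[of ?A] by auto
      then show ?thesis using f subP by blast
    next
      case 2
      then show ?thesis using a1(2)[OF 2 fq] f(2) adj_sym by blast
    next
      case 3
      have i: "ipath ((p1 @ [x1]) @ b1 @ ?A)" using t1(2) e1 by simp
      then have "z = hd (b1 @ ?A)" using 3 f unfolding ipath_append[of "p1 @ [x1]"] by auto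
      moreover have "set b1 \<inter> set ?A = {}" using dq e1 by auto
      ultimately have "b1 = []" using 3 by (cases b1) auto
      then show ?thesis using \<open>z = hd (b1 @ ?A)\<close> by simp
    next
      case 4
      then show ?thesis using t1(12)[OF fq, of z] sub f by blast
    qed
  next
    assume "z = hd ds \<or> (b1 = [] \<and> z = y1)"
    moreover have "x1 \<sim> hd ds" using e1 adj_sym by blast
    moreover have "x1 \<sim> y1" if "b1 = []"
      using t1(2) ipath_append[of p1 "x1 # y1 # c1"] e1 that by simp
    ultimately show "\<exists>f\<in>?P1. f \<sim> z" by auto
  qed
  have att_P2: "(\<exists>f\<in>?P2. f \<sim> z) \<longleftrightarrow> z = last ds \<or> (b2 = [] \<and> z = y2)" if z: "z \<in> ?Z" for z
  proof
    assume "\<exists>f\<in>?P2. f \<sim> z"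
    then obtain f where f: "f \<in> ?P2" "f \<sim> z" by blast
    have fq: "f \<in> set q2" using f subP by blast
    from Zcases[OF z] consider "z = w" | "z \<in> set ds" | "z \<in> set ?A" | "z \<in> set ?B" by blast
    then show "z = last ds \<or> (b2 = [] \<and> z = y2)"
    proof cases
      case 1
      then have "f = last q2" using t2(8)[OF fq] f(2) adj_sym by blast
      then have "f \<in> set ?B" using lA last_in_set[of ?B] by auto
      then show ?thesis using f subP by blast
    next
      case 2
      then show ?thesis using a2(2)[OF 2 fq] f(2) adj_sym by blast
    next
      case 4
      have i: "ipath ((p2 @ [x2]) @ b2 @ ?B)" using t2(2) e2 by simp
      then have "z = hd (b2 @ ?B)" using 4 f unfolding ipath_append[of "p2 @ [x2]"] by auto
      moreover have "set b2 \<inter> set ?B = {}" using dq e2 by auto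
      ultimately have "b2 = []" using 4 by (cases b2) auto
      then show ?thesis using \<open>z = hd (b2 @ ?B)\<close> by simp
    next
      case 3
      then show ?thesis using t1(12)[OF _ fq, of z] sub f adj_sym by blast
    qed
  next
    assume "z = last ds \<or> (b2 = [] \<and> z = y2)"
    moreover have "x2 \<sim> last ds" using e2 adj_sym by blast
    moreover have "x2 \<sim> y2" if "b2 = []"
      using t2(2) ipath_append[of p2 "x2 # y2 # c2"] e2 that by simp
    ultimately show "\<exists>f\<in>?P2. f \<sim> z" by auto
  qed
  have att_Q: "(\<exists>f\<in>set q3. f \<sim> z) \<longleftrightarrow> z = w" if z: "z \<in> ?Z" for z
  proof
    assume "\<exists>f\<in>set q3. f \<sim> z"
    then obtain f where f: "f \<in> set q3" "f \<sim> z" by blast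
    have "z \<notin> set ds" using a3[of z f] f adj_sym by blast
    moreover have "z \<notin> set q1" "z \<notin> set q2" using t1(13)[of z f] t1(14)[of z f] f adj_sym by blast+
    ultimately show "z = w" using Zcases[OF z] sub by blast
  qed (use lq in blast)
  have cv: "conn {v}" "conn (insert v ?P1)" "conn (insert v ?P2)" "conn (insert v (set q3))"
  proof -
    have "ipath (v # p1 @ [x1])" "ipath (v # p2 @ [x2])"
      using t1(5) t2(5) ipath_append[of "v # p1 @ [x1]" "b1 @ ?A"] ipath_append[of "v # p2 @ [x2]" "b2 @ ?B"] e1 e2 by simp_all
    from this[THEN ipath_conn] show "conn (insert v ?P1)" "conn (insert v ?P2)" by simp_all
    show "conn (insert v (set q3))" using ipath_conn[OF t3(5)] by simp
  qed simp
  have off: "v \<in> V - ?Z" "?P1 \<subseteq> V - ?Z" "?P2 \<subseteq> V - ?Z" "set q3 \<subseteq> V - ?Z"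
  proof -
    show "v \<in> V - ?Z" using Zcases[of v] t1(3,9,11) t2(3) sub disj(4)[of v] by blast
    have o: "q \<subseteq> V - ?Z" if "q \<subseteq> V" "w \<notin> q" "q \<inter> set ds = {}" "q \<inter> set ?A = {}" "q \<inter> set ?B = {}" for q
      using that by auto
    have "?P1 \<inter> set ?B = {}" "?P2 \<inter> set ?A = {}" using t1(12) sub subP by blast+
    moreover have "?P1 \<subseteq> V" "?P2 \<subseteq> V" using subP t1(11) by blast+
    moreover have "w \<notin> ?P1" "w \<notin> ?P2" using t1(4) t2(4) subP by blast+
    moreover have "?P1 \<inter> set ds = {}" "?P2 \<inter> set ds = {}" using disj subP by blast+
    ultimately show "?P1 \<subseteq> V - ?Z" "?P2 \<subseteq> V - ?Z" using o[of ?P1] o[of ?P2] subP(3,4) by blast+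
    have "set q3 \<inter> set ?A = {}" "set q3 \<inter> set ?B = {}" using t1(13,14) sub by blast+
    moreover have "set q3 \<subseteq> V" "set q3 \<inter> set ds = {}" using t1(11) disj by blast+
    ultimately show "set q3 \<subseteq> V - ?Z" using o t3(4) by blast
  qed
  have three: False if "conn F" "F \<subseteq> V - ?Z" "p \<in> ?Z" "q \<in> ?Z" "r \<in> ?Z" "p \<noteq> q" "p \<noteq> r" "q \<noteq> r"
    "\<And>z. z \<in> ?Z \<Longrightarrow> (\<exists>f\<in>F. f \<sim> z) \<longleftrightarrow> z = p \<or> z = q \<or> z = r" for F p q r
    by (rule attach_three_False[OF hZ ZV that(3-5) _ that(1) _ _ that(9)]) (use that(2,6-8) in auto)
  have un: "conn (insert v S \<union> insert v T)" if "conn (insert v S)" "conn (insert v T)" for S T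
    by (rule conn_union[OF that, of v v]) auto
  have ne: "w \<noteq> hd ds" "w \<noteq> last ds" "w \<noteq> y1" "w \<noteq> y2" "hd ds \<noteq> y1" "last ds \<noteq> y2"
    using disj[OF hl(1)] disj[OF hl(2)] t1(4) t2(4) in1 in2 by auto
  show False
  \<comment> \<open>The pieces are chosen according to whether \<open>v\<close> has no, several or
    one neighbour on \<open>ds\<close>.\<close>
  proof (cases "\<exists>n\<in>set ds. v \<sim> n")
    case False
    have nov: "\<not> v \<sim> z" if "z \<in> ?Z" for z using att_v[OF that] False by blast
    show False
    proof (cases "b1 = []")
      case True
      show False
      proof (rule three[of "insert v ?P1 \<union> insert v (set q3)" "hd ds" y1 w])
        fix z assume z: "z \<in> ?Z"
        have "(\<exists>f\<in>insert v ?P1 \<union> insert v (set q3). f \<sim> z) \<longleftrightarrow> v \<sim> z \<or> (\<exists>f\<in>?P1. f \<sim> z) \<or> (\<exists>f\<in>set q3. f \<sim> z)" by blast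
        then show "(\<exists>f\<in>insert v ?P1 \<union> insert v (set q3). f \<sim> z) \<longleftrightarrow> z = hd ds \<or> z = y1 \<or> z = w"
          unfolding att_P1[OF z] att_Q[OF z] using nov[OF z] True by blast
      qed (use un[OF cv(2,4)] off Zin ne in blast)+
    next
      case b1: False
      show False
      proof (cases "b2 = []")
        case True
        show False
        proof (rule three[of "insert v ?P2 \<union> insert v (set q3)" "last ds" y2 w])
          fix z assume z: "z \<in> ?Z"
          have "(\<exists>f\<in>insert v ?P2 \<union> insert v (set q3). f \<sim> z) \<longleftrightarrow> v \<sim> z \<or> (\<exists>f\<in>?P2. f \<sim> z) \<or> (\<exists>f\<in>set q3. f \<sim> z)" by blast
          then show "(\<exists>f\<in>insert v ?P2 \<union> insert v (set q3). f \<sim> z) \<longleftrightarrow> z = last ds \<or> z = y2 \<or> z = w"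
            unfolding att_P2[OF z] att_Q[OF z] using nov[OF z] True by blast
        qed (use un[OF cv(3,4)] off Zin ne in blast)+
      next
        case b2: False
        \<comment> \<open>With no consecutive pair on either leg, the two starts contribute only
          \<open>hd ds\<close> and \<open>last ds\<close>, and \<open>q3\<close> contributes
          \<open>w\<close>.\<close>
        have c3: "conn (insert v (?P1 \<union> ?P2) \<union> insert v (set q3))"
        proof (rule un[OF _ cv(4)])
          have "insert v ?P1 \<union> insert v ?P2 = insert v (?P1 \<union> ?P2)" by blast
          then show "conn (insert v (?P1 \<union> ?P2))" using un[OF cv(2,3)] by metis
        qed
        show False
        proof (rule three[OF c3, of "hd ds" "last ds" w])
          fix z assume z: "z \<in> ?Z"
          have "(\<exists>f\<in>insert v (?P1 \<union> ?P2) \<union> insert v (set q3). f \<sim> z) \<longleftrightarrow> v \<sim> z \<or> (\<exists>f\<in>?P1. f \<sim> z) \<or> (\<exists>f\<in>?P2. f \<sim> z) \<or> (\<exists>f\<in>set q3. f \<sim> z)" by blast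
          then show "(\<exists>f\<in>insert v (?P1 \<union> ?P2) \<union> insert v (set q3). f \<sim> z) \<longleftrightarrow> z = hd ds \<or> z = last ds \<or> z = w"
            unfolding att_P1[OF z] att_P2[OF z] att_Q[OF z] using nov[OF z] b1 b2 by blast
        qed (use off Zin ne dne in blast)+
      qed
    qed
  next
    case True
    then obtain n where n: "n \<in> set ds" "v \<sim> n" by blast
    have nn: "n \<noteq> hd ds" "n \<noteq> y1" "n \<noteq> w" using n nv disj[OF n(1)] in1 by auto
    show False
    proof (cases "\<exists>n'\<in>set ds. v \<sim> n' \<and> n' \<noteq> n")
      case True
      then obtain n' where n': "n' \<in> set ds" "v \<sim> n'" "n' \<noteq> n" by blast
      have "n' \<noteq> w" using disj[OF n'(1)] by auto
      \<comment> \<open>A third neighbour would give a wheel, so \<open>v\<close> and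
        \<open>q3\<close> together are attached at \<open>n\<close>, \<open>n'\<close> and
        \<open>w\<close>.\<close>
      have only: "z = n \<or> z = n'" if "z \<in> ?Z" "v \<sim> z" for z
        using hole_wheelD[OF hZ ZV _ _ _ _ n(2) n'(2) that(2)] off(1) Zin(6)[OF n(1)] Zin(6)[OF n'(1)] n'(3) that(1) by auto
      show False
      proof (rule three[OF cv(4), of n n' w])
        fix z assume z: "z \<in> ?Z"
        have "(\<exists>f\<in>insert v (set q3). f \<sim> z) \<longleftrightarrow> v \<sim> z \<or> (\<exists>f\<in>set q3. f \<sim> z)" by blast
        then show "(\<exists>f\<in>insert v (set q3). f \<sim> z) \<longleftrightarrow> z = n \<or> z = n' \<or> z = w"
          unfolding att_Q[OF z] using only[OF z] n(2) n'(2) by blast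
      qed (use off Zin nn n n' \<open>n' \<noteq> w\<close> in blast)+
    next
      case False
      then have vn: "v \<sim> z \<longleftrightarrow> z = n" if "z \<in> ?Z" for z using att_v[OF that] n by blast
      show False
      proof (cases "b1 = []")
        case True
        show False
        proof (rule three[OF cv(2), of n "hd ds" y1])
          fix z assume z: "z \<in> ?Z"
          have "(\<exists>f\<in>insert v ?P1. f \<sim> z) \<longleftrightarrow> v \<sim> z \<or> (\<exists>f\<in>?P1. f \<sim> z)" by blast
          then show "(\<exists>f\<in>insert v ?P1. f \<sim> z) \<longleftrightarrow> z = n \<or> z = hd ds \<or> z = y1"
            unfolding att_P1[OF z] vn[OF z] using True by blast
        qed (use off Zin nn n ne in blast)+
      next
        case b1: False
        show False
        proof (rule three[of "insert v ?P1 \<union> insert v (set q3)" n "hd ds" w])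
          fix z assume z: "z \<in> ?Z"
          have "(\<exists>f\<in>insert v ?P1 \<union> insert v (set q3). f \<sim> z) \<longleftrightarrow> v \<sim> z \<or> (\<exists>f\<in>?P1. f \<sim> z) \<or> (\<exists>f\<in>set q3. f \<sim> z)" by blast
          then show "(\<exists>f\<in>insert v ?P1 \<union> insert v (set q3). f \<sim> z) \<longleftrightarrow> z = n \<or> z = hd ds \<or> z = w"
            unfolding att_P1[OF z] att_Q[OF z] vn[OF z] using b1 by blast
        qed (use un[OF cv(2,4)] off Zin nn n ne in blast)+
      qed
    qed
  qed
qed

text \<open>The induction is over the size of \<open>D\<close> with the legs generalised, since it
  is used for permuted thetas and for one with a new leg. Let \<open>ds\<close> be a shortest path
  in \<open>D\<close> between the attachments to \<open>q1\<close> and to \<open>q2\<close>. If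
  \<open>ds\<close> sees \<open>q3\<close>, a proper part of it attaches to another pair of legs, or
  \<open>ds\<close> is one vertex and \<open>theta_vertex\<close> applies. If not,
  \<open>theta_path_aux\<close> leaves only the case that \<open>ds\<close> sees both
  \<open>v\<close> and \<open>w\<close>: then a new leg \<open>q4\<close> lies inside
  \<open>ds\<close>, and the part of \<open>ds\<close> leading from its head to \<open>q4\<close> is
  a smaller set attached to \<open>q1\<close> and \<open>q4\<close>.\<close>

lemma theta_attach:
  assumes "theta v w q1 q2 q3" "conn D" "D \<subseteq> V" "D \<inter> ({v, w} \<union> set q1 \<union> set q2 \<union> set q3) = {}"
    and "\<exists>d\<in>D. \<exists>x\<in>set q1. d \<sim> x" "\<exists>d\<in>D. \<exists>x\<in>set q2. d \<sim> x"
  shows "\<exists>d\<in>D. \<exists>x1 x2 x3. q1 = [x1] \<and> q2 = [x2] \<and> q3 = [x3] \<and> d \<sim> x1 \<and> d \<sim> x2 \<and> d \<sim> x3"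
  using assms
proof (induction "card D" arbitrary: D q1 q2 q3 rule: less_induct)
  case less
  note th = less.prems(1) and D = less.prems(2-4)
  note t1 = theta_legD[OF th] and t2 = theta_legD[OF theta_perm(1)[OF th]]
    and t3 = theta_legD[OF theta_perm(1)[OF theta_perm(2)[OF th]]]
  have finD: "finite D" using D(2) finite_V finite_subset by blast
  obtain da db where dab: "da \<in> D" "\<exists>x\<in>set q1. da \<sim> x" "db \<in> D" "\<exists>x\<in>set q2. db \<sim> x" using less.prems(5,6) by blast
  obtain ds where ds: "ds \<noteq> []" "ipath ds" "set ds \<subseteq> D" "\<exists>x\<in>set q1. hd ds \<sim> x" "\<exists>x\<in>set q2. last ds \<sim> x"
    "\<And>z. z \<in> set ds \<Longrightarrow> \<exists>x\<in>set q1. z \<sim> x \<Longrightarrow> z = hd ds" "\<And>z. z \<in> set ds \<Longrightarrow> \<exists>x\<in>set q2. z \<sim> x \<Longrightarrow> z = last ds"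
    by (rule min_path[where A = "\<lambda>z. \<exists>x\<in>set q1. z \<sim> x" and B = "\<lambda>z. \<exists>x\<in>set q2. z \<sim> x", OF D(1) dab]) blast
  have dsV: "set ds \<subseteq> V" "set ds \<inter> ({v, w} \<union> set q1 \<union> set q2 \<union> set q3) = {}" using ds(3) D by blast+
  have dd: "distinct ds" by (rule ipath_distinct[OF ds(2)])
  show ?case
  proof (cases "\<exists>e\<in>set ds. \<exists>x\<in>set q3. e \<sim> x")
    case True
    then obtain e where e: "e \<in> set ds" "\<exists>x\<in>set q3. e \<sim> x" by blast
    then obtain as bs where ab: "ds = as @ e # bs" by (meson split_list)
    show ?thesis
    \<comment> \<open>If \<open>e\<close> is not the last vertex, the initial part up to
      \<open>e\<close> attaches to \<open>q1\<close> and \<open>q3\<close> and is smaller than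
      \<open>D\<close>.\<close>
    proof (cases "bs = []")
      case False
      let ?D = "set (as @ [e])"
      have sub: "?D \<subseteq> set ds" using ab by auto
      have "last ds \<notin> ?D" using ab False dd by auto
      then have "?D \<subset> D" using sub ds(1,3) last_in_set by blast
      then have c: "card ?D < card D" using finD by (rule psubset_card_mono[rotated])
      have i: "conn ?D" using ds(2) ipath_append[of "as @ [e]" bs] ab by (intro ipath_conn) simp
      have "hd ds \<in> ?D" using ab by (cases as) auto
      then have h: "\<exists>d\<in>?D. \<exists>x\<in>set q1. d \<sim> x" using ds(4) by blast
      have h3: "\<exists>d\<in>?D. \<exists>x\<in>set q3. d \<sim> x" using e(2) by auto
      have "?D \<subseteq> V" "?D \<inter> ({v, w} \<union> set q1 \<union> set q3 \<union> set q2) = {}" using sub dsV by blast+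
      from less.hyps[OF c theta_perm(2)[OF th] i this h h3] show ?thesis using sub ds(3) by blast
    next
      case True
      show ?thesis
      \<comment> \<open>If \<open>e\<close> is the last but not the first vertex, \<open>{e}\<close>
        attaches to \<open>q2\<close> and \<open>q3\<close> and is smaller than
        \<open>D\<close>.\<close>
      proof (cases "as = []")
        case False
        let ?D = "{e}"
        have "hd ds \<noteq> e" using ab True False dd by (cases as) auto
        then have "?D \<subset> D" using e ds(1,3) hd_in_set by blast
        then have c: "card ?D < card D" using finD by (rule psubset_card_mono[rotated])
        have "e = last ds" using ab True by simp
        then have h: "\<exists>d\<in>?D. \<exists>x\<in>set q2. d \<sim> x" using ds(5) by blast
        have h3: "\<exists>d\<in>?D. \<exists>x\<in>set q3. d \<sim> x" using e(2) by auto
        have "?D \<subseteq> V" "?D \<inter> ({v, w} \<union> set q2 \<union> set q3 \<union> set q1) = {}" using e dsV by blast+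
        from less.hyps[OF c theta_perm(2)[OF theta_perm(1)[OF th]] conn_single this h h3]
        show ?thesis using e(1) ds(3) by blast
      next
        case as: True
        then have "ds = [e]" using ab True by simp
        then obtain x1 x2 x3 where x: "x1 \<in> set q1" "x2 \<in> set q2" "x3 \<in> set q3" "e \<sim> x1" "e \<sim> x2" "e \<sim> x3"
          using ds(4,5) e(2) by auto
        have "e \<in> V" "e \<notin> {v, w} \<union> set q1 \<union> set q2 \<union> set q3" using e(1) dsV by blast+
        from theta_vertex[OF th this x] show ?thesis using x e(1) ds(3) by blast
      qed
    qed
  next
    case no3: False
    have a1: "z = hd ds" if "z \<in> set ds" "x \<in> set q1" "z \<sim> x" for z x using ds(6) that by blast
    have a2: "z = last ds" if "z \<in> set ds" "x \<in> set q2" "z \<sim> x" for z x using ds(7) that by blast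
    have a3: "\<not> z \<sim> x" if "z \<in> set ds" "x \<in> set q3" for z x using no3 that by blast
    have False
    proof (cases "(\<exists>z\<in>set ds. z \<sim> v) \<and> (\<exists>z\<in>set ds. z \<sim> w)")
      case False
      then consider "\<And>z. z \<in> set ds \<Longrightarrow> \<not> z \<sim> w" | "\<And>z. z \<in> set ds \<Longrightarrow> \<not> z \<sim> v" by blast
      then show False
      proof cases
        case 1
        show False by (rule theta_path_aux[OF th ds(2,1) dsV ds(4) a1 ds(5) a2 a3 1])
      next
        case 2
        show False
          by (rule theta_path_aux[OF theta_rev[OF th] ds(2,1) dsV(1) _ _ _ _ _ _ 2])
            (use dsV(2) ds(4,5) a1 a2 a3 in auto)
      qed
    next
      case True
      have hl: "hd ds \<in> set ds" "last ds \<in> set ds" using ds(1) by auto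
      have cds: "conn (set ds)" by (rule ipath_conn[OF ds(2)])
      have dsV': "set ds \<inter> ({v, w} \<union> set q2 \<union> set q1 \<union> set q3) = {}" using dsV(2) by auto
      have q2e: "\<exists>z\<in>set ds. \<exists>x\<in>set q2. z \<sim> x" and q1e: "\<exists>z\<in>set ds. \<exists>x\<in>set q1. z \<sim> x" using ds(4,5) hl by blast+
      \<comment> \<open>Both ends of \<open>ds\<close> see two leg vertices and hence neither
        \<open>v\<close> nor \<open>w\<close>, so the new leg lies strictly inside
        \<open>ds\<close>.\<close>
      have two1: "\<not> hd ds \<sim> v" "\<not> hd ds \<sim> w"
      proof -
        have "\<exists>a x b y c. q1 = a @ x # b @ y # c \<and> hd ds \<sim> x \<and> hd ds \<sim> y \<and> (\<forall>z\<in>{v, w} \<union> set q1. hd ds \<sim> z \<longrightarrow> z = x \<or> z = y)"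
          by (rule theta_leg_two[OF th cds dsV hl(1) ds(4) _ q2e]) (use a1 a3 in blast)+
        then show "\<not> hd ds \<sim> v" "\<not> hd ds \<sim> w" using t1(3,4) by auto
      qed
      have two2: "\<not> last ds \<sim> v" "\<not> last ds \<sim> w"
      proof -
        have "\<exists>a x b y c. q2 = a @ x # b @ y # c \<and> last ds \<sim> x \<and> last ds \<sim> y \<and> (\<forall>z\<in>{v, w} \<union> set q2. last ds \<sim> z \<longrightarrow> z = x \<or> z = y)"
          by (rule theta_leg_two[OF theta_perm(1)[OF th] cds dsV(1) dsV' hl(2) ds(5) _ q1e]) (use a2 a3 in blast)+
        then show "\<not> last ds \<sim> v" "\<not> last ds \<sim> w" using t2(3,4) by auto
      qed
      obtain x0 rest where r: "ds = x0 # rest" using ds(1) by (meson neq_Nil_conv)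
      have "rest \<noteq> []" using r True two1 by auto
      then obtain mid y0 where m: "rest = mid @ [y0]" by (metis append_butlast_last_id)
      have ds_eq: "ds = x0 # mid @ [y0]" using r m by simp
      have mid: "set mid \<subseteq> set ds" "hd ds \<notin> set mid" "last ds \<notin> set mid" using ds_eq dd by auto
      have cmid: "conn (set mid)"
      proof -
        have "ipath ([x0] @ mid @ [y0])" using ds(2) ds_eq by simp
        then show ?thesis by (rule ipath_conn[OF ipath_sub])
      qed
      have in_mid: "z \<in> set mid" if "z \<in> set ds" "z \<sim> v \<or> z \<sim> w" for z
      proof -
        have "z \<noteq> hd ds" "z \<noteq> last ds" using that(2) two1 two2 by blast+
        then show ?thesis using that(1) unfolding ds_eq by simp
      qed
      obtain zv zw where z: "zv \<in> set mid" "zv \<sim> v" "zw \<in> set mid" "zw \<sim> w" using True in_mid by blast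
      obtain q4 where q4: "q4 \<noteq> []" "ipath q4" "set q4 \<subseteq> set mid" "hd q4 \<sim> v" "last q4 \<sim> w"
        "\<And>x. x \<in> set q4 \<Longrightarrow> x \<sim> v \<Longrightarrow> x = hd q4" "\<And>x. x \<in> set q4 \<Longrightarrow> x \<sim> w \<Longrightarrow> x = last q4"
        by (rule min_path[where A = "\<lambda>x. x \<sim> v" and B = "\<lambda>x. x \<sim> w", OF cmid z]) blast
      have q4ds: "set q4 \<subseteq> set ds" using q4(3) mid(1) by blast
      have leg4: "ipath (v # q4 @ [w])"
      proof (rule ipath_legI[OF t1(9,10) q4(2,1)])
        show "v \<notin> set q4" "w \<notin> set q4" using q4ds dsV(2) by auto
        show "v \<sim> x \<longleftrightarrow> x = hd q4" if "x \<in> set q4" for x using q4(4,6) that adj_sym by blast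
        show "w \<sim> x \<longleftrightarrow> x = last q4" if "x \<in> set q4" for x using q4(5,7) that adj_sym by blast
      qed
      have an1: "anti q1 q4"
        unfolding anti_def
      proof (intro ballI)
        fix x y assume x: "x \<in> set q1" and y: "y \<in> set q4"
        have "y \<in> set ds" "y \<noteq> hd ds" using y q4ds q4(3) mid(2) by blast+
        then show "x \<noteq> y \<and> \<not> x \<sim> y" using a1[OF _ x, of y] dsV(2) x adj_sym by blast
      qed
      have an3: "anti q3 q4"
        unfolding anti_def using a3 q4ds dsV(2) adj_sym by blast
      have th4: "theta v w q1 q4 q3"
        using th leg4 an1 anti_sym[OF an3] q4ds dsV(1) unfolding theta_def by (auto simp del: ipath.simps)
      obtain es where es: "es \<noteq> []" "ipath es" "set es \<subseteq> set ds" "hd es = hd ds" "\<exists>y\<in>set q4. last es \<sim> y" "set es \<inter> set q4 = {}"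
      proof (rule min_path_adj[where A = "\<lambda>x. x = hd ds" and T = "set q4" and t = "hd q4", OF cds hl(1) refl])
        show "hd q4 \<in> set ds" "hd q4 \<in> set q4 \<or> (\<exists>y\<in>set q4. hd q4 \<sim> y)" using q4ds q4(1) hd_in_set by auto
        show "x \<noteq> hd ds" if "x \<in> set q4" for x using that q4(3) mid(2) by blast
      qed blast
      have "hd q4 \<in> D - set es" using q4(1) q4ds ds(3) es(6) hd_in_set by blast
      then have "set es \<subset> D" using es(3) ds(3) by blast
      then have c: "card (set es) < card D" using finD by (rule psubset_card_mono[rotated])
      have esV: "set es \<subseteq> V" "set es \<inter> ({v, w} \<union> set q1 \<union> set q4 \<union> set q3) = {}" using es(3,6) dsV by blast+
      have "\<exists>d\<in>set es. \<exists>x\<in>set q1. d \<sim> x" "\<exists>d\<in>set es. \<exists>x\<in>set q4. d \<sim> x"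
        using es(1,4,5) ds(4) hd_in_set[OF es(1)] last_in_set[OF es(1)] by auto
      \<comment> \<open>The induction hypothesis provides a vertex of \<open>ds\<close> that sees
        \<open>q3\<close>, which is excluded in this case.\<close>
      from less.hyps[OF c th4 ipath_conn[OF es(2)] esV this]
      obtain d x3 where "d \<in> set es" "q3 = [x3]" "d \<sim> x3" by blast
      then show False using a3[of d x3] es(3) by auto
    qed
    then show ?thesis ..
  qed
qed

end

section \<open>Components, separations and complete bipartite subgraphs\<close>

context sym_rel begin

text \<open>For \<open>x\<close> outside \<open>S\<close> this is just \<open>{x}\<close>, so
  \<open>comp_self\<close> holds unconditionally.\<close>

definition comp :: "'a set \<Rightarrow> 'a \<Rightarrow> 'a set" where
  "comp S x = {y. (x, y) \<in> {(a, b). a \<in> S \<and> b \<in> S \<and> a \<sim> b}\<^sup>*}"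

lemma comp_self: "x \<in> comp S x"
  by (simp add: comp_def)

lemma comp_subset: "x \<in> S \<Longrightarrow> comp S x \<subseteq> S"
proof
  fix y assume "x \<in> S" "y \<in> comp S x"
  then show "y \<in> S" unfolding comp_def by (auto elim: rtranclE)
qed

lemma comp_closed: "y \<in> comp S x \<Longrightarrow> y \<in> S \<Longrightarrow> z \<in> S \<Longrightarrow> y \<sim> z \<Longrightarrow> z \<in> comp S x"
  unfolding comp_def by (auto intro: rtrancl_into_rtrancl)

lemma conn_comp: "conn (comp S x)"
proof -
  let ?R = "{(a, b). a \<in> S \<and> b \<in> S \<and> a \<sim> b}" and ?D = "comp S x"
  let ?Q = "{(a, b). a \<in> ?D \<and> b \<in> ?D \<and> a \<sim> b}"
  have xy: "(x, y) \<in> ?Q\<^sup>*" if "(x, y) \<in> ?R\<^sup>*" for y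
    using that
  proof (induction rule: rtrancl_induct)
    case (step y z)
    then have "y \<in> ?D" "z \<in> ?D" unfolding comp_def by (auto intro: rtrancl_into_rtrancl)
    then show ?case using step by (auto intro: rtrancl_into_rtrancl)
  qed simp
  show ?thesis unfolding conn_def
  proof (intro ballI)
    fix a b assume "a \<in> ?D" "b \<in> ?D"
    then have "(x, a) \<in> ?Q\<^sup>*" "(x, b) \<in> ?Q\<^sup>*" using xy unfolding comp_def by auto
    then show "(a, b) \<in> ?Q\<^sup>*" using rtrancl_sub_sym[of x a ?D] by (meson rtrancl_trans)
  qed
qed

lemma conn_subset_comp:
  assumes "conn T" "T \<subseteq> S" "y \<in> T" "y \<in> comp S x"
  shows "T \<subseteq> comp S x"
proof
  fix z assume "z \<in> T"
  then have "(y, z) \<in> {(a, b). a \<in> T \<and> b \<in> T \<and> a \<sim> b}\<^sup>*" using assms(1,3) unfolding conn_def by blast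
  then have "(y, z) \<in> {(a, b). a \<in> S \<and> b \<in> S \<and> a \<sim> b}\<^sup>*" using assms(2) by (rule rtrancl_sub_mono)
  then show "z \<in> comp S x" using assms(4) unfolding comp_def by auto
qed

lemma ipath_nbrs:
  assumes "ipath (as @ x # bs)" "y \<in> set (as @ x # bs)" "x \<sim> y"
  shows "y = last as \<or> y = hd bs"
proof -
  have i: "ipath (x # bs)" and a: "\<forall>u\<in>set as. \<forall>z\<in>set (x # bs). u \<noteq> z \<and> (u \<sim> z \<longrightarrow> u = last as \<and> z = hd (x # bs))"
    using assms(1) unfolding ipath_append by blast+
  have "y \<noteq> x" using assms(3) adj_neq by blast
  then consider "y \<in> set as" | "y \<in> set bs" using assms(2) by auto
  then show ?thesis
  proof cases
    case 1 then show ?thesis using a assms(3) adj_sym by auto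
  next
    case 2 then show ?thesis using i assms(3) by (cases bs) auto
  qed
qed

text \<open>An induced path has no shortcut, so an induced path with the same ends inside its vertex
  set must follow it step by step. It shows that a side of a separation containing a leg and a
  further vertex is not a path.\<close>

lemma ipath_subset_eq:
  assumes "ipath xs" "ipath ys" "xs \<noteq> []" "ys \<noteq> []" "hd xs = hd ys" "last xs = last ys" "set ys \<subseteq> set xs"
  shows "set ys = set xs"
  using assms
proof (induction xs arbitrary: ys)
  case (Cons x xs)
  obtain zs where ys: "ys = x # zs" using Cons.prems(4,5) by (cases ys) auto
  show ?case
  proof (cases "xs = [] \<or> zs = []")
    case True
    have "xs = []"
    proof (rule ccontr)
      assume "xs \<noteq> []"
      then have "zs = []" "last xs = x" using True Cons.prems(6) ys by auto
      then show False using \<open>xs \<noteq> []\<close> Cons.prems(1) by (metis ipath.simps(2) last_in_set)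
    qed
    then show ?thesis using Cons.prems(7) ys by auto
  next
    case False
    have "x \<sim> hd zs" "hd zs \<in> set zs" "x \<notin> set zs" using Cons.prems(2) ys False by auto
    then have "hd zs \<in> set xs" using Cons.prems(7) ys by auto
    then have "hd zs = hd xs" using Cons.prems(1) \<open>x \<sim> hd zs\<close> by (cases xs) auto
    then have "set zs = set xs"
      using Cons.IH[of zs] Cons.prems False ys \<open>x \<notin> set zs\<close> by auto
    then show ?thesis using ys by simp
  qed
qed simp

definition path_set :: "'a set \<Rightarrow> 'a \<Rightarrow> 'a \<Rightarrow> bool" where
  "path_set S a b \<longleftrightarrow> (\<exists>zs. ipath zs \<and> zs \<noteq> [] \<and> hd zs = a \<and> last zs = b \<and> set zs = S)"

text \<open>The counterpart of \<open>proper_2_cutset\<close> for the adjacency relation, with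
  \<open>path_set\<close> in place of \<open>is_path_between\<close>.\<close>

definition two_separation :: "'a set \<Rightarrow> 'a \<Rightarrow> 'a \<Rightarrow> 'a set \<Rightarrow> 'a set \<Rightarrow> bool" where
  "two_separation V a b X Y \<longleftrightarrow> a \<in> V \<and> b \<in> V \<and> a \<noteq> b \<and> \<not> a \<sim> b \<and> X \<noteq> {} \<and> Y \<noteq> {} \<and> X \<inter> Y = {} \<and> X \<union> Y = V - {a, b} \<and>
     (\<forall>x\<in>X. \<forall>y\<in>Y. \<not> x \<sim> y) \<and> \<not> path_set (X \<union> {a, b}) a b \<and> \<not> path_set (Y \<union> {a, b}) a b"

definition bip :: "'a set \<Rightarrow> 'a set \<Rightarrow> bool" where
  "bip A B \<longleftrightarrow> A \<inter> B = {} \<and> (\<forall>a\<in>A. \<forall>b\<in>B. a \<sim> b) \<and> (\<forall>a\<in>A. \<forall>a'\<in>A. \<not> a \<sim> a') \<and> (\<forall>b\<in>B. \<forall>b'\<in>B. \<not> b \<sim> b')"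

lemma bip_commute: "bip A B \<Longrightarrow> bip B A"
  unfolding bip_def using adj_sym by blast

end

context no_clique_cutset_rel begin

text \<open>K_{2,3} is the theta whose legs are single vertices.\<close>

lemma bip_theta:
  assumes "bip A B" "A \<union> B \<subseteq> V" "a1 \<in> A" "a2 \<in> A" "a1 \<noteq> a2" "{b1, b2, b3} \<subseteq> B" "distinct [b1, b2, b3]"
  shows "theta a1 a2 [b1] [b2] [b3]"
proof -
  have "a \<sim> b \<and> b \<sim> a \<and> a \<noteq> b" if "a \<in> A" "b \<in> B" for a b
    using assms(1) that adj_sym adj_neq unfolding bip_def by blast
  moreover have "\<not> b \<sim> b'" if "b \<in> B" "b' \<in> B" for b b' using assms(1) that unfolding bip_def by blast
  moreover have "\<not> a1 \<sim> a2" using assms(1,3,4) unfolding bip_def by blast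
  ultimately show ?thesis unfolding theta_def anti_def using assms(2-7) by auto
qed

lemma card_3_obtain:
  assumes "3 \<le> card A" obtains a1 a2 a3 where "{a1, a2, a3} \<subseteq> A" "distinct [a1, a2, a3]"
proof -
  obtain T where "T \<subseteq> A" "card T = 3" by (rule obtain_subset_with_card_n[OF assms])
  then show ?thesis using that unfolding card_3_iff by auto
qed

text \<open>Two vertices of \<open>A\<close> and three of \<open>B\<close> form a theta, so
  \<open>theta_attach\<close> yields \<open>d\<close> in \<open>D\<close> adjacent to
  \<open>b1\<close>, \<open>b2\<close> and a third vertex of \<open>B\<close>. Applied again to
  \<open>{d}\<close> with any other third vertex, it makes \<open>d\<close> adjacent to all of
  \<open>B\<close>. An edge from \<open>d\<close> to \<open>A\<close> would have the common
  neighbours \<open>b1\<close> and \<open>b2\<close>.\<close>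

lemma bip_extend:
  assumes bip: "bip A B" "A \<union> B \<subseteq> V" "3 \<le> card A" "3 \<le> card B"
    and D: "conn D" "D \<subseteq> V" "D \<inter> (A \<union> B) = {}"
    and b: "b1 \<in> B" "b2 \<in> B" "b1 \<noteq> b2" "\<exists>d\<in>D. d \<sim> b1" "\<exists>d\<in>D. d \<sim> b2"
  shows "\<exists>d\<in>D. bip (insert d A) B"
proof -
  obtain a1 a2 a3 where "{a1, a2, a3} \<subseteq> A" "distinct [a1, a2, a3]" by (rule card_3_obtain[OF bip(3)])
  then have a: "a1 \<in> A" "a2 \<in> A" "a1 \<noteq> a2" by auto
  have attach: "\<exists>d\<in>D'. d \<sim> b1 \<and> d \<sim> b2 \<and> d \<sim> b"
    if D': "conn D'" "D' \<subseteq> D" "\<exists>d\<in>D'. d \<sim> b1" "\<exists>d\<in>D'. d \<sim> b2" and b': "b \<in> B" "b \<noteq> b1" "b \<noteq> b2" for b D'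
  proof -
    have th: "theta a1 a2 [b1] [b2] [b]" by (rule bip_theta[OF bip(1,2) a]) (use b b' in auto)
    have "D' \<inter> ({a1, a2} \<union> set [b1] \<union> set [b2] \<union> set [b]) = {}" using D' D(3) a b b' by auto
    from theta_attach[OF th D'(1) _ this] show ?thesis using D'(2-4) D(2) by auto
  qed
  have "card {b1, b2} < card B" using b(3) bip(4) by simp
  then have "\<not> B \<subseteq> {b1, b2}" by (meson card_mono finite.simps leD)
  then obtain b3 where b3: "b3 \<in> B" "b3 \<noteq> b1" "b3 \<noteq> b2" by blast
  obtain d where d: "d \<in> D" "d \<sim> b1" "d \<sim> b2" using attach[OF D(1) _ b(4,5) b3] by blast
  have dB: "d \<sim> b'" if "b' \<in> B" for b'
  proof (cases "b' = b1 \<or> b' = b2")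
    case False
    then show ?thesis using attach[of "{d}" b'] d that by auto
  qed (use d in auto)
  have dA: "\<not> d \<sim> a" if "a \<in> A" for a
  proof
    assume "d \<sim> a"
    moreover have "a \<sim> b1" "a \<sim> b2" using bip(1) that b unfolding bip_def by auto
    ultimately show False using common_nbr_unique[of d a b1 b2] d b(3) adj_sym by blast
  qed
  have "d \<notin> B" using d D(3) by auto
  then have "bip (insert d A) B" using bip(1) dB dA adj_sym adj_irrefl unfolding bip_def by auto
  then show ?thesis using d by blast
qed

text \<open>Take \<open>A\<close> and \<open>B\<close> of maximal total size. By
  \<open>bip_extend\<close>, a component outside them is attached to at most one vertex of
  \<open>A\<close> and one of \<open>B\<close>. These attachments form a clique, and it would be a
  cutset.\<close>

lemma bip_spanning:
  assumes "bip A0 B0" "A0 \<union> B0 \<subseteq> V" "3 \<le> card A0" "3 \<le> card B0"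
  shows "\<exists>A B. bip A B \<and> A \<union> B = V \<and> A \<noteq> {} \<and> B \<noteq> {}"
proof -
  define P where "P AB \<longleftrightarrow> bip (fst AB) (snd AB) \<and> fst AB \<union> snd AB \<subseteq> V \<and> 3 \<le> card (fst AB) \<and> 3 \<le> card (snd AB)" for AB
  have "P (A0, B0)" using assms unfolding P_def by simp
  moreover have "\<forall>AB. P AB \<longrightarrow> card (fst AB \<union> snd AB) < Suc (card V)"
    unfolding P_def using card_mono[OF finite_V] by (simp add: less_Suc_eq_le)
  ultimately obtain AB where AB: "P AB" "\<And>AB'. P AB' \<Longrightarrow> card (fst AB' \<union> snd AB') \<le> card (fst AB \<union> snd AB)"
    using ex_has_greatest_nat[of P _ "\<lambda>AB. card (fst AB \<union> snd AB)"] by metis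
  obtain A B where e: "AB = (A, B)" by (cases AB)
  have bip: "bip A B" "A \<union> B \<subseteq> V" "3 \<le> card A" "3 \<le> card B" using AB(1) e unfolding P_def by auto
  have fin: "finite A" "finite B" using bip(2) finite_V finite_subset by auto
  have noext: False if A': "bip A' B'" "A' \<union> B' \<subseteq> V" "3 \<le> card A'" "3 \<le> card B'" "A' \<union> B' = A \<union> B"
     "conn D" "D \<subseteq> V" "D \<inter> (A \<union> B) = {}"
     "b1 \<in> B'" "b2 \<in> B'" "b1 \<noteq> b2" "\<exists>d\<in>D. d \<sim> b1" "\<exists>d\<in>D. d \<sim> b2" for A' B' D b1 b2
  proof -
    obtain d where d: "d \<in> D" "bip (insert d A') B'" using bip_extend[OF A'(1-4,6,7) _ A'(9-13)] A'(5,8) by auto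
    have fA: "finite A'" using A'(2) finite_V finite_subset by auto
    have dn: "d \<notin> A' \<union> B'" using d A'(5,8) by auto
    have "card A' \<le> card (insert d A')" using fA by (simp add: card_insert_le)
    then have "P (insert d A', B')" unfolding P_def using d A'(2,3,4,7) by auto
    from AB(2)[OF this] have "card (insert d (A' \<union> B')) \<le> card (A' \<union> B')" using e A'(5) by simp
    then show False using dn A'(2) finite_V finite_subset by (metis card_insert_disjoint not_less_eq_eq order_refl)
  qed
  have "A \<union> B = V"
  proof (rule ccontr)
    assume "A \<union> B \<noteq> V"
    then obtain x where x: "x \<in> V - (A \<union> B)" using bip(2) by blast
    let ?D = "comp (V - (A \<union> B)) x"
    have D: "?D \<subseteq> V" "?D \<inter> (A \<union> B) = {}" using comp_subset[OF x] by auto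
    define N where "N = {y \<in> A \<union> B. \<exists>d\<in>?D. d \<sim> y}"
    have NB: "b1 = b2" if "b1 \<in> B" "b2 \<in> B" "b1 \<in> N" "b2 \<in> N" for b1 b2
      using noext[OF bip refl conn_comp D that(1,2)] that(3,4) unfolding N_def by blast
    have NA: "b1 = b2" if "b1 \<in> A" "b2 \<in> A" "b1 \<in> N" "b2 \<in> N" for b1 b2
    proof (rule ccontr)
      assume ne: "b1 \<noteq> b2"
      show False
        by (rule noext[OF bip_commute[OF bip(1)] _ bip(4,3) _ conn_comp D that(1,2) ne])
          (use bip(2) that(3,4) in \<open>auto simp: N_def\<close>)
    qed
    have NV: "N \<subseteq> A \<union> B" "N \<subseteq> V" using bip(2) unfolding N_def by auto
    have cVN: "conn (V - N)"
    proof (rule clique_conn[OF NV(2)])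
      fix y z assume yz: "y \<in> N" "z \<in> N" "y \<noteq> z"
      then consider "y \<in> A" "z \<in> B" | "y \<in> B" "z \<in> A" using NV(1) NA NB by blast
      then show "y \<sim> z"
      proof cases
        case 1 then show ?thesis using bip(1) unfolding bip_def by blast
      next
        case 2
        then have "z \<sim> y" using bip(1) unfolding bip_def by blast
        then show ?thesis by (rule adj_sym)
      qed
    qed
    obtain a1 a2 a3 where "{a1, a2, a3} \<subseteq> A" "distinct [a1, a2, a3]" by (rule card_3_obtain[OF bip(3)])
    \<comment> \<open>\<open>A\<close> has at least three vertices and at most one of them is an
      attachment, so a vertex remains on the other side of the cutset.\<close>
    then obtain a where a: "a \<in> A - N" using NA by auto
    have xaV: "x \<in> V - N" "a \<in> V - N" using x a bip(2) NV by auto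
    obtain xs where xs: "xs \<noteq> []" "ipath xs" "set xs \<subseteq> V - N" "hd xs = x" "\<exists>y\<in>A \<union> B - N. last xs \<sim> y" "set xs \<inter> (A \<union> B - N) = {}"
      by (rule min_path_adj[where A = "\<lambda>z. z = x" and T = "A \<union> B - N", OF cVN xaV(1) refl xaV(2)]) (use x a in blast)+
    have "set xs \<subseteq> V - (A \<union> B)" using xs(3,6) by blast
    then have "set xs \<subseteq> ?D" using conn_subset_comp[OF ipath_conn[OF xs(2)], of _ x] xs(1,4) comp_self hd_in_set by metis
    then show False using xs(1,5) unfolding N_def using last_in_set by blast
  qed
  moreover have "A \<noteq> {}" "B \<noteq> {}" using bip(3,4) by auto
  ultimately show ?thesis using bip(1) by blast
qed

text \<open>\<open>X\<close> consists of \<open>q1\<close>, the components outside the theta that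
  see it, and the component of \<open>d\<close>; \<open>Y\<close> is the rest. Adding
  \<open>v\<close> and \<open>w\<close> to \<open>X\<close> gives a set containing the path along
  \<open>q1\<close> and also \<open>d\<close>, hence no path; in \<open>Y\<close> with
  \<open>v\<close> and \<open>w\<close>, the end \<open>v\<close> has the two neighbours
  \<open>hd q2\<close> and \<open>hd q3\<close>. The hypothesis \<open>no\<close> ranges over
  reordered legs so that it covers every pair of them.\<close>

lemma theta_separation:
  assumes th: "theta v w q1 q2 q3" and d: "d \<in> V" "d \<notin> {v, w} \<union> set q1 \<union> set q2 \<union> set q3"
    and no: "\<And>D qa qb qc. theta v w qa qb qc \<Longrightarrow> set qa \<union> set qb \<union> set qc = set q1 \<union> set q2 \<union> set q3 \<Longrightarrow> conn D \<Longrightarrow> D \<subseteq> V \<Longrightarrow>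
      D \<inter> ({v, w} \<union> set q1 \<union> set q2 \<union> set q3) = {} \<Longrightarrow> \<exists>d\<in>D. \<exists>x\<in>set qa. d \<sim> x \<Longrightarrow> \<not> (\<exists>d\<in>D. \<exists>x\<in>set qb. d \<sim> x)"
    and dcomp: "\<And>z x. z \<in> comp (V - ({v, w} \<union> set q1 \<union> set q2 \<union> set q3)) d \<Longrightarrow> x \<in> set q2 \<union> set q3 \<Longrightarrow> \<not> z \<sim> x"
  shows "\<exists>X Y. two_separation V v w X Y"
proof -
  note t1 = theta_legD[OF th] and t2 = theta_legD[OF theta_perm(1)[OF th]]
    and t3 = theta_legD[OF theta_perm(1)[OF theta_perm(2)[OF th]]]
  define T where "T = {v, w} \<union> set q1 \<union> set q2 \<union> set q3"
  have TV: "T \<subseteq> V" using t1(11) unfolding T_def .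
  define X where "X = set q1 \<union> {x \<in> V - T. (\<exists>z\<in>comp (V - T) x. \<exists>y\<in>set q1. z \<sim> y)} \<union> comp (V - T) d"
  define Y where "Y = V - {v, w} - X"
  have dT: "d \<in> V - T" using d unfolding T_def by blast
  have cT: "comp (V - T) d \<subseteq> V - T" by (rule comp_subset[OF dT])
  have XV: "X \<subseteq> V - {v, w}" using cT t1(3,4) TV unfolding X_def T_def by blast
  have n23: "x \<notin> X" if "x \<in> set q2 \<union> set q3" for x
    using that t1(12,13) cT unfolding X_def T_def by blast
  have far: "\<not> z \<sim> y" if x: "x \<in> X" "x \<in> V - T" and z: "z \<in> comp (V - T) x" and y: "y \<in> set q2 \<union> set q3" for x y z
  proof (cases "x \<in> comp (V - T) d")
    case True
    have "z \<in> comp (V - T) d" using conn_subset_comp[OF conn_comp comp_subset[OF x(2)] comp_self True] z by blast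
    then show ?thesis using dcomp[of z y] y unfolding T_def by blast
  next
    case False
    then have q1x: "\<exists>z\<in>comp (V - T) x. \<exists>y\<in>set q1. z \<sim> y" using x unfolding X_def T_def by blast
    have cx: "comp (V - T) x \<subseteq> V" "comp (V - T) x \<inter> ({v, w} \<union> set q1 \<union> set q2 \<union> set q3) = {}"
      using comp_subset[OF x(2)] unfolding T_def by blast+
    have "set q1 \<union> set q3 \<union> set q2 = set q1 \<union> set q2 \<union> set q3" by blast
    then show ?thesis
      using no[OF th refl conn_comp cx q1x] no[OF theta_perm(2)[OF th] _ conn_comp cx q1x] z y by blast
  qed
  have edge: "\<not> x \<sim> y" if x: "x \<in> X" and y: "y \<in> Y" for x y
  proof
    assume xy: "x \<sim> y"
    have yV: "y \<in> V" "y \<noteq> v" "y \<noteq> w" "y \<notin> X" using y unfolding Y_def by auto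
    have yq1: "y \<notin> set q1" using yV unfolding X_def by blast
    show False
    proof (cases "y \<in> T")
      case True
      then have yq: "y \<in> set q2 \<union> set q3" using yV yq1 unfolding T_def by blast
      then have "x \<notin> set q1" using t1(12,13) xy by blast
      then have "x \<in> V - T" using x cT unfolding X_def by blast
      then show False using far[OF x _ comp_self yq] xy by blast
    next
      case yT: False
      show False
      proof (cases "x \<in> set q1")
        case True
        then have "y \<in> X" using yT yV(1) comp_self xy adj_sym unfolding X_def by blast
        then show False using yV by blast
      next
        case False
        then have xT: "x \<in> V - T" using x cT unfolding X_def by blast
        have yx: "y \<in> comp (V - T) x" using comp_closed[OF comp_self xT _ xy] yT yV(1) by blast
        have sub: "comp (V - T) x \<subseteq> comp (V - T) y"
        proof (rule conn_subset_comp[OF conn_comp comp_subset[OF xT] yx comp_self])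
        qed
        show False
        proof (cases "x \<in> comp (V - T) d")
          case True
          then have "y \<in> comp (V - T) d" using comp_closed[OF True xT _ xy] yT yV(1) by blast
          then show False using yV unfolding X_def by blast
        next
          case nd: False
          then have "\<exists>z\<in>comp (V - T) x. \<exists>y\<in>set q1. z \<sim> y" using x False unfolding X_def by blast
          then have "y \<in> X" using sub yT yV(1) unfolding X_def by blast
          then show False using yV by blast
        qed
      qed
    qed
  qed
  have l: "ipath (v # q1 @ [w])" using th unfolding theta_def by blast
  have nX: "\<not> path_set (X \<union> {v, w}) v w"
  proof
    assume "path_set (X \<union> {v, w}) v w"
    then obtain zs where zs: "ipath zs" "zs \<noteq> []" "hd zs = v" "last zs = w" "set zs = X \<union> {v, w}" unfolding path_set_def by blast
    have "set (v # q1 @ [w]) = set zs"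
      by (rule ipath_subset_eq[OF zs(1) l zs(2)]) (use zs(3-5) in \<open>auto simp: X_def\<close>)
    moreover have "d \<in> set zs" using zs(5) comp_self unfolding X_def by blast
    ultimately show False using d(2) by auto
  qed
  have h: "hd q2 \<in> Y" "hd q3 \<in> Y" "v \<sim> hd q2" "v \<sim> hd q3" "hd q2 \<noteq> hd q3"
  proof -
    have i: "hd q2 \<in> set q2" "hd q3 \<in> set q3" using t2(1) t3(1) by auto
    then show "hd q2 \<in> Y" "hd q3 \<in> Y" using n23 t1(11) t2(3,4) t3(3,4) unfolding Y_def by blast+
    show "v \<sim> hd q2" "v \<sim> hd q3" using t2(7)[OF i(1)] t3(7)[OF i(2)] by auto
    show "hd q2 \<noteq> hd q3" using t1(14) i by blast
  qed
  have nY: "\<not> path_set (Y \<union> {v, w}) v w"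
  proof
    assume "path_set (Y \<union> {v, w}) v w"
    then obtain zs where zs: "ipath zs" "zs \<noteq> []" "hd zs = v" "last zs = w" "set zs = Y \<union> {v, w}" unfolding path_set_def by blast
    then obtain ys where "zs = v # ys" by (cases zs) auto
    then have u: "y = hd ys" if "y \<in> set zs" "v \<sim> y" for y
    proof -
      have "y \<noteq> v" using that(2) adj_neq by blast
      then show ?thesis using zs(1) that unfolding \<open>zs = v # ys\<close> by (cases ys) auto
    qed
    have "hd q2 \<in> set zs" "hd q3 \<in> set zs" using h(1,2) unfolding zs(5) by simp_all
    from u[OF this(1) h(3)] u[OF this(2) h(4)] show False using h(5) by simp
  qed
  have "two_separation V v w X Y"
    unfolding two_separation_def
  proof (intro conjI ballI)
    show "v \<in> V" "w \<in> V" "v \<noteq> w" "\<not> v \<sim> w" using t1(9-11) by auto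
    show "X \<noteq> {}" "Y \<noteq> {}" using comp_self[of d] h(1) unfolding X_def by blast+
    show "X \<inter> Y = {}" "X \<union> Y = V - {v, w}" using XV unfolding Y_def by blast+
    show "\<not> x \<sim> y" if "x \<in> X" "y \<in> Y" for x y using edge that by blast
    show "\<not> path_set (X \<union> {v, w}) v w" by (rule nX)
    show "\<not> path_set (Y \<union> {v, w}) v w" by (rule nY)
  qed
  then show ?thesis by blast
qed

text \<open>In the last alternative the theta is the whole graph: inner vertices of its legs have
  degree at most two, and \<open>a\<close> and \<open>b\<close> are its ends.\<close>

theorem claw_structure:
  assumes claw: "v \<sim> n1" "v \<sim> n2" "v \<sim> n3" "distinct [n1, n2, n3]" "\<not> n1 \<sim> n2" "\<not> n1 \<sim> n3" "\<not> n2 \<sim> n3"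
  shows "(\<exists>A B. bip A B \<and> A \<union> B = V \<and> A \<noteq> {} \<and> B \<noteq> {}) \<or> (\<exists>a b X Y. two_separation V a b X Y)
    \<or> (\<exists>a b. \<forall>x\<in>V - {a, b}. card {y. x \<sim> y} \<le> 2)"
proof -
  obtain w q1 q2 q3 where th: "theta v w q1 q2 q3" using claw_theta[OF claw] by blast
  let ?T = "{v, w} \<union> set q1 \<union> set q2 \<union> set q3"
  show ?thesis
  proof (cases "\<exists>D qa qb qc. theta v w qa qb qc \<and> set qa \<union> set qb \<union> set qc = set q1 \<union> set q2 \<union> set q3 \<and> conn D \<and> D \<subseteq> V \<and>
      D \<inter> ?T = {} \<and> (\<exists>d\<in>D. \<exists>x\<in>set qa. d \<sim> x) \<and> (\<exists>d\<in>D. \<exists>x\<in>set qb. d \<sim> x)")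
    case True
    then show ?thesis
    proof (elim exE conjE)
      fix D qa qb qc
      assume a: "theta v w qa qb qc" "set qa \<union> set qb \<union> set qc = set q1 \<union> set q2 \<union> set q3" "conn D" "D \<subseteq> V"
        "D \<inter> ?T = {}" "\<exists>d\<in>D. \<exists>x\<in>set qa. d \<sim> x" "\<exists>d\<in>D. \<exists>x\<in>set qb. d \<sim> x"
    have U: "{v, w} \<union> set qa \<union> set qb \<union> set qc = ?T" using a(2) by blast
    obtain d x1 x2 x3 where d: "d \<in> D" "qa = [x1]" "qb = [x2]" "qc = [x3]" "d \<sim> x1" "d \<sim> x2" "d \<sim> x3"
      using theta_attach[OF a(1,3,4) _ a(6,7)] a(5) unfolding U by blast
    note t1 = theta_legD[OF a(1)] and t2 = theta_legD[OF theta_perm(1)[OF a(1)]]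
      and t3 = theta_legD[OF theta_perm(1)[OF theta_perm(2)[OF a(1)]]]
    have vx: "v \<sim> x1" "v \<sim> x2" "v \<sim> x3" "w \<sim> x1" "w \<sim> x2" "w \<sim> x3"
      using t1(7,8)[of x1] t2(7,8)[of x2] t3(7,8)[of x3] d by auto
    have xx: "x1 \<noteq> x2" "x1 \<noteq> x3" "x2 \<noteq> x3" "\<not> x1 \<sim> x2" "\<not> x1 \<sim> x3" "\<not> x2 \<sim> x3"
      using t1(12)[of x1 x2] t1(13)[of x1 x3] t1(14)[of x2 x3] d by auto
    have dT: "d \<notin> {v, w} \<union> set qa \<union> set qb \<union> set qc" using d(1) a(5) U by blast
    \<comment> \<open>An edge from \<open>d\<close> to \<open>v\<close> or \<open>w\<close> would
      have both \<open>x1\<close> and \<open>x2\<close> as common neighbours.\<close>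
    have dvw: "\<not> d \<sim> v" "\<not> d \<sim> w"
      using common_nbr_unique[of d v x1 x2] common_nbr_unique[of d w x1 x2] vx xx d adj_sym by blast+
    have dne: "d \<noteq> v" "d \<noteq> w" "d \<notin> {x1, x2, x3}" using dT d by auto
    have vwx: "v \<notin> {x1, x2, x3}" "w \<notin> {x1, x2, x3}" using vx adj_neq by blast+
    have "bip {v, w, d} {x1, x2, x3}"
    proof -
      have "{v, w, d} \<inter> {x1, x2, x3} = {}" using dne vwx by auto
      moreover have "\<forall>a\<in>{v, w, d}. \<forall>b\<in>{x1, x2, x3}. a \<sim> b" using vx d(5-7) by simp
      moreover have "\<forall>a\<in>{v, w, d}. \<forall>b\<in>{v, w, d}. \<not> a \<sim> b"
        using dvw t1(10) adj_commute[of v d] adj_commute[of w d] adj_commute[of w v] by (simp add: adj_irrefl)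
      moreover have "\<forall>a\<in>{x1, x2, x3}. \<forall>b\<in>{x1, x2, x3}. \<not> a \<sim> b"
        using xx adj_commute[of x2 x1] adj_commute[of x3 x1] adj_commute[of x3 x2] by (simp add: adj_irrefl)
      ultimately show ?thesis unfolding bip_def by blast
    qed
    moreover have "{v, w, d} \<union> {x1, x2, x3} \<subseteq> V" using t1(11) d a(4) by auto
    moreover have "card {v, w, d} = 3" "card {x1, x2, x3} = 3" using t1(9) dne xx by auto
    ultimately show ?thesis using bip_spanning[of "{v, w, d}" "{x1, x2, x3}"] by simp
    qed
  next
    case False
    then have no: "\<not> (\<exists>d\<in>D. \<exists>x\<in>set qb. d \<sim> x)" if "theta v w qa qb qc" "set qa \<union> set qb \<union> set qc = set q1 \<union> set q2 \<union> set q3"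
      "conn D" "D \<subseteq> V" "D \<inter> ?T = {}" "\<exists>d\<in>D. \<exists>x\<in>set qa. d \<sim> x" for D qa qb qc using that by blast
    have TV: "?T \<subseteq> V" using theta_legD(11)[OF th] .
    show ?thesis
    proof (cases "?T = V")
      case True
      have "card {y. x \<sim> y} \<le> 2" if x: "x \<in> V - {v, w}" for x
      proof -
        have leg: "card {y. x \<sim> y} \<le> 2" if t: "theta v w qa qb qc" and U: "{v, w} \<union> set qa \<union> set qb \<union> set qc = V" and xq: "x \<in> set qa" for qa qb qc
        proof -
          obtain as bs where e: "qa = as @ x # bs" using xq by (meson split_list)
          have i: "ipath ((v # as) @ x # (bs @ [w]))" using t e unfolding theta_def by simp
          have "y = last (v # as) \<or> y = hd (bs @ [w])" if "x \<sim> y" for y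
          proof (rule ipath_nbrs[OF i _ that])
            have "y \<in> V" using adj_V adj_sym that by blast
            then have "y \<in> {v, w} \<union> set qa" using theta_legD(12,13)[OF t xq, of y] that U by blast
            then show "y \<in> set ((v # as) @ x # (bs @ [w]))" using e by auto
          qed
          then have "{y. x \<sim> y} \<subseteq> {last (v # as), hd (bs @ [w])}" by blast
          then have "card {y. x \<sim> y} \<le> card {last (v # as), hd (bs @ [w])}" by (intro card_mono) simp_all
          also have "\<dots> \<le> 2" by (simp add: card_insert_if)
          finally show ?thesis .
        qed
        have "x \<in> set q1 \<or> x \<in> set q2 \<or> x \<in> set q3" using x True by blast
        then show ?thesis
          using leg[OF th True] leg[OF theta_perm(1)[OF th]] leg[OF theta_perm(1)[OF theta_perm(2)[OF th]]] True
          by (metis Un_assoc Un_commute)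
      qed
      then show ?thesis by blast
    next
      case False
      then obtain d where d: "d \<in> V" "d \<notin> ?T" using TV by blast
      let ?D = "comp (V - ?T) d"
      have D: "conn ?D" "?D \<subseteq> V" "?D \<inter> ?T = {}" using conn_comp comp_subset[of d "V - ?T"] d by blast+
      have sep: ?thesis if t: "theta v w qa qb qc" and U: "set qa \<union> set qb \<union> set qc = set q1 \<union> set q2 \<union> set q3"
        and att: "\<And>z x. z \<in> ?D \<Longrightarrow> x \<in> set qb \<union> set qc \<Longrightarrow> \<not> z \<sim> x" for qa qb qc
      proof -
        have U': "{v, w} \<union> set qa \<union> set qb \<union> set qc = ?T" using U by blast
        have "\<exists>X Y. two_separation V v w X Y"
          by (rule theta_separation[OF t d(1), unfolded U' U, OF d(2)]) (fact no att)+
        then show ?thesis by blast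
      qed
      have p1: "theta v w q2 q1 q3" "theta v w q3 q1 q2" "theta v w q1 q3 q2" "theta v w q2 q3 q1"
        using theta_perm th by blast+
      have s: "set q2 \<union> set q1 \<union> set q3 = set q1 \<union> set q2 \<union> set q3" "set q3 \<union> set q1 \<union> set q2 = set q1 \<union> set q2 \<union> set q3"
        "set q1 \<union> set q3 \<union> set q2 = set q1 \<union> set q2 \<union> set q3" "set q2 \<union> set q3 \<union> set q1 = set q1 \<union> set q2 \<union> set q3" by blast+
      \<comment> \<open>The component of \<open>d\<close> sees at most one leg; the theta is
        reordered so that this leg comes first.\<close>
      show ?thesis
      proof (cases "\<exists>d\<in>?D. \<exists>x\<in>set q2. d \<sim> x")
        case True
        show ?thesis by (rule sep[OF p1(1) s(1)]) (use no[OF p1(1) s(1) D True] no[OF p1(4) s(4) D True] in blast)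
      next
        case n2: False
        show ?thesis
        proof (cases "\<exists>d\<in>?D. \<exists>x\<in>set q3. d \<sim> x")
          case True
          show ?thesis by (rule sep[OF p1(2) s(2)]) (use no[OF p1(2) s(2) D True] n2 in blast)
        next
          case False
          show ?thesis by (rule sep[OF th refl]) (use n2 False in blast)
        qed
      qed
    qed
  qed
qed

end

subsection \<open>Root graphs of claw-free graphs\<close>

text \<open>\<open>S g\<close> is the set of the two ends of the edge of the root graph that corresponds to the vertex \<open>g\<close>.\<close>

definition root_graph :: "('a \<Rightarrow> nat set) \<Rightarrow> 'a set \<Rightarrow> nat pair_pre_digraph" where
  "root_graph S V = \<lparr>pverts = \<Union>(S ` V), parcs = {(x, y). x \<noteq> y \<and> (\<exists>g\<in>V. S g = {x, y})}\<rparr>"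

lemma pair_graph_root_graph:
  assumes "finite V" "\<And>g. g \<in> V \<Longrightarrow> card (S g) = 2"
  shows "pair_graph (root_graph S V)"
proof -
  have fin: "finite (\<Union>(S ` V))" using assms by (auto intro: card_ge_0_finite)
  have sub: "parcs (root_graph S V) \<subseteq> \<Union>(S ` V) \<times> \<Union>(S ` V)" unfolding root_graph_def by auto
  then have "finite (parcs (root_graph S V))" using fin by (meson finite_SigmaI finite_subset)
  then show ?thesis using fin sub
    by unfold_locales (auto simp: root_graph_def symmetric_def sym_def insert_commute)
qed

lemma undirected_edges_root_graph:
  assumes "\<And>g. g \<in> V \<Longrightarrow> card (S g) = 2"
  shows "undirected_edges (root_graph S V) = S ` V"
proof
  show "undirected_edges (root_graph S V) \<subseteq> S ` V" unfolding undirected_edges_def root_graph_def by auto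
  show "S ` V \<subseteq> undirected_edges (root_graph S V)"
  proof
    fix e assume "e \<in> S ` V"
    then obtain g where g: "g \<in> V" "e = S g" by blast
    then obtain x y where "S g = {x, y}" "x \<noteq> y" using assms card_2_iff by metis
    then show "e \<in> undirected_edges (root_graph S V)" unfolding undirected_edges_def root_graph_def using g by auto
  qed
qed

section \<open>Cycles of the root graph as chordless cycles of its line graph\<close>

context sym_rel begin

text \<open>\<open>\<gamma> x y\<close> stands for the vertex of the graph that represents the edge
  between \<open>x\<close> and \<open>y\<close> of the root graph.\<close>

fun edge_list :: "('b \<Rightarrow> 'b \<Rightarrow> 'a) \<Rightarrow> 'b list \<Rightarrow> 'a list" where
  "edge_list \<gamma> (x # y # zs) = \<gamma> x y # edge_list \<gamma> (y # zs)"
| "edge_list \<gamma> _ = []"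

lemma edge_list_in: "g \<in> set (edge_list \<gamma> us) \<Longrightarrow> \<exists>x y. g = \<gamma> x y \<and> (x, y) \<in> path_arcs us"
  by (induction \<gamma> us rule: edge_list.induct) auto

lemma edge_list_last: "xs \<noteq> [] \<Longrightarrow> edge_list \<gamma> (xs @ [y]) = edge_list \<gamma> xs @ [\<gamma> (last xs) y]"
  by (induction \<gamma> xs rule: edge_list.induct) auto

lemma edge_list_append: "edge_list \<gamma> (xs @ y # zs) = edge_list \<gamma> (xs @ [y]) @ edge_list \<gamma> (y # zs)"
proof (induction \<gamma> xs rule: edge_list.induct)
  case ("2_2" \<gamma> v) then show ?case by (cases zs) auto
qed auto

lemma edge_list_length: "length (edge_list \<gamma> us) = length us - 1"
  by (induction \<gamma> us rule: edge_list.induct) auto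

text \<open>Along a list without repetitions two edges share an end only if they are
  consecutive.\<close>

lemma ipath_edge_list:
  assumes S: "\<And>x y. (x, y) \<in> path_arcs us \<Longrightarrow> \<gamma> x y \<in> V \<and> S (\<gamma> x y) = {x, y}"
    and adj: "\<And>g h. g \<in> V \<Longrightarrow> h \<in> V \<Longrightarrow> g \<noteq> h \<Longrightarrow> g \<sim> h \<longleftrightarrow> S g \<inter> S h \<noteq> {}"
    and "distinct us"
  shows "ipath (edge_list \<gamma> us)"
  using assms(1,3)
proof (induction \<gamma> us rule: edge_list.induct)
  case (1 \<gamma> x y zs)
  have IH: "ipath (edge_list \<gamma> (y # zs))" using 1 by auto
  have xy: "\<gamma> x y \<in> V" "S (\<gamma> x y) = {x, y}" using "1.prems"(1)[of x y] by auto
  have later: "h \<in> V \<and> x \<notin> S h \<and> \<gamma> x y \<noteq> h" if m: "h \<in> set (edge_list \<gamma> (y # zs))" for h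
  proof -
    obtain a b where ab: "h = \<gamma> a b" "(a, b) \<in> path_arcs (y # zs)" using edge_list_in[OF m] by blast
    then have "a \<in> set (y # zs)" "b \<in> set (y # zs)" using path_arcs_subset[of "y # zs"] by auto
    moreover have "h \<in> V" "S h = {a, b}" using "1.prems"(1)[of a b] ab by auto
    ultimately show ?thesis using xy "1.prems"(2) by auto
  qed
  have far: "y \<notin> S h" if h: "h \<in> set (tl (edge_list \<gamma> (y # zs)))" for h
  proof -
    obtain z ws where zs: "zs = z # ws" using h by (cases zs) auto
    then have "h \<in> set (edge_list \<gamma> (z # ws))" using h by simp
    then obtain a b where ab: "h = \<gamma> a b" "(a, b) \<in> path_arcs (z # ws)" using edge_list_in by blast
    then have "a \<in> set (z # ws)" "b \<in> set (z # ws)" using path_arcs_subset[of "z # ws"] by auto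
    moreover have "S h = {a, b}" using "1.prems"(1)[of a b] ab zs by auto
    ultimately show ?thesis using "1.prems"(2) zs by auto
  qed
  show ?case unfolding edge_list.simps ipath.simps
  proof (intro conjI IH impI ballI)
    show "\<gamma> x y \<notin> set (edge_list \<gamma> (y # zs))" using later by blast
    assume "edge_list \<gamma> (y # zs) \<noteq> []"
    then obtain z ws where zs: "zs = z # ws" by (cases zs) auto
    have "\<gamma> y z \<in> V" "S (\<gamma> y z) = {y, z}" using "1.prems"(1)[of y z] zs by auto
    then show "\<gamma> x y \<sim> hd (edge_list \<gamma> (y # zs))" using adj[of "\<gamma> x y" "\<gamma> y z"] xy later[of "\<gamma> y z"] zs by auto
  next
    fix h assume h: "h \<in> set (tl (edge_list \<gamma> (y # zs)))"
    then have "h \<in> set (edge_list \<gamma> (y # zs))" by (cases "edge_list \<gamma> (y # zs)") auto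
    then show "\<not> \<gamma> x y \<sim> h" using adj[of "\<gamma> x y" h] xy later[of h] far[OF h] by auto
  qed
qed auto

end

context ISK4_wheel_free_rel begin

text \<open>The edges of the cycle form a chordless cycle of the graph. The chord shares the end
  \<open>a\<close> with both cycle edges at \<open>a\<close>, and the end \<open>b\<close> with the
  edge from \<open>c'\<close> to \<open>b\<close>: three neighbours on a rim.\<close>

lemma rim_no_chord:
  assumes card2: "\<And>g. g \<in> V \<Longrightarrow> card (S g) = 2" and inj: "inj_on S V"
    and adj: "\<And>g h. g \<in> V \<Longrightarrow> h \<in> V \<Longrightarrow> g \<noteq> h \<Longrightarrow> g \<sim> h \<longleftrightarrow> S g \<inter> S h \<noteq> {}"
    and cyc: "distinct us" "3 \<le> length us" "path_arcs (us @ [hd us]) \<subseteq> parcs (root_graph S V)"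
    and ab: "a \<in> set us" "b \<in> set us" "(a, b) \<in> parcs (root_graph S V)"
  shows "(a, b) \<in> path_arcs (us @ [hd us])"
proof (rule ccontr)
  assume nab: "(a, b) \<notin> path_arcs (us @ [hd us])"
  have aneb: "a \<noteq> b" using ab(3) unfolding root_graph_def by auto
  define \<gamma> where "\<gamma> x y = (SOME g. g \<in> V \<and> S g = {x, y})" for x y
  have \<gamma>: "\<gamma> x y \<in> V \<and> S (\<gamma> x y) = {x, y}" if "(x, y) \<in> parcs (root_graph S V)" for x y
    unfolding \<gamma>_def by (rule someI_ex) (use that in \<open>auto simp: root_graph_def\<close>)
  obtain as bs where us: "us = as @ a # bs" using ab(1) by (meson split_list)
  \<comment> \<open>The cycle rotated to start at \<open>a\<close>. As the chord is not a cycle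
    edge, \<open>b\<close> is neither the second nor the last vertex of this list.\<close>
  let ?vs = "a # bs @ as"
  have vs: "distinct ?vs" "set ?vs = set us" "length ?vs = length us" using cyc(1) us by auto
  have arcs: "path_arcs (?vs @ [a]) = path_arcs (us @ [hd us])"
  proof (cases as)
    case Nil then show ?thesis using us by simp
  next
    case (Cons c cs)
    have "path_arcs (?vs @ [a]) = path_arcs (a # bs @ [c]) \<union> path_arcs (c # cs @ [a])"
      using path_arcs_append[of "a # bs" c "cs @ [a]"] Cons by simp
    moreover have "path_arcs (us @ [hd us]) = path_arcs (c # cs @ [a]) \<union> path_arcs (a # bs @ [c])"
      using path_arcs_append[of "c # cs" a "bs @ [c]"] Cons us by simp
    ultimately show ?thesis by blast
  qed
  have "b \<in> set (bs @ as)" using ab(2) aneb us by auto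
  then obtain cs ds where cd: "bs @ as = cs @ b # ds" by (meson split_list)
  have "?vs @ [a] = a # cs @ b # ds @ [a]" using cd by simp
  then have nab': "(a, b) \<notin> path_arcs (a # cs @ b # ds @ [a])" using nab arcs by simp
  have "cs \<noteq> []" using nab' by auto
  then obtain c cs' where cs: "cs = c # cs'" by (meson neq_Nil_conv)
  have "ds \<noteq> []"
  proof
    assume "ds = []"
    then have "path_arcs (a # cs @ b # ds @ [a]) = path_arcs (a # cs @ [b]) \<union> path_arcs [b, a]"
      using path_arcs_append[of "a # cs" b "[a]"] by simp
    then show False using nab' by auto
  qed
  then obtain ds' l where ds: "ds = ds' @ [l]" by (metis append_butlast_last_id)
  have vs_eq: "?vs = a # c # cs' @ b # ds' @ [l]" using cd cs ds by simp
  let ?ws = "a # c # cs' @ b # ds' @ [l]"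
  have dw: "distinct ?ws" using vs(1) vs_eq by simp
  have sub: "path_arcs (?ws @ [a]) \<subseteq> parcs (root_graph S V)" using arcs cyc(3) vs_eq by simp
  have sub': "path_arcs ?ws \<subseteq> path_arcs (?ws @ [a])" using path_arcs_snoc[of ?ws a] by blast
  have la: "(l, a) \<in> path_arcs (?ws @ [a])" using path_arcs_snoc[of ?ws a] by simp
  have S: "\<gamma> x y \<in> V \<and> S (\<gamma> x y) = {x, y}" if "(x, y) \<in> path_arcs (?ws @ [a])" for x y
    using \<gamma> that sub by blast
  let ?gs = "edge_list \<gamma> ?ws"
  have ip: "ipath ?gs" by (rule ipath_edge_list[where S = S and V = V]) (use S sub' dw adj in blast)+
  have gV: "set ?gs \<subseteq> V" using edge_list_in[of _ \<gamma> ?ws] S sub' by blast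
  define k where "k = \<gamma> l a"
  have k: "k \<in> V" "S k = {l, a}" using S[OF la] unfolding k_def by auto
  have hdg: "hd ?gs = \<gamma> a c" by simp
  have ac: "\<gamma> a c \<in> V" "S (\<gamma> a c) = {a, c}" using S[of a c] by auto
  let ?l' = "last (a # c # cs' @ b # ds')"
  have lastg: "?gs = edge_list \<gamma> (a # c # cs' @ b # ds') @ [\<gamma> ?l' l]"
    using edge_list_last[of "a # c # cs' @ b # ds'" \<gamma> l] by simp
  have l'l: "(?l', l) \<in> path_arcs ?ws" using path_arcs_snoc[of "a # c # cs' @ b # ds'" l] by simp
  have lastS: "last ?gs \<in> V" "S (last ?gs) = {?l', l}" using S[of ?l' l] l'l sub' unfolding lastg by auto
  have other: "a \<notin> S g \<or> g = hd ?gs" "l \<notin> S g \<or> g = last ?gs" if g: "g \<in> set ?gs" for g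
  proof -
    have "g = \<gamma> a c \<or> g \<in> set (edge_list \<gamma> (c # cs' @ b # ds' @ [l]))" using g by auto
    moreover have "a \<notin> S g" if m: "g \<in> set (edge_list \<gamma> (c # cs' @ b # ds' @ [l]))"
    proof -
      obtain x y where xy: "g = \<gamma> x y" "(x, y) \<in> path_arcs (c # cs' @ b # ds' @ [l])" using edge_list_in[OF m] by blast
      have "(x, y) \<in> path_arcs ?ws" using xy(2) by auto
      then have "S g = {x, y}" using S sub' xy(1) by blast
      moreover have "x \<noteq> a" "y \<noteq> a" using path_arcs_subset[of "c # cs' @ b # ds' @ [l]"] xy(2) dw by auto
      ultimately show ?thesis by auto
    qed
    ultimately show "a \<notin> S g \<or> g = hd ?gs" by auto
    have "g = last ?gs \<or> g \<in> set (edge_list \<gamma> (a # c # cs' @ b # ds'))" using g unfolding lastg by auto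
    moreover have "l \<notin> S g" if m: "g \<in> set (edge_list \<gamma> (a # c # cs' @ b # ds'))"
    proof -
      obtain x y where xy: "g = \<gamma> x y" "(x, y) \<in> path_arcs (a # c # cs' @ b # ds')" using edge_list_in[OF m] by blast
      have "(x, y) \<in> path_arcs ?ws" using xy(2) path_arcs_snoc[of "a # c # cs' @ b # ds'" l] by auto
      then have "S g = {x, y}" using S sub' xy(1) by blast
      moreover have "x \<noteq> l" "y \<noteq> l" using path_arcs_subset[of "a # c # cs' @ b # ds'"] xy(2) dw by auto
      ultimately show ?thesis by auto
    qed
    ultimately show "l \<notin> S g \<or> g = last ?gs" by auto
  qed
  have al: "a \<noteq> l" "c \<noteq> l" "a \<noteq> ?l'" using dw by (auto split: if_splits)
  have kg: "k \<notin> set ?gs"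
  proof
    assume "k \<in> set ?gs"
    then have "k = hd ?gs" using other(1)[of k] k by auto
    then show False using k ac hdg al dw by (auto simp: doubleton_eq_iff)
  qed
  have H: "hole_at k ?gs" unfolding hole_at_def
  proof (intro conjI ip kg ballI)
    show "2 \<le> length ?gs" by (simp add: edge_list_length)
    fix g assume g: "g \<in> set ?gs"
    then have "k \<sim> g \<longleftrightarrow> a \<in> S g \<or> l \<in> S g" using adj[of k g] k gV kg by auto
    then show "k \<sim> g \<longleftrightarrow> g = hd ?gs \<or> g = last ?gs" using other[OF g] ac lastS unfolding hdg by auto
  qed
  define h where "h = \<gamma> a b"
  have h: "h \<in> V" "S h = {a, b}" using \<gamma>[OF ab(3)] unfolding h_def by auto
  have bl: "b \<noteq> l" "b \<noteq> c" using dw by auto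
  have hk: "h \<noteq> k" using h k bl aneb by (auto simp: doubleton_eq_iff)
  have hg: "h \<notin> set ?gs"
  proof
    assume "h \<in> set ?gs"
    then have "h = hd ?gs" using other(1)[of h] h by auto
    then show False using h ac hdg bl aneb by (auto simp: doubleton_eq_iff)
  qed
  define c' where "c' = last (c # cs')"
  have cb: "(c', b) \<in> path_arcs (c # cs' @ [b])" using path_arcs_snoc[of "c # cs'" b] unfolding c'_def by simp
  have "path_arcs ?ws = path_arcs (a # c # cs' @ [b]) \<union> path_arcs (b # ds' @ [l])"
    using path_arcs_append[of "a # c # cs'" b "ds' @ [l]"] by simp
  then have cb': "(c', b) \<in> path_arcs ?ws" using cb by auto
  have "\<gamma> c' b \<in> set (edge_list \<gamma> (a # c # cs' @ [b]))"
    using edge_list_last[of "a # c # cs'" \<gamma> b] unfolding c'_def by simp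
  then have in3: "\<gamma> c' b \<in> set ?gs" using edge_list_append[of \<gamma> "a # c # cs'" b "ds' @ [l]"] by auto
  have g3: "\<gamma> c' b \<in> V" "S (\<gamma> c' b) = {c', b}" using S[of c' b] cb' sub' by blast+
  have c'a: "c' \<noteq> a" using dw unfolding c'_def by (auto split: if_splits)
  have in1: "\<gamma> a c \<in> set ?gs" by simp
  show False
  proof (rule wheelD[OF H, of h k "\<gamma> a c" "\<gamma> c' b"])
    show "insert h (insert k (set ?gs)) \<subseteq> V" using h k gV by auto
    show "h \<notin> insert k (set ?gs)" using hk hg by auto
    show "{k, \<gamma> a c, \<gamma> c' b} \<subseteq> insert k (set ?gs)" using in1 in3 by blast
    have "\<gamma> a c \<noteq> \<gamma> c' b" using ac(2) g3(2) c'a aneb by (auto simp: doubleton_eq_iff)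
    then show "distinct [k, \<gamma> a c, \<gamma> c' b]" using kg in1 in3 by auto
    show "h \<sim> k" using adj[OF h(1) k(1) hk] h k by auto
    show "h \<sim> \<gamma> a c" using adj[OF h(1) ac(1)] h ac hg in1 by auto
    show "h \<sim> \<gamma> c' b" using adj[OF h(1) g3(1)] h g3 hg in3 by auto
  qed
qed

end

section \<open>Maximal cliques as vertices of the root graph\<close>

context no_clique_cutset_rel begin

text \<open>By \<open>common_nbr_unique\<close> this is the maximal clique containing the edge \<open>g h\<close>.\<close>

definition clq :: "'a \<Rightarrow> 'a \<Rightarrow> 'a set" where
  "clq g h = {g, h} \<union> {x. x \<sim> g \<and> x \<sim> h}"

lemma clq_commute: "clq g h = clq h g"
  unfolding clq_def by auto

lemma clq_third:
  assumes "g \<sim> h" "c \<sim> g" "c \<sim> h"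
  shows "clq g h = {g, h, c}" "clq g c = {g, h, c}"
proof -
  have "x = c" if "x \<sim> g" "x \<sim> h" for x using common_nbr_unique[OF assms(1) that assms(2,3)] .
  then have "x \<sim> g \<and> x \<sim> h \<longleftrightarrow> x = c" for x using assms(2,3) by metis
  then show "clq g h = {g, h, c}" unfolding clq_def by auto
  have "x = h" if "x \<sim> g" "x \<sim> c" for x
    by (rule common_nbr_unique[OF adj_sym[OF assms(2)] that adj_sym[OF assms(1)] adj_sym[OF assms(3)]])
  then have "x \<sim> g \<and> x \<sim> c \<longleftrightarrow> x = h" for x using adj_sym[OF assms(1)] adj_sym[OF assms(3)] by metis
  then show "clq g c = {g, h, c}" unfolding clq_def by auto
qed

text \<open>An edge lies in at most one triangle, so any edge of the clique determines it. Different
  cliques thus share at most one vertex, as different vertices of a simple root graph share at most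
  one edge.\<close>

lemma clq_eq:
  assumes "g \<sim> h" "a \<in> clq g h" "b \<in> clq g h" "a \<noteq> b"
  shows "clq a b = clq g h" "a \<sim> b"
proof -
  have "clq a b = clq g h \<and> a \<sim> b"
  proof (cases "{a, b} = {g, h}")
    case True
    then show ?thesis using clq_commute[of g h] assms(1) adj_sym by (auto simp: doubleton_eq_iff)
  next
    case False
    then obtain c where c: "c \<sim> g" "c \<sim> h" "c = a \<or> c = b" using assms(2-4) unfolding clq_def by auto
    have gh: "clq g h = {g, h, c}" "clq g c = {g, h, c}" by (rule clq_third[OF assms(1) c(1,2)])+
    have hc: "clq h c = {g, h, c}" using clq_third(2)[OF adj_sym[OF assms(1)] c(2,1)] by (simp add: insert_commute)
    have "a \<in> {g, h, c}" "b \<in> {g, h, c}" using assms(2,3) gh by auto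
    moreover have "clq c g = {g, h, c}" "clq c h = {g, h, c}" "clq h g = {g, h, c}"
      using gh hc clq_commute by metis+
    moreover have "g \<sim> c" "h \<sim> c" "h \<sim> g" using c(1,2) assms(1) adj_sym by blast+
    ultimately show ?thesis using gh hc assms(1,4) c(1,2) by auto
  qed
  then show "clq a b = clq g h" "a \<sim> b" by auto
qed

lemma card_clq: "g \<sim> h \<Longrightarrow> card (clq g h) \<le> 3 \<and> finite (clq g h)"
proof (cases "\<exists>c. c \<sim> g \<and> c \<sim> h")
  case True
  assume "g \<sim> h"
  obtain c where "c \<sim> g" "c \<sim> h" using True by blast
  then show ?thesis using clq_third[OF \<open>g \<sim> h\<close>, of c] by (simp add: card_insert_if)
next
  case False
  assume "g \<sim> h"
  have "clq g h = {g, h}" using False unfolding clq_def by auto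
  then show ?thesis by (simp add: card_insert_if)
qed

text \<open>Each of these cliques contains an edge at \<open>g\<close>; an isolated vertex has
  none.\<close>

definition cliques_at :: "'a \<Rightarrow> 'a set set" where
  "cliques_at g = {clq g h | h. g \<sim> h}"

lemma cliques_atD:
  assumes "K \<in> cliques_at g"
  shows "g \<in> K" "card K \<le> 3" "finite K" "\<And>h. h \<in> K \<Longrightarrow> h \<noteq> g \<Longrightarrow> g \<sim> h \<and> K = clq g h"
proof -
  obtain x where x: "g \<sim> x" "K = clq g x" using assms unfolding cliques_at_def by blast
  show g: "g \<in> K" unfolding x clq_def by simp
  show "card K \<le> 3" "finite K" using card_clq x by auto
  fix h assume h: "h \<in> K" "h \<noteq> g"
  show "g \<sim> h \<and> K = clq g h" using clq_eq[OF x(1), of g h] g h x(2) by auto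
qed

text \<open>Neighbours of \<open>g\<close> in different cliques are distinct and not adjacent, so
  three cliques at \<open>g\<close> would give a claw.\<close>

lemma card_cliques_at:
  assumes claw_free: "\<And>v n1 n2 n3. v \<sim> n1 \<Longrightarrow> v \<sim> n2 \<Longrightarrow> v \<sim> n3 \<Longrightarrow> distinct [n1, n2, n3] \<Longrightarrow>
      \<not> n1 \<sim> n2 \<Longrightarrow> \<not> n1 \<sim> n3 \<Longrightarrow> \<not> n2 \<sim> n3 \<Longrightarrow> False"
  shows "finite (cliques_at g)" "card (cliques_at g) \<le> 2"
proof -
  have "{h. g \<sim> h} \<subseteq> V" using adj_V adj_sym by blast
  then have "finite {h. g \<sim> h}" using finite_V finite_subset by blast
  moreover have "cliques_at g = clq g ` {h. g \<sim> h}" unfolding cliques_at_def by auto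
  ultimately show fin: "finite (cliques_at g)" by simp
  show "card (cliques_at g) \<le> 2"
  proof (rule ccontr)
    assume "\<not> ?thesis"
    then obtain K1 K2 K3 where K: "{K1, K2, K3} \<subseteq> cliques_at g" "distinct [K1, K2, K3]"
      using card_3_obtain[of "cliques_at g"] by (metis not_less_eq_eq numeral_2_eq_2 numeral_3_eq_3)
    have ex: "\<exists>h. g \<sim> h \<and> K = clq g h" if "K \<in> cliques_at g" for K using that unfolding cliques_at_def by blast
    obtain h1 h2 h3 where h: "g \<sim> h1" "g \<sim> h2" "g \<sim> h3" "K1 = clq g h1" "K2 = clq g h2" "K3 = clq g h3"
      using ex[of K1] ex[of K2] ex[of K3] K(1) by auto
    have far: "x \<noteq> y \<and> \<not> x \<sim> y" if "g \<sim> x" "g \<sim> y" "clq g x \<noteq> clq g y" for x y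
    proof
      show "x \<noteq> y" using that by auto
      show "\<not> x \<sim> y"
      proof
        assume "x \<sim> y"
        then show False using clq_third[OF that(1), of y] that adj_sym by auto
      qed
    qed
    have "clq g h1 \<noteq> clq g h2" "clq g h1 \<noteq> clq g h3" "clq g h2 \<noteq> clq g h3" using K(2) h(4-6) by auto
    note f = far[OF h(1,2) this(1)] far[OF h(1,3) this(2)] far[OF h(2,3) this(3)]
    then have "distinct [h1, h2, h3]" by simp
    from claw_free[OF h(1-3) this] show False using f by blast
  qed
qed

text \<open>Distinct vertices share at most one end, the clique spanned by their edge. This gives
  the adjacency condition and, as every vertex has two ends, injectivity. An end belongs to at most
  three vertices because a clique has at most three elements and a padding end only one
  owner.\<close>

lemma claw_free_root:
  assumes claw_free: "\<And>v n1 n2 n3. v \<sim> n1 \<Longrightarrow> v \<sim> n2 \<Longrightarrow> v \<sim> n3 \<Longrightarrow> distinct [n1, n2, n3] \<Longrightarrow>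
      \<not> n1 \<sim> n2 \<Longrightarrow> \<not> n1 \<sim> n3 \<Longrightarrow> \<not> n2 \<sim> n3 \<Longrightarrow> False"
  shows "\<exists>S :: 'a \<Rightarrow> nat set. (\<forall>g\<in>V. card (S g) = 2) \<and> inj_on S V \<and>
    (\<forall>g\<in>V. \<forall>h\<in>V. g \<noteq> h \<longrightarrow> (g \<sim> h \<longleftrightarrow> S g \<inter> S h \<noteq> {})) \<and> (\<forall>x. card {g \<in> V. x \<in> S g} \<le> 3)"
proof -
  have fin: "finite (cliques_at g)" for g by (rule card_cliques_at(1), rule claw_free)
  have le2: "card (cliques_at g) \<le> 2" for g by (rule card_cliques_at(2), rule claw_free)
  txt \<open>The ends of \<open>g\<close> are the cliques through \<open>g\<close>, padded to two by private end vertices of degree one.\<close>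
  define R where "R g = (\<lambda>K. (K, 0 :: nat)) ` cliques_at g \<union> (if card (cliques_at g) \<le> 1 then {({g}, 1)} else {})
    \<union> (if card (cliques_at g) = 0 then {({g}, 2)} else {})" for g
  have finR: "finite (R g)" for g unfolding R_def using fin by auto
  have card2: "card (R g) = 2" for g
  proof -
    have c: "card ((\<lambda>K. (K, 0 :: nat)) ` cliques_at g) = card (cliques_at g)"
      by (rule card_image) (auto intro: inj_onI)
    consider "card (cliques_at g) = 0" | "card (cliques_at g) = 1" | "card (cliques_at g) = 2" using le2[of g] by linarith
    then show ?thesis
    proof cases
      case 1
      then have "cliques_at g = {}" using fin by simp
      then show ?thesis unfolding R_def by simp
    next
      case 2
      have "R g = insert ({g}, 1) ((\<lambda>K. (K, 0 :: nat)) ` cliques_at g)" unfolding R_def using 2 by auto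
      then show ?thesis using c 2 fin[of g] by (auto simp: card_insert_if)
    next
      case 3
      then show ?thesis unfolding R_def using c by simp
    qed
  qed
  have Rmem: "(K, i) \<in> R g \<Longrightarrow> (i = 0 \<and> K \<in> cliques_at g) \<or> (i > 0 \<and> K = {g})" for K i g
    unfolding R_def by (auto split: if_splits)
  have common: "\<rho> = (clq g h, 0) \<and> g \<sim> h" if "\<rho> \<in> R g" "\<rho> \<in> R h" "g \<noteq> h" for \<rho> g h
  proof -
    obtain K i where r: "\<rho> = (K, i)" by (cases \<rho>)
    have "i = 0" "K \<in> cliques_at g" "K \<in> cliques_at h" using Rmem[of K i g] Rmem[of K i h] that r by auto
    then show ?thesis using cliques_atD(1)[of K h] cliques_atD(4)[of K g h] that(3) r by auto
  qed
  have meet: "R g \<inter> R h \<noteq> {} \<longleftrightarrow> g \<sim> h" if "g \<noteq> h" for g h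
  proof
    assume "g \<sim> h"
    then have "clq g h \<in> cliques_at g" "clq g h \<in> cliques_at h"
      unfolding cliques_at_def using clq_commute[of g h] adj_sym by blast+
    then have "(clq g h, 0) \<in> R g" "(clq g h, 0) \<in> R h" unfolding R_def by auto
    then show "R g \<inter> R h \<noteq> {}" by blast
  qed (use common that in blast)
  have inj: "g = h" if "R g = R h" for g h
  proof (rule ccontr)
    assume ne: "g \<noteq> h"
    have "R g \<subseteq> {(clq g h, 0)}" using common[of _ g h] that ne by blast
    then have "card (R g) \<le> 1" using card_mono[of "{(clq g h, 0 :: nat)}" "R g"] by simp
    then show False using card2[of g] by simp
  qed
  have deg: "card {g \<in> V. \<rho> \<in> R g} \<le> 3" for \<rho>
  proof -
    obtain K i where r: "\<rho> = (K, i)" by (cases \<rho>)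
    show ?thesis
    proof (cases "\<exists>g. \<rho> \<in> R g")
      case True
      then obtain g where g: "(K, i) \<in> R g" using r by blast
      have "\<exists>K'. {g \<in> V. \<rho> \<in> R g} \<subseteq> K' \<and> finite K' \<and> card K' \<le> 3"
      proof (cases "i = 0")
        case True
        then have "K \<in> cliques_at g" using Rmem[OF g] by simp
        then have "finite K" "card K \<le> 3" using cliques_atD(2,3) by blast+
        moreover have "{g \<in> V. \<rho> \<in> R g} \<subseteq> K"
        proof
          fix g' assume "g' \<in> {g \<in> V. \<rho> \<in> R g}"
          then have "K \<in> cliques_at g'" using Rmem[of K i g'] r True by simp
          then show "g' \<in> K" by (rule cliques_atD(1))
        qed
        ultimately show ?thesis by blast
      next
        case False
        have "{g \<in> V. \<rho> \<in> R g} \<subseteq> {g}" using Rmem[of K i] Rmem[OF g] r False by auto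
        then show ?thesis by (intro exI[of _ "{g}"]) simp
      qed
      then show ?thesis using card_mono by (meson order_trans)
    qed simp
  qed
  have finU: "finite (\<Union>(R ` V))" using finR finite_V by simp
  \<comment> \<open>The ends are renumbered because the root graph has to live on the natural
    numbers.\<close>
  obtain \<iota> :: "'a set \<times> nat \<Rightarrow> nat" and n where "\<iota> ` \<Union>(R ` V) = {i. i < n}" and \<iota>: "inj_on \<iota> (\<Union>(R ` V))"
    using finite_imp_inj_to_nat_seg[OF finU] by metis
  define S where "S g = \<iota> ` R g" for g
  have S_eq: "\<iota> \<rho> \<in> S g \<longleftrightarrow> \<rho> \<in> R g" if "\<rho> \<in> \<Union>(R ` V)" "g \<in> V" for \<rho> g
    unfolding S_def using \<iota> that by (auto simp: inj_on_eq_iff inj_on_def)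
  have sub: "R g \<subseteq> \<Union>(R ` V)" if "g \<in> V" for g using that by blast
  show ?thesis
  proof (intro exI[of _ S] conjI ballI allI impI)
    fix g assume "g \<in> V"
    then show "card (S g) = 2" unfolding S_def using card_image[OF inj_on_subset[OF \<iota> sub]] card2 by simp
  next
    show "inj_on S V"
    proof (rule inj_onI)
      fix g h assume gh: "g \<in> V" "h \<in> V" "S g = S h"
      then have "R g = R h" unfolding S_def using inj_on_image_eq_iff[OF \<iota> sub sub] by blast
      then show "g = h" by (rule inj)
    qed
  next
    fix g h assume gh: "g \<in> V" "h \<in> V" "g \<noteq> h"
    have "S g \<inter> S h = \<iota> ` (R g \<inter> R h)" unfolding S_def using inj_on_image_Int[OF \<iota> sub[OF gh(1)] sub[OF gh(2)]] by simp
    then show "g \<sim> h \<longleftrightarrow> S g \<inter> S h \<noteq> {}" using meet[OF gh(3)] by auto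
  next
    fix x
    show "card {g \<in> V. x \<in> S g} \<le> 3"
    proof (cases "x \<in> \<iota> ` \<Union>(R ` V)")
      case True
      then obtain \<rho> where \<rho>: "\<rho> \<in> \<Union>(R ` V)" "x = \<iota> \<rho>" by blast
      have "{g \<in> V. x \<in> S g} = {g \<in> V. \<rho> \<in> R g}" using S_eq[OF \<rho>(1)] \<rho>(2) by auto
      then show ?thesis using deg by simp
    next
      case False
      then have e: "{g \<in> V. x \<in> S g} = {}" unfolding S_def by auto
      show ?thesis unfolding e by simp
    qed
  qed
qed

end

section \<open>Translation to the digraph notions of the theorem\<close>

text \<open>Subdividing an edge at a branch vertex exchanges one neighbour for the new vertex, so
  the degree remains three. The four branch vertices thus obstruct a graph with at most two vertices
  of degree above two.\<close>

lemma K4_subdivision_degree_three: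
  assumes "K4_subdivision H"
  shows "\<exists>B \<subseteq> pverts H. card B = 4 \<and> (\<forall>b\<in>B. finite {y. (b, y) \<in> parcs H} \<longrightarrow> 3 \<le> card {y. (b, y) \<in> parcs H})"
proof -
  obtain K where K: "complete_digraph 4 (with_proj K)" "subdivision_pair K H"
    using assms unfolding K4_subdivision_def by blast
  have Kd: "finite (pverts K)" "card (pverts K) = 4" "parcs K = {(u, v). (u, v) \<in> pverts K \<times> pverts K \<and> u \<noteq> v}"
    using K(1) unfolding complete_digraph_pair_def by auto
  \<comment> \<open>The induction also carries symmetry, which supplies the reverse arc, and that
    arcs stay within the vertex set, which makes \<open>w\<close> a new neighbour.\<close>
  have "pverts K \<subseteq> pverts H \<and> (\<forall>b\<in>pverts K. finite {y. (b, y) \<in> parcs H} \<and> card {y. (b, y) \<in> parcs H} = 3)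
      \<and> parcs H \<subseteq> pverts H \<times> pverts H \<and> sym (parcs H)"
    using K(2)
  proof (induction rule: subdivision_pair_induct)
    case base
    have "finite {y. (b, y) \<in> parcs K} \<and> card {y. (b, y) \<in> parcs K} = 3" if "b \<in> pverts K" for b
    proof -
      have "{y. (b, y) \<in> parcs K} = pverts K - {b}" using Kd(3) that by auto
      then show ?thesis using Kd(1,2) that by simp
    qed
    moreover have "sym (parcs K)" using Kd(3) by (auto simp: sym_def)
    ultimately show ?case using Kd(3) by auto
  next
    case (divide e w H)
    obtain u v where e: "e = (u, v)" by (cases e)
    let ?H = "subdivide H e w"
    have H: "pverts ?H = insert w (pverts H)" "parcs ?H = parcs H - {(u, v), (v, u)} \<union> {(u, w), (w, u), (w, v), (v, w)}"
      unfolding e by (simp_all add: subdivide.simps)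
    have IH: "pverts K \<subseteq> pverts H" "\<And>b. b \<in> pverts K \<Longrightarrow> finite {y. (b, y) \<in> parcs H} \<and> card {y. (b, y) \<in> parcs H} = 3"
      "parcs H \<subseteq> pverts H \<times> pverts H" "sym (parcs H)" using divide by blast+
    have uv: "(u, v) \<in> parcs H" "(v, u) \<in> parcs H" using divide(1) e IH(4) by (auto dest: symD)
    have w: "w \<notin> pverts H" using divide(2) .
    have uvH: "u \<in> pverts H" "v \<in> pverts H" using uv(1) IH(3) by auto
    have deg: "finite {y. (b, y) \<in> parcs ?H} \<and> card {y. (b, y) \<in> parcs ?H} = 3" if b: "b \<in> pverts K" for b
    proof -
      let ?N = "{y. (b, y) \<in> parcs H}"
      have bw: "b \<noteq> w" using b IH(1) w by auto
      have wN: "w \<notin> ?N" using IH(3) w by auto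
      have swap: "finite (insert w (?N - {x})) \<and> card (insert w (?N - {x})) = 3" if "x \<in> ?N" for x
      proof -
        have "card (?N - {x}) = 2" using IH(2)[OF b] that by simp
        then show ?thesis using IH(2)[OF b] wN by simp
      qed
      consider "b = u" "b \<noteq> v" | "b = v" "b \<noteq> u" | "b \<noteq> u" "b \<noteq> v" | "b = u" "b = v" by blast
      then show ?thesis
      proof cases
        case 1
        then have "{y. (b, y) \<in> parcs ?H} = insert w (?N - {v})" unfolding H using bw by auto
        then show ?thesis using swap[of v] uv 1 by simp
      next
        case 2
        then have "{y. (b, y) \<in> parcs ?H} = insert w (?N - {u})" unfolding H using bw by auto
        then show ?thesis using swap[of u] uv 2 by simp
      next
        case 3
        then have "{y. (b, y) \<in> parcs ?H} = ?N" unfolding H using bw by auto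
        then show ?thesis using IH(2)[OF b] by simp
      next
        case 4
        then have "{y. (b, y) \<in> parcs ?H} = insert w (?N - {u})" unfolding H using bw by auto
        then show ?thesis using swap[of u] uv 4 by simp
      qed
    qed
    have "sym (parcs ?H)" using IH(4) unfolding H by (auto simp: sym_def)
    moreover have "parcs ?H \<subseteq> pverts ?H \<times> pverts ?H" unfolding H using IH(3) uvH by auto
    ultimately show ?case using deg IH(1) H(1) by auto
  qed
  then show ?thesis using Kd(2) by (intro exI[of _ "pverts K"]) simp
qed

lemma (in pair_graph) line_graph_of_root:
  assumes card2: "\<And>g. g \<in> pverts G \<Longrightarrow> card (S g) = 2" and inj: "inj_on S (pverts G)"
    and adj: "\<And>g h. g \<in> pverts G \<Longrightarrow> h \<in> pverts G \<Longrightarrow> g \<noteq> h \<Longrightarrow> (g, h) \<in> parcs G \<longleftrightarrow> S g \<inter> S h \<noteq> {}"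
  shows "digraph_iso (with_proj (line_graph (root_graph S (pverts G)))) (with_proj G)"
proof -
  let ?V = "pverts G"
  let ?L = "line_graph (root_graph S ?V)"
  have U: "undirected_edges (root_graph S ?V) = S ` ?V" by (rule undirected_edges_root_graph[OF card2])
  have LV: "pverts ?L = S ` ?V" unfolding line_graph_def U by simp
  have LA: "parcs ?L = {(e, f). e \<in> S ` ?V \<and> f \<in> S ` ?V \<and> e \<noteq> f \<and> e \<inter> f \<noteq> {}}"
    unfolding line_graph_def U by simp
  define T where "T = the_inv_into ?V S"
  have T: "T (S g) = g" if "g \<in> ?V" for g unfolding T_def using the_inv_into_f_f[OF inj that] .
  define f where "f = \<lparr>iso_verts = T, iso_arcs = map_prod T T, iso_head = snd, iso_tail = fst\<rparr>"
  have wf: "wf_digraph (with_proj ?L)" unfolding wf_digraph_def using LV LA by auto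
  have injT: "inj_on T (S ` ?V)" using T by (auto intro!: inj_onI)
  have "inj_on (map_prod T T) (parcs ?L)"
  proof (rule inj_on_subset[of _ "(S ` ?V) \<times> (S ` ?V)"])
    show "inj_on (map_prod T T) ((S ` ?V) \<times> (S ` ?V))" by (rule map_prod_inj_on[OF injT injT])
    show "parcs ?L \<subseteq> (S ` ?V) \<times> (S ` ?V)" using LA by auto
  qed
  then have iso: "pre_digraph.digraph_isomorphism (with_proj ?L) f"
    unfolding pre_digraph.digraph_isomorphism_def f_def using wf injT LV by auto
  have TV: "T ` (S ` ?V) = ?V" using T by force
  have "map_prod T T ` parcs ?L = parcs G"
  proof
    show "map_prod T T ` parcs ?L \<subseteq> parcs G"
    proof
      fix e assume "e \<in> map_prod T T ` parcs ?L"
      then obtain g h where gh: "e = (T (S g), T (S h))" "g \<in> ?V" "h \<in> ?V" "S g \<noteq> S h" "S g \<inter> S h \<noteq> {}"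
        unfolding LA by auto
      then have "e = (g, h)" "g \<noteq> h" using T by auto
      then show "e \<in> parcs G" using adj gh by blast
    qed
    show "parcs G \<subseteq> map_prod T T ` parcs ?L"
    proof
      fix e assume e: "e \<in> parcs G"
      obtain g h where gh: "e = (g, h)" by (cases e)
      have V: "g \<in> ?V" "h \<in> ?V" "g \<noteq> h" using e gh in_arcsD1 in_arcsD2 no_loops' by blast+
      then have "S g \<noteq> S h" "S g \<inter> S h \<noteq> {}" using inj adj e gh by (auto dest: inj_onD)
      then have "(S g, S h) \<in> parcs ?L" unfolding LA using V by auto
      then show "e \<in> map_prod T T ` parcs ?L" using gh T V by (intro rev_image_eqI[of "(S g, S h)"]) auto
    qed
  qed
  then have "with_proj G = app_iso f (with_proj ?L)"
    unfolding app_iso_def f_def with_proj_def using LV TV by simp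
  then show ?thesis unfolding digraph_iso_def using iso by blast
qed

text \<open>An arc leaving \<open>x\<close> is recovered from the edge that carries it, so there are
  at most as many arcs as edges at \<open>x\<close>.\<close>

lemma max_degree_root_graph:
  assumes "finite V" "\<And>g. g \<in> V \<Longrightarrow> card (S g) = 2" and deg: "\<And>x. card {g \<in> V. x \<in> S g} \<le> k"
  shows "max_degree_le k (root_graph S V)"
  unfolding max_degree_le_def
proof
  fix x assume "x \<in> pverts (root_graph S V)"
  have sub: "out_arcs (with_proj (root_graph S V)) x \<subseteq> (\<lambda>g. (x, THE y. y \<in> S g \<and> y \<noteq> x)) ` {g \<in> V. x \<in> S g}"
  proof
    fix e assume "e \<in> out_arcs (with_proj (root_graph S V)) x"
    then obtain y g where e: "e = (x, y)" "x \<noteq> y" "g \<in> V" "S g = {x, y}" unfolding out_arcs_def root_graph_def by auto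
    then have "(THE y. y \<in> S g \<and> y \<noteq> x) = y" by auto
    then show "e \<in> (\<lambda>g. (x, THE y. y \<in> S g \<and> y \<noteq> x)) ` {g \<in> V. x \<in> S g}" using e by (intro rev_image_eqI[of g]) auto
  qed
  have fin: "finite {g \<in> V. x \<in> S g}" using assms(1) by simp
  have "out_degree (with_proj (root_graph S V)) x \<le> card ((\<lambda>g. (x, THE y. y \<in> S g \<and> y \<noteq> x)) ` {g \<in> V. x \<in> S g})"
    unfolding out_degree_def using card_mono[OF finite_imageI[OF fin] sub] .
  also have "\<dots> \<le> card {g \<in> V. x \<in> S g}" by (rule card_image_le[OF fin])
  finally show "out_degree (with_proj (root_graph S V)) x \<le> k" using deg[of x] by linarith
qed

lemma pawalk_path_arcs: "pcas x p y \<Longrightarrow> set p \<union> (set p)\<inverse> = path_arcs (pawalk_verts x p)"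
proof (induction p arbitrary: x)
  case (Cons e es)
  obtain z where e: "e = (x, z)" "pcas z es y" using Cons.prems by (cases e) auto
  obtain ys where ys: "pawalk_verts z es = z # ys" using e(2) by (cases es) auto
  have "set (e # es) \<union> (set (e # es))\<inverse> = {(x, z), (z, x)} \<union> (set es \<union> (set es)\<inverse>)" unfolding e by auto
  then show ?case using Cons.IH[OF e(2)] e(1) ys by simp
qed simp

lemma pawalk_verts_fst: "pcas x p y \<Longrightarrow> pawalk_verts x p = map fst p @ [y]"
  by (induction p arbitrary: x) auto

lemma pawalk_verts_snd: "pcas x p y \<Longrightarrow> pawalk_verts x p = x # map snd p"
  by (induction p arbitrary: x) auto

lemma undirected_cycle_verts:
  assumes "undirected_cycle H p"
  obtains us where "distinct us" "3 \<le> length us" "set p \<union> (set p)\<inverse> = path_arcs (us @ [hd us])" "fst ` set p \<union> snd ` set p = set us"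
proof -
  obtain u where u: "pre_digraph.awalk (with_proj H) u p u" "distinct (tl (pre_digraph.awalk_verts (with_proj H) u p))" and len: "3 \<le> length p"
    using assms unfolding undirected_cycle_def pre_digraph.cycle_def by blast
  have cas: "pcas u p u" and dist: "distinct (tl (pawalk_verts u p))"
    using u unfolding pre_digraph.awalk_def cas_with_proj_eq awalk_verts_with_proj_eq by auto
  let ?us = "map fst p"
  obtain e es where p: "p = e # es" using len by (cases p) auto
  have hd: "hd ?us = u" using cas p by auto
  have v: "pawalk_verts u p = ?us @ [hd ?us]" using pawalk_verts_fst[OF cas] hd by simp
  \<comment> \<open>\<open>cycle\<close> makes the heads of the arcs distinct, while
    \<open>us\<close> lists the tails. On a closed walk these lists are rotations of each
    other.\<close>
  have "mset (map snd p) = mset ?us"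
  proof -
    have "tl (?us @ [hd ?us]) = map snd p" using pawalk_verts_snd[OF cas] v by simp
    then have "map snd p = tl ?us @ [hd ?us]" using p by simp
    then show ?thesis using p by simp
  qed
  then have "distinct ?us" "snd ` set p = fst ` set p"
    using dist pawalk_verts_snd[OF cas] by (metis list.sel(3) mset_eq_imp_distinct_iff, metis list.set_map mset_eq_setD)
  then show ?thesis using that[of ?us] len pawalk_path_arcs[OF cas] v by simp
qed

text \<open>The converse of \<open>ipath_adj_iff\<close>.\<close>

lemma (in sym_rel) ipath_path_arcsI:
  assumes "distinct zs" "\<And>x y. x \<in> set zs \<Longrightarrow> y \<in> set zs \<Longrightarrow> x \<sim> y \<longleftrightarrow> (x, y) \<in> path_arcs zs"
  shows "ipath zs"
  using assms
proof (induction zs rule: path_arcs.induct)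
  case (1 x y zs)
  have sub: "a \<in> set (y # zs) \<and> b \<in> set (y # zs)" if "(a, b) \<in> path_arcs (y # zs)" for a b
    using path_arcs_subset[of "y # zs"] that by blast
  have "ipath (y # zs)"
  proof (rule "1.IH")
    show "distinct (y # zs)" using 1 by simp
    fix a b assume "a \<in> set (y # zs)" "b \<in> set (y # zs)"
    then show "a \<sim> b \<longleftrightarrow> (a, b) \<in> path_arcs (y # zs)" using "1.prems" by auto
  qed
  moreover have "x \<sim> y" using "1.prems"(2)[of x y] by simp
  moreover have "\<not> x \<sim> z" if "z \<in> set zs" for z
    using "1.prems" sub[of x z] that by auto
  ultimately show ?case using "1.prems"(1) by simp
qed auto

lemma (in sym_rel) conn_no_separation:
  assumes "conn (X \<union> Y)" "\<And>x y. x \<in> X \<Longrightarrow> y \<in> Y \<Longrightarrow> \<not> x \<sim> y" "x \<in> X" "y \<in> Y" "X \<inter> Y = {}"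
  shows False
proof -
  have "(x, y) \<in> {(a, b). a \<in> X \<union> Y \<and> b \<in> X \<union> Y \<and> a \<sim> b}\<^sup>*" using assms(1,3,4) unfolding conn_def by blast
  then have "y \<in> X"
  proof (induction rule: rtrancl_induct)
    case (step y z) then show ?case using assms(2) by blast
  qed (rule assms(3))
  then show False using assms(4,5) by blast
qed

lemma (in sym_rel) two_separationD:
  assumes "two_separation V a b X Y"
  shows "a \<in> V" "b \<in> V" "a \<noteq> b" "\<not> a \<sim> b" "X \<noteq> {}" "Y \<noteq> {}" "X \<inter> Y = {}" "X \<union> Y = V - {a, b}"
    "\<forall>x\<in>X. \<forall>y\<in>Y. \<not> x \<sim> y" "\<not> path_set (X \<union> {a, b}) a b" "\<not> path_set (Y \<union> {a, b}) a b"
  using assms by (simp_all add: two_separation_def)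

context pair_graph begin

lemma sym_rel_arcs: "sym_rel (\<lambda>x y. (x, y) \<in> parcs G)"
  by unfold_locales (auto intro: arcs_symmetric dest: no_loops')

text \<open>\<open>connected\<close> is strong connectivity of the symmetric closure, and here the
  arcs are already symmetric.\<close>

lemma connected_induced_conn:
  assumes "Digraph_Component.connected (with_proj G \<restriction> S)"
  shows "sym_rel.conn (\<lambda>x y. (x, y) \<in> parcs G) S"
proof -
  interpret sym_rel "\<lambda>x y. (x, y) \<in> parcs G" by (rule sym_rel_arcs)
  let ?M = "mk_symmetric (with_proj G \<restriction> S)"
  have M: "pverts ?M = S" "parcs ?M \<subseteq> {(a, b). a \<in> S \<and> b \<in> S \<and> (a, b) \<in> parcs G}"
    unfolding mk_symmetric_def by (auto intro: arcs_symmetric)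
  show ?thesis unfolding conn_def
  proof (intro ballI)
    fix x y assume "x \<in> S" "y \<in> S"
    then have "x \<rightarrow>\<^sup>*\<^bsub>with_proj ?M\<^esub> y"
      using assms M(1) unfolding Digraph_Component.connected_def strongly_connected_def by simp
    then have "(x, y) \<in> (parcs ?M)\<^sup>*" using reachable_rtranclI by fastforce
    then show "(x, y) \<in> {(a, b). a \<in> S \<and> b \<in> S \<and> (a, b) \<in> parcs G}\<^sup>*" using rtrancl_mono[OF M(2)] by blast
  qed
qed

lemma path_between_path_set:
  assumes "is_path_between (with_proj G \<restriction> S) a b"
  shows "sym_rel.path_set (\<lambda>x y. (x, y) \<in> parcs G) S a b"
proof -
  interpret sym_rel "\<lambda>x y. (x, y) \<in> parcs G" by (rule sym_rel_arcs)
  let ?H = "\<lparr>pverts = S, parcs = {e \<in> parcs G. fst e \<in> S \<and> snd e \<in> S}\<rparr>"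
  have H: "with_proj G \<restriction> S = with_proj ?H" by (simp add: with_proj_def induce_subgraph_def)
  obtain p where p: "pre_digraph.apath (with_proj ?H) a p b" "S = set (pawalk_verts a p)"
    "{e \<in> parcs G. fst e \<in> S \<and> snd e \<in> S} = set p \<union> (set p)\<inverse>"
    using assms unfolding is_path_between_def H by (auto simp: awalk_verts_with_proj_eq)
  have cas: "pcas a p b" and d: "distinct (pawalk_verts a p)"
    using p(1) unfolding pre_digraph.apath_def pre_digraph.awalk_def cas_with_proj_eq awalk_verts_with_proj_eq by auto
  let ?zs = "pawalk_verts a p"
  have "ipath ?zs"
  proof (rule ipath_path_arcsI[OF d])
    fix x y assume "x \<in> set ?zs" "y \<in> set ?zs"
    then have "(x, y) \<in> parcs G \<longleftrightarrow> (x, y) \<in> set p \<union> (set p)\<inverse>" unfolding p(3)[symmetric] p(2)[symmetric] by simp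
    then show "(x, y) \<in> parcs G \<longleftrightarrow> (x, y) \<in> path_arcs ?zs" using pawalk_path_arcs[OF cas] by simp
  qed
  moreover have "?zs \<noteq> []" "hd ?zs = a" unfolding pawalk_verts_snd[OF cas] by simp_all
  moreover have "last ?zs = b" unfolding pawalk_verts_fst[OF cas] by simp
  ultimately show ?thesis unfolding path_set_def using p(2) by blast
qed

end

theorem theorem1p2:
  fixes G :: "'a pair_pre_digraph"
  assumes "pair_graph G"
    and "ISK4_wheel_free G"
  shows "series_parallel G
       \<or> line_graph_of_chordless_subcubic G
       \<or> complete_bipartite G
       \<or> (has_clique_cutset G \<or> has_proper_2_cutset G)"
proof (rule ccontr)
  assume not: "\<not> ?thesis"
  interpret pair_graph G by (rule assms(1))
  let ?E = "\<lambda>x y. (x, y) \<in> parcs G"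
  let ?V = "pverts G"
  interpret R: sym_rel ?E by (rule sym_rel_arcs)
  interpret R: no_clique_cutset_rel ?E ?V
  proof unfold_locales
    show "finite ?V" by (rule pair_finite_verts)
    show "x \<in> ?V" if "(x, y) \<in> parcs G" for x y using that by (rule in_arcsD1)
    show "\<not> spider ?E S" if "S \<subseteq> ?V" for S
      using spider_has_ISK4[OF _ that] assms(2) unfolding ISK4_wheel_free_def by blast
    show "card {u \<in> insert x (set xs). (v, u) \<in> parcs G} \<le> 2"
      if "R.hole_at x xs" "insert v (insert x (set xs)) \<subseteq> ?V" "v \<notin> insert x (set xs)" for x xs v
      using hole_has_wheel[OF that] assms(2) unfolding ISK4_wheel_free_def by linarith
    show "R.conn (?V - K)" if K: "K \<subseteq> ?V" "\<And>x y. x \<in> K \<Longrightarrow> y \<in> K \<Longrightarrow> x \<noteq> y \<Longrightarrow> (x, y) \<in> parcs G" for K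
    proof (cases "?V - K = {}")
      case True
      \<comment> \<open>Deleting all vertices never counts as disconnecting, so the absence of
        clique-cutsets says nothing here; the convention for \<open>conn\<close> covers the
        case.\<close>
      show ?thesis unfolding True by (rule R.conn_empty)
    next
      case False
      have "\<not> cutset G K" using not K unfolding has_clique_cutset_def clique_def by blast
      then have "Digraph_Component.connected (with_proj G \<restriction> (?V - K))"
        using K(1) False unfolding cutset_def disconnected_def by simp
      then show ?thesis by (rule connected_induced_conn)
    qed
  qed
  show False
  proof (cases "\<exists>v n1 n2 n3. ?E v n1 \<and> ?E v n2 \<and> ?E v n3 \<and> distinct [n1, n2, n3] \<and> \<not> ?E n1 n2 \<and> \<not> ?E n1 n3 \<and> \<not> ?E n2 n3")
    case True
    then obtain v n1 n2 n3 where "?E v n1" "?E v n2" "?E v n3" "distinct [n1, n2, n3]" "\<not> ?E n1 n2" "\<not> ?E n1 n3" "\<not> ?E n2 n3"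
      by blast
    from R.claw_structure[OF this] show False
    proof (elim disjE exE conjE)
      fix A B assume bip: "R.bip A B" "A \<union> B = ?V" "A \<noteq> {}" "B \<noteq> {}"
      have fin: "finite A" "finite B" using bip(2) pair_finite_verts by (metis finite_Un)+
      have "parcs G = A \<times> B \<union> B \<times> A"
      proof
        show "parcs G \<subseteq> A \<times> B \<union> B \<times> A"
        proof
          fix e assume e: "e \<in> parcs G"
          obtain x y where xy: "e = (x, y)" by (cases e)
          have "x \<in> A \<union> B" "y \<in> A \<union> B" using e xy in_arcsD1 in_arcsD2 bip(2) by blast+
          then show "e \<in> A \<times> B \<union> B \<times> A" using e xy bip(1) unfolding R.bip_def by auto
        qed
        show "A \<times> B \<union> B \<times> A \<subseteq> parcs G" using bip(1) arcs_symmetric unfolding R.bip_def by auto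
      qed
      moreover have "A \<inter> B = {}" using bip(1) unfolding R.bip_def by (elim conjE)
      ultimately have "complete_bipartite_digraph (card A) (card B) (with_proj G)"
        unfolding complete_bipartite_digraph_pair_def using bip(2) pair_finite_verts
        by (intro conjI exI[of _ A] exI[of _ B]) simp_all
      moreover have "0 < card A" "0 < card B" using fin bip(3,4) by (simp_all add: card_gt_0_iff)
      ultimately show False using not unfolding complete_bipartite_def by blast
    next
      fix a b X Y assume sep: "R.two_separation ?V a b X Y"
      note s = R.two_separationD[OF sep]
      have "\<not> Digraph_Component.connected (with_proj G \<restriction> (?V - {a, b}))"
      proof
        assume "Digraph_Component.connected (with_proj G \<restriction> (?V - {a, b}))"
        then have "R.conn (X \<union> Y)" unfolding s(8)[symmetric] by (rule connected_induced_conn)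
        then show False using R.conn_no_separation[of X Y] s(5-7,9) by blast
      qed
      then have cut: "cutset G {a, b}" unfolding cutset_def disconnected_def using s(1,2,5,8) by auto
      have "proper_2_cutset G a b" unfolding proper_2_cutset_def
      proof (rule conjI[OF s(3) conjI[OF s(4) conjI[OF cut]]], rule exI[of _ X], rule exI[of _ Y], intro conjI)
        show "\<not> is_path_between (with_proj G \<restriction> (X \<union> {a, b})) a b" using s(10) path_between_path_set by blast
        show "\<not> is_path_between (with_proj G \<restriction> (Y \<union> {a, b})) a b" using s(11) path_between_path_set by blast
      qed (rule s)+
      then show False using not unfolding has_proper_2_cutset_def by blast
    next
      fix a b assume deg: "\<forall>x\<in>?V - {a, b}. card {y. ?E x y} \<le> 2"
      have "series_parallel G" unfolding series_parallel_def
      proof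
        assume "\<exists>H :: 'a pair_pre_digraph. subgraph (with_proj H) (with_proj G) \<and> K4_subdivision H"
        then obtain H :: "'a pair_pre_digraph" where H: "subgraph (with_proj H) (with_proj G)" "K4_subdivision H" by blast
        have sub: "pverts H \<subseteq> ?V" "parcs H \<subseteq> parcs G" using H(1) unfolding subgraph_def by auto
        obtain B where B: "B \<subseteq> pverts H" "card B = 4" "\<forall>b\<in>B. finite {y. (b, y) \<in> parcs H} \<longrightarrow> 3 \<le> card {y. (b, y) \<in> parcs H}"
          using K4_subdivision_degree_three[OF H(2)] by blast
        \<comment> \<open>Four branch vertices, but only two vertices of \<open>G\<close> can have
          degree three.\<close>
        have "card {a, b} < card B" using B(2) by (simp add: card_insert_if)
        then have "\<not> B \<subseteq> {a, b}" by (meson card_mono finite.emptyI finite.insertI leD)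
        then obtain x where x: "x \<in> B" "x \<noteq> a" "x \<noteq> b" by blast
        have fin: "finite {y. ?E x y}" using finite_subset[OF _ pair_finite_verts, of "{y. ?E x y}"] in_arcsD2 by blast
        have s: "{y. (x, y) \<in> parcs H} \<subseteq> {y. ?E x y}" using sub(2) by blast
        have "3 \<le> card {y. (x, y) \<in> parcs H}" using B(3) x(1) finite_subset[OF s fin] by blast
        also have "\<dots> \<le> card {y. ?E x y}" by (rule card_mono[OF fin s])
        also have "\<dots> \<le> 2" using deg x B(1) sub(1) by blast
        finally show False by simp
      qed
      then show False using not by blast
    qed
  next
    case False
    obtain S :: "'a \<Rightarrow> nat set" where S: "\<forall>g\<in>?V. card (S g) = 2" "inj_on S ?V"
      "\<forall>g\<in>?V. \<forall>h\<in>?V. g \<noteq> h \<longrightarrow> (?E g h \<longleftrightarrow> S g \<inter> S h \<noteq> {})" "\<forall>x. card {g \<in> ?V. x \<in> S g} \<le> 3"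
      using R.claw_free_root False by blast
    let ?H = "root_graph S ?V"
    interpret H: pair_graph ?H by (rule pair_graph_root_graph) (use pair_finite_verts S(1) in auto)
    have "chordless_graph ?H"
      unfolding chordless_graph_def chordless_cycle_def
    proof (intro allI impI conjI)
      fix p assume cyc: "undirected_cycle ?H p"
      then show "undirected_cycle ?H p" .
      \<comment> \<open>From the arc walk back to a vertex list, so that \<open>rim_no_chord\<close>
        identifies the arcs among the cycle vertices with the cycle edges.\<close>
      obtain us where us: "distinct us" "3 \<le> length us" "set p \<union> (set p)\<inverse> = path_arcs (us @ [hd us])" "fst ` set p \<union> snd ` set p = set us"
        by (rule undirected_cycle_verts[OF cyc])
      have "set p \<subseteq> parcs ?H" using cyc unfolding undirected_cycle_def pre_digraph.cycle_def pre_digraph.awalk_def by auto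
      then have arcs: "path_arcs (us @ [hd us]) \<subseteq> parcs ?H" unfolding us(3)[symmetric] using H.arcs_symmetric by auto
      have C: "graph_of_arcs p = \<lparr>pverts = set us, parcs = path_arcs (us @ [hd us])\<rparr>"
        unfolding graph_of_arcs_def us(3,4) ..
      have sub: "set us \<subseteq> pverts ?H"
      proof -
        have "fst ` set p \<union> snd ` set p \<subseteq> pverts ?H" using \<open>set p \<subseteq> parcs ?H\<close> H.in_arcsD1 H.in_arcsD2 by fastforce
        then show ?thesis unfolding us(4) .
      qed
      have "path_arcs (us @ [hd us]) = {e \<in> parcs ?H. fst e \<in> set us \<and> snd e \<in> set us}"
      proof
        have "set (us @ [hd us]) = set us" using us(2) by (cases us) auto
        then have "path_arcs (us @ [hd us]) \<subseteq> set us \<times> set us" using path_arcs_subset[of "us @ [hd us]"] by simp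
        then show "path_arcs (us @ [hd us]) \<subseteq> {e \<in> parcs ?H. fst e \<in> set us \<and> snd e \<in> set us}" using arcs by auto
        show "{e \<in> parcs ?H. fst e \<in> set us \<and> snd e \<in> set us} \<subseteq> path_arcs (us @ [hd us])"
          using R.rim_no_chord[of S us, OF _ S(2) _ us(1,2) arcs] S(1,3) by auto
      qed
      then have "with_proj (graph_of_arcs p) = with_proj ?H \<restriction> set us"
        unfolding C by (simp add: with_proj_def induce_subgraph_def)
      then show "induced_subgraph (with_proj (graph_of_arcs p)) (with_proj ?H)"
        using H.induced_induce[OF sub] by simp
    qed
    moreover have "max_degree_le 3 ?H" by (rule max_degree_root_graph) (use pair_finite_verts S(1,4) in auto)
    moreover have "digraph_iso (with_proj (line_graph ?H)) (with_proj G)"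
      by (rule line_graph_of_root) (use S in auto)
    ultimately have "line_graph_of_chordless_subcubic G"
      unfolding line_graph_of_chordless_subcubic_def using H.pair_graph by blast
    then show False using not by blast
  qed
qed

end
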